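(* Let $n, d \geq 3$ be integers. Then \[ \operatorname{Ork}(n,d) \leq \binom{n+d-2}{d-1} - \binom{n+d-6}{d-3}. \]
   Context: Let $k$ be an algebraically closed field of characteristic $0$. For $n \ge 1$ let $S = k[x_1,\dots,x_n]$ and let $S_d$ be the space of homogeneous polynomials (forms) of degree $d$ in $S$. The space $S_1$ of linear forms is regarded as the affine space $\mathbb{A}^n$ over $k$ with its Zariski topology. A closed subset $V\subsetneq S_1$ is called homogeneous if it is the zero set of a set of homogeneous polynomials, i.e. it is stable under multiplication by scalars (the empty set is allowed). A form $F \in S_d$ essentially depends on $n$ variables if it cannot be written using fewer than $n$ variables after a linear change of coordinates. For $F \in S_d$ and $V \subseteq S_1$, let $\operatorname{Ork}(F,V)$ be the minimal natural number $m$ such that there is a presentation $F = \sum_{i=1}^m l_i^d$ with all $l_i \in S_1 \setminus V$, and $\operatorname{Ork}(F,V) = \infty$ if no such presentation exists. The open Waring rank of $F$ is \[ \operatorname{Ork}(F) = \sup\{\operatorname{Ork}(F,V) \mid V \subsetneq S_1 \text{ homogeneous and Zariski closed}\}, \] and \[ \operatorname{Ork}(n,d) = \sup\{\operatorname{Ork}(F) \mid F \in S_d \text{ essentially depends on } n \text{ variables}\}, \] where $S = k[x_1,\dots,x_n]$. *)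

theory Defs
  imports
    "HOL-Library.Poly_Mapping"
    "HOL-Library.Extended_Nat"
    "HOL-Computational_Algebra.Polynomial"
    "Jordan_Normal_Form.Matrix"
begin

text \<open>
  Multivariate polynomials are finitely supported maps from exponent vectors to coefficients;
  the ring structure is the convolution product of \<^theory>\<open>HOL-Library.Poly_Mapping\<close>.
  The variables are indexed by the natural numbers, and the ring in \<open>n\<close> variables consists of
  the polynomials all of whose variables have an index below \<open>n\<close>.
\<close>

type_synonym 'a mvpoly = "(nat \<Rightarrow>\<^sub>0 nat) \<Rightarrow>\<^sub>0 'a"

definition mvconst :: "'a::zero \<Rightarrow> 'a mvpoly" where
  "mvconst c = Poly_Mapping.single 0 c"

definition mvvar :: "nat \<Rightarrow> 'a::zero_neq_one mvpoly" where
  "mvvar i = Poly_Mapping.single (Poly_Mapping.single i 1) 1"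

definition mvvars :: "'a::zero mvpoly \<Rightarrow> nat set" where
  "mvvars p = (\<Union>m\<in>Poly_Mapping.keys p. Poly_Mapping.keys m)"

definition mon_degree :: "(nat \<Rightarrow>\<^sub>0 nat) \<Rightarrow> nat" where
  "mon_degree m = (\<Sum>i\<in>Poly_Mapping.keys m. Poly_Mapping.lookup m i)"

definition mveval :: "(nat \<Rightarrow> 'a) \<Rightarrow> 'a::comm_semiring_1 mvpoly \<Rightarrow> 'a" where
  "mveval a p = (\<Sum>m\<in>Poly_Mapping.keys p. Poly_Mapping.lookup p m *
     (\<Prod>i\<in>Poly_Mapping.keys m. a i ^ Poly_Mapping.lookup m i))"

definition mvsubst :: "(nat \<Rightarrow> 'a mvpoly) \<Rightarrow> 'a::comm_semiring_1 mvpoly \<Rightarrow> 'a mvpoly" where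
  "mvsubst s p = (\<Sum>m\<in>Poly_Mapping.keys p. mvconst (Poly_Mapping.lookup p m) *
     (\<Prod>i\<in>Poly_Mapping.keys m. s i ^ Poly_Mapping.lookup m i))"

text \<open>The space of forms of degree \<open>d\<close> in \<open>n\<close> variables; as a vector space, it contains \<open>0\<close>.\<close>

definition forms :: "nat \<Rightarrow> nat \<Rightarrow> 'a::zero mvpoly set" where
  "forms n d = {p. mvvars p \<subseteq> {..<n} \<and> (\<forall>m\<in>Poly_Mapping.keys p. mon_degree m = d)}"

definition linear_coord :: "'a::zero mvpoly \<Rightarrow> nat \<Rightarrow> 'a" where
  "linear_coord l i = Poly_Mapping.lookup l (Poly_Mapping.single i 1)"

text \<open>
  Linear forms are points of affine \<open>n\<close>-space via their coefficients, so a polynomial in \<open>n\<close>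
  variables is a function on the space of linear forms. In the definition of homogeneous closed
  subsets, the degree may vary with the equation; degree \<open>0\<close> is included, which makes the
  empty set homogeneous and closed.
\<close>

definition linear_zero_set :: "nat \<Rightarrow> 'a::comm_semiring_1 mvpoly set \<Rightarrow> 'a mvpoly set" where
  "linear_zero_set n P = {l \<in> forms n 1. \<forall>p\<in>P. mveval (linear_coord l) p = 0}"

definition homogeneous_closed :: "nat \<Rightarrow> 'a::comm_semiring_1 mvpoly set \<Rightarrow> bool" where
  "homogeneous_closed n V \<longleftrightarrow> (\<exists>P \<subseteq> (\<Union>e. forms n e). V = linear_zero_set n P)"

definition linear_change :: "nat \<Rightarrow> 'a::comm_semiring_1 mat \<Rightarrow> 'a mvpoly \<Rightarrow> 'a mvpoly" where
  "linear_change n A p = mvsubst (\<lambda>i. \<Sum>j<n. mvconst (A $$ (i, j)) * mvvar j) p"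

definition essentially_depends :: "nat \<Rightarrow> 'a::comm_semiring_1 mvpoly \<Rightarrow> bool" where
  "essentially_depends n F \<longleftrightarrow>
     \<not> (\<exists>A\<in>carrier_mat n n. invertible_mat A \<and> card (mvvars (linear_change n A F)) < n)"

text \<open>The infimum of the empty set in \<^typ>\<open>enat\<close> is \<open>\<infinity>\<close>.\<close>

definition Ork_avoiding ::
    "nat \<Rightarrow> nat \<Rightarrow> 'a::comm_semiring_1 mvpoly \<Rightarrow> 'a mvpoly set \<Rightarrow> enat" where
  "Ork_avoiding n d F V =
     Inf {enat m | m. \<exists>l. (\<forall>i<m. l i \<in> forms n 1 - V) \<and> F = (\<Sum>i<m. l i ^ d)}"

definition Ork_form :: "nat \<Rightarrow> nat \<Rightarrow> 'a::comm_semiring_1 mvpoly \<Rightarrow> enat" where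
  "Ork_form n d F = Sup {Ork_avoiding n d F V | V. V \<subset> forms n 1 \<and> homogeneous_closed n V}"

definition Ork :: "'a::comm_semiring_1 itself \<Rightarrow> nat \<Rightarrow> nat \<Rightarrow> enat" where
  "Ork _ n d = Sup {Ork_form n d F | F :: 'a mvpoly. F \<in> forms n d \<and> essentially_depends n F}"

end

theory Submission
  imports Defs "HOL-Library.Function_Algebras" "Jordan_Normal_Form.Determinant"
begin

text \<open>
  We show by induction that a form \<open>F\<close> of degree \<open>d\<close> with exactly \<open>n\<close> essential variables is a sum of
  at most \<open>B(n, d)\<close> powers of linear forms outside a given cone \<open>{h = 0}\<close>, where \<open>B\<close> satisfies the
  recursion \<open>B(n, d) = B(n, d - 1) + B(n - 1, d)\<close>, except for \<open>B(3, 3) = 5\<close>.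

  Choose a direction \<open>\<alpha>\<close> and write the derivative \<open>\<alpha>F\<close> as a sum of powers of \<open>l\<^sub>i\<close> with
  \<open>\<alpha>(l\<^sub>i) \<noteq> 0\<close>. Integrating, \<open>F\<close> is a combination of the \<open>l\<^sub>i\<^sup>d\<close> plus a form \<open>G\<close> on the
  hyperplane \<open>\<alpha> = 0\<close>. If \<open>G\<close> needs fewer than \<open>n - 1\<close> variables, its space of variables may lie inside
  the cone; in that case one of the powers \<open>l\<^sub>i\<^sup>d\<close> is moved over to \<open>G\<close>, which adds a variable outside of
  the cone and saves a summand. The derivative itself need not have \<open>n\<close> essential variables for any
  \<open>\<alpha>\<close> (its Hessian may vanish), but for general \<open>\<alpha>\<close> either its variables are not contained in the
  cone, or there are at most \<open>n - 2\<close> of them, because the cone contains only finitely many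
  hyperplanes. In the second case we subtract the power of a general linear form.

  For ternary cubics with nondegenerate \<open>\<alpha>F\<close> we pass to the normal form
  \<open>x\<^sup>3 + 3x(y\<^sup>2 + z\<^sup>2) + C(y, z)\<close> and write down five cubes.
\<close>

section \<open>Generic points of vector spaces\<close>

text \<open>Avoiding a cone is part of the induction because integrating the (d-1)-st power of l
  divides by \<alpha>(l): the decomposition of the derivative \<alpha>F has to avoid the zeros of h
  times \<alpha>. One function h can stand for the closed set, since a proper closed set lies in the
  zero set of one of its equations. The number of variables is not predictable, neither for
  \<alpha>F nor for the remainder G; therefore forms are treated without coordinates, each with its
  own subspace of essential variables.

  Pascal's recursion with boundary value 1 alone would give binom(n+d-2, d-1), which is 6 for n = d
  = 3. The value 5 at this place lowers all later values, and the loss spreads by the same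
  recursion: it is the subtracted binomial coefficient. Quadrics and binary forms are not affected.

  Algebraic closedness serves to normalise ternary cubics, to split one cubic polynomial in one
  variable and to absorb the coefficients into the powers.\<close>

definition polynomial_fun :: "('a::comm_ring_1 \<Rightarrow> 'a) \<Rightarrow> bool" where
  "polynomial_fun f \<longleftrightarrow> (\<exists>p. \<forall>t. f t = poly p t)"

named_theorems poly_intros

lemma polynomial_fun_const [poly_intros]: "polynomial_fun (\<lambda>t. c)"
  unfolding polynomial_fun_def by (rule exI[of _ "[:c:]"]) simp

lemma polynomial_fun_ident [poly_intros]: "polynomial_fun (\<lambda>t. t)"
  unfolding polynomial_fun_def by (rule exI[of _ "[:0, 1:]"]) simp

lemma polynomial_fun_add [poly_intros]:
  "polynomial_fun f \<Longrightarrow> polynomial_fun g \<Longrightarrow> polynomial_fun (\<lambda>t. f t + g t)"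
  unfolding polynomial_fun_def by (metis poly_add)

lemma polynomial_fun_diff [poly_intros]:
  "polynomial_fun f \<Longrightarrow> polynomial_fun g \<Longrightarrow> polynomial_fun (\<lambda>t. f t - g t)"
  unfolding polynomial_fun_def by (metis poly_diff)

lemma polynomial_fun_mult [poly_intros]:
  "polynomial_fun f \<Longrightarrow> polynomial_fun g \<Longrightarrow> polynomial_fun (\<lambda>t. f t * g t)"
  unfolding polynomial_fun_def by (metis poly_mult)

lemma polynomial_fun_power [poly_intros]:
  "polynomial_fun f \<Longrightarrow> polynomial_fun (\<lambda>t. f t ^ n)"
  unfolding polynomial_fun_def by (metis poly_power)

lemma polynomial_fun_sum [poly_intros]:
  "(\<And>i. i \<in> I \<Longrightarrow> polynomial_fun (f i)) \<Longrightarrow> polynomial_fun (\<lambda>t. \<Sum>i\<in>I. f i t)"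
  by (induction I rule: infinite_finite_induct) (auto intro!: poly_intros)

lemma polynomial_fun_prod [poly_intros]:
  "(\<And>i. i \<in> I \<Longrightarrow> polynomial_fun (f i)) \<Longrightarrow> polynomial_fun (\<lambda>t. \<Prod>i\<in>I. f i t)"
  by (induction I rule: infinite_finite_induct) (auto intro!: poly_intros)

lemma polynomial_fun_finite_zeros:
  fixes f :: "'a::idom \<Rightarrow> 'a"
  assumes "polynomial_fun f" "f t \<noteq> 0"
  shows "finite {t. f t = 0}"
proof -
  obtain p where p: "\<And>t. f t = poly p t" using assms(1) by (auto simp: polynomial_fun_def)
  have "p \<noteq> 0" using assms(2) p by auto
  then show ?thesis using poly_roots_finite[of p] by (simp add: p)
qed

lemma polynomial_fun_common_nonzero:
  fixes f g :: "'a::field_char_0 \<Rightarrow> 'a"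
  assumes "polynomial_fun f" "f s \<noteq> 0" "polynomial_fun g" "g t \<noteq> 0"
  obtains x where "f x \<noteq> 0" "g x \<noteq> 0"
proof -
  have "finite ({t. f t = 0} \<union> {t. g t = 0})"
    using polynomial_fun_finite_zeros[OF assms(1,2)] polynomial_fun_finite_zeros[OF assms(3,4)] by simp
  from ex_new_if_finite[OF infinite_UNIV_char_0 this]
  obtain x where "x \<notin> {t. f t = 0} \<union> {t. g t = 0}" by blast
  then show ?thesis using that by auto
qed

locale vspace = vector_space scale
  for scale :: "'a::field_char_0 \<Rightarrow> 'b::ab_group_add \<Rightarrow> 'b"
begin

text \<open>A stand-in for nonempty Zariski open sets: polynomiality along lines already suffices for
  finitely many generic conditions to have a common point.\<close>

definition generic :: "'b set \<Rightarrow> ('b \<Rightarrow> bool) \<Rightarrow> bool" where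
  "generic S P \<longleftrightarrow> (\<exists>g. (\<forall>p\<in>S. \<forall>q\<in>S. polynomial_fun (\<lambda>t. g (p + scale t q))) \<and>
     (\<exists>p\<in>S. g p \<noteq> 0) \<and> (\<forall>p\<in>S. g p \<noteq> 0 \<longrightarrow> P p))"

lemma genericI:
  assumes "\<And>p q. p \<in> S \<Longrightarrow> q \<in> S \<Longrightarrow> polynomial_fun (\<lambda>t. g (p + scale t q))"
    and "p \<in> S" "g p \<noteq> 0"
  shows "generic S (\<lambda>p. g p \<noteq> 0)"
  using assms unfolding generic_def by (intro exI[of _ g]) auto

lemma generic_ex: "generic S P \<Longrightarrow> \<exists>p\<in>S. P p"
  unfolding generic_def by auto

lemma generic_mono: "generic S P \<Longrightarrow> (\<And>p. p \<in> S \<Longrightarrow> P p \<Longrightarrow> Q p) \<Longrightarrow> generic S Q"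
  unfolding generic_def by (elim exE conjE, rule_tac x = g in exI) auto

text \<open>A point good for f and a point good for g are joined by a line in S; on it both
  functions are nonzero polynomials in the parameter, and the field is infinite.\<close>

lemma generic_conj:
  assumes S: "subspace S" and "generic S P" "generic S Q"
  shows "generic S (\<lambda>p. P p \<and> Q p)"
proof -
  obtain f where f: "\<forall>p\<in>S. \<forall>q\<in>S. polynomial_fun (\<lambda>t. f (p + scale t q))"
    "\<exists>p\<in>S. f p \<noteq> 0" "\<forall>p\<in>S. f p \<noteq> 0 \<longrightarrow> P p"
    using assms(2) unfolding generic_def by blast
  obtain g where g: "\<forall>p\<in>S. \<forall>q\<in>S. polynomial_fun (\<lambda>t. g (p + scale t q))"
    "\<exists>p\<in>S. g p \<noteq> 0" "\<forall>p\<in>S. g p \<noteq> 0 \<longrightarrow> Q p"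
    using assms(3) unfolding generic_def by blast
  obtain p q where p: "p \<in> S" "f p \<noteq> 0" and q: "q \<in> S" "g q \<noteq> 0" using f(2) g(2) by blast
  have d: "q - p \<in> S" using S p(1) q(1) by (simp add: subspace_diff)
  have *: "f (p + scale 0 (q - p)) \<noteq> 0" "g (p + scale 1 (q - p)) \<noteq> 0" using p q by simp_all
  obtain t where t: "f (p + scale t (q - p)) \<noteq> 0" "g (p + scale t (q - p)) \<noteq> 0"
    using polynomial_fun_common_nonzero[of "\<lambda>t. f (p + scale t (q - p))" 0
        "\<lambda>t. g (p + scale t (q - p))" 1] f(1) g(1) p(1) d * by blast
  have m: "p + scale t (q - p) \<in> S" using S p(1) d by (simp add: subspace_add subspace_scale)
  show ?thesis
    unfolding generic_def
  proof (intro exI conjI)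
    show "\<forall>p\<in>S. \<forall>q\<in>S. polynomial_fun (\<lambda>t. f (p + scale t q) * g (p + scale t q))"
      by (intro ballI polynomial_fun_mult) (use f(1) g(1) in simp_all)
    show "\<exists>x\<in>S. f x * g x \<noteq> 0" using t m by (intro bexI) simp_all
    show "\<forall>p\<in>S. f p * g p \<noteq> 0 \<longrightarrow> P p \<and> Q p" using f(3) g(3) by simp
  qed
qed

lemma generic_true: "subspace S \<Longrightarrow> generic S (\<lambda>_. True)"
  unfolding generic_def
  by (intro exI[of _ "\<lambda>_. 1"]) (auto intro!: poly_intros dest: subspace_0)

lemma generic_ball:
  assumes "subspace S" "finite I" "\<And>i. i \<in> I \<Longrightarrow> generic S (P i)"
  shows "generic S (\<lambda>p. \<forall>i\<in>I. P i p)"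
  using assms(2,3)
proof (induction I rule: finite_induct)
  case empty
  then show ?case using generic_true[OF assms(1)] by simp
next
  case (insert i I)
  then show ?case
    using generic_conj[OF assms(1), of "P i" "\<lambda>p. \<forall>i\<in>I. P i p"] by auto
qed

text \<open>The space of all polynomials is infinite-dimensional, so a finite basis is made part of
  the notion of dimension.\<close>

definition has_dim :: "'b set \<Rightarrow> nat \<Rightarrow> bool" where
  "has_dim U n \<longleftrightarrow> (\<exists>B. independent B \<and> finite B \<and> card B = n \<and> span B = U)"

lemma has_dim_unique: "has_dim U m \<Longrightarrow> has_dim U n \<Longrightarrow> m = n"
  unfolding has_dim_def using dim_eq_card by metis

lemma has_dim_subspace: "has_dim U n \<Longrightarrow> subspace U"
  unfolding has_dim_def using subspace_span by blast

lemma has_dim_span: "independent B \<Longrightarrow> finite B \<Longrightarrow> has_dim (span B) (card B)"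
  unfolding has_dim_def by auto

lemma has_dim_subset:
  assumes U: "has_dim U n" and W: "subspace W" "W \<subseteq> U"
  obtains m where "has_dim W m" "m \<le> n" "W \<noteq> U \<Longrightarrow> m < n"
proof -
  obtain B where B: "independent B" "finite B" "card B = n" "span B = U"
    using U by (auto simp: has_dim_def)
  obtain C where C: "C \<subseteq> W" "independent C" "W \<subseteq> span C"
    by (rule maximal_independent_subset)
  have CW: "span C = W" using span_minimal[OF C(1) W(1)] C(3) by simp
  have b: "finite C \<and> card C \<le> n" using independent_span_bound[OF B(2) C(2)] B(3,4) C(1) W(2) by simp
  have "card C < n" if neq: "W \<noteq> U"
  proof -
    obtain u where u: "u \<in> U" "u \<notin> W" using neq W(2) by blast
    have "independent (insert u C)" using C CW u by (simp add: independent_insertI)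
    moreover have "insert u C \<subseteq> span B" using u C(1) W(2) B(4) by simp
    ultimately have "card (insert u C) \<le> n" using independent_span_bound[OF B(2)] B(3) by simp
    moreover have "u \<notin> C" using u C(1) by blast
    ultimately show ?thesis using b by simp
  qed
  then show ?thesis using that[of "card C"] b C(2) CW unfolding has_dim_def by auto
qed

lemma has_dim_insert:
  assumes W: "has_dim W m" and v: "v \<notin> W"
  shows "has_dim (span (insert v W)) (Suc m)"
proof -
  obtain B where B: "independent B" "finite B" "card B = m" "span B = W"
    using W by (auto simp: has_dim_def)
  have "independent (insert v B)" using B v by (simp add: independent_insertI)
  moreover have "v \<notin> B" using B v span_base by blast
  moreover have "span (insert v B) = span (insert v W)"
    unfolding B(4)[symmetric] by (simp add: span_insert span_span)
  ultimately show ?thesis unfolding has_dim_def using B by (intro exI[of _ "insert v B"]) auto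
qed

lemma has_dim_zeroD: "has_dim U 0 \<Longrightarrow> U = {0}"
  unfolding has_dim_def by auto

end

section \<open>Forms as multilinear functions on the dual space\<close>

text \<open>Linear forms live in \<open>'b\<close>, directions of differentiation in
  \<open>'x\<close>. Duality enters through \<open>separation\<close>. Directions that pair to zero
  with everything are not excluded, so equality of directions is replaced by \<open>null U\<close>
  of their difference.\<close>

locale dual_pair = E: vspace scaleE + X: vspace scaleX
  for scaleE :: "'a::{alg_closed_field,field_char_0} \<Rightarrow> 'b::ab_group_add \<Rightarrow> 'b" (infixr "\<cdot>" 75)
    and scaleX :: "'a \<Rightarrow> 'x::ab_group_add \<Rightarrow> 'x" (infixr "\<odot>" 75) +
  fixes pr :: "'x \<Rightarrow> 'b \<Rightarrow> 'a"
  assumes pr_add_left: "pr (\<xi> + \<eta>) u = pr \<xi> u + pr \<eta> u"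
    and pr_scale_left: "pr (c \<odot> \<xi>) u = c * pr \<xi> u"
    and pr_add_right: "pr \<xi> (u + v) = pr \<xi> u + pr \<xi> v"
    and pr_scale_right: "pr \<xi> (c \<cdot> u) = c * pr \<xi> u"
    and separation: "E.subspace W \<Longrightarrow> v \<notin> W \<Longrightarrow> \<exists>\<xi>. (\<forall>w\<in>W. pr \<xi> w = 0) \<and> pr \<xi> v = 1"
begin

lemma pr_zero_right [simp]: "pr \<xi> 0 = 0"
  using pr_scale_right[of \<xi> 0 0] by simp

lemma pr_zero_left [simp]: "pr 0 u = 0"
  using pr_scale_left[of 0 0 u] by simp

lemma pr_minus_left: "pr (- \<xi>) u = - pr \<xi> u"
  using pr_add_left[of \<xi> "- \<xi>" u] by (simp add: eq_neg_iff_add_eq_0 add.commute)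

lemma pr_minus_right: "pr \<xi> (- u) = - pr \<xi> u"
  using pr_add_right[of \<xi> u "- u"] by (simp add: eq_neg_iff_add_eq_0 add.commute)

lemma pr_diff_left: "pr (\<xi> - \<eta>) u = pr \<xi> u - pr \<eta> u"
  using pr_add_left[of \<xi> "- \<eta>" u] by (simp add: pr_minus_left)

lemma pr_diff_right: "pr \<xi> (u - v) = pr \<xi> u - pr \<xi> v"
  using pr_add_right[of \<xi> u "- v"] by (simp add: pr_minus_right)

lemma pr_sum_left: "pr (\<Sum>i\<in>I. f i) u = (\<Sum>i\<in>I. pr (f i) u)"
  by (induction I rule: infinite_finite_induct) (simp_all add: pr_add_left)

lemma pr_sum_right: "pr \<xi> (\<Sum>i\<in>I. f i) = (\<Sum>i\<in>I. pr \<xi> (f i))"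
  by (induction I rule: infinite_finite_induct) (simp_all add: pr_add_right)

lemmas pr_simps = pr_add_left pr_scale_left pr_add_right pr_scale_right
  pr_minus_left pr_minus_right pr_diff_left pr_diff_right pr_sum_left pr_sum_right

definition ker :: "'x \<Rightarrow> 'b set" where
  "ker \<xi> = {u. pr \<xi> u = 0}"

definition null :: "'b set \<Rightarrow> 'x \<Rightarrow> bool" where
  "null U \<xi> \<longleftrightarrow> (\<forall>u\<in>U. pr \<xi> u = 0)"

lemma subspace_ker: "E.subspace (ker \<xi>)"
  by (auto simp: ker_def E.subspace_def pr_simps)

lemma pr_ext: "(\<And>\<xi>. pr \<xi> u = pr \<xi> v) \<Longrightarrow> u = v"
proof (rule ccontr)
  assume *: "\<And>\<xi>. pr \<xi> u = pr \<xi> v" and "u \<noteq> v"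
  then have "u - v \<notin> {0}" by simp
  then obtain \<xi> where "pr \<xi> (u - v) = 1"
    using separation[OF E.subspace_single_0] by blast
  then show False using *[of \<xi>] by (simp add: pr_simps)
qed

lemma null_span: "null (E.span S) \<xi> \<longleftrightarrow> null S \<xi>"
proof
  assume "null S \<xi>"
  then have "S \<subseteq> ker \<xi>" by (auto simp: null_def ker_def)
  then have "E.span S \<subseteq> ker \<xi>" using E.span_minimal subspace_ker by blast
  then show "null (E.span S) \<xi>" by (auto simp: null_def ker_def)
qed (auto simp: null_def E.span_base)

lemma null_insert: "null (insert u U) \<xi> \<longleftrightarrow> pr \<xi> u = 0 \<and> null U \<xi>"
  by (auto simp: null_def)

lemma has_dim_hyperplane:
  assumes U: "E.has_dim U n" and \<alpha>: "\<not> null U \<alpha>"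
  obtains m where "n = Suc m" "E.has_dim (U \<inter> ker \<alpha>) m"
proof -
  obtain u0 where u0: "u0 \<in> U" "pr \<alpha> u0 \<noteq> 0" using \<alpha> by (auto simp: null_def)
  have sU: "E.subspace U" using U by (rule E.has_dim_subspace)
  have sub: "E.subspace (U \<inter> ker \<alpha>)" using sU subspace_ker by (rule E.subspace_inter)
  obtain m where m: "E.has_dim (U \<inter> ker \<alpha>) m"
    using E.has_dim_subset[OF U sub] by auto
  have "E.span (insert u0 (U \<inter> ker \<alpha>)) = U"
  proof
    show "E.span (insert u0 (U \<inter> ker \<alpha>)) \<subseteq> U"
      using u0 sU by (intro E.span_minimal) auto
    show "U \<subseteq> E.span (insert u0 (U \<inter> ker \<alpha>))"
    proof
      fix u assume u: "u \<in> U"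
      have "u - (pr \<alpha> u / pr \<alpha> u0) \<cdot> u0 \<in> U \<inter> ker \<alpha>"
        using u u0 sU by (auto simp: ker_def pr_simps E.subspace_diff E.subspace_scale)
      then show "u \<in> E.span (insert u0 (U \<inter> ker \<alpha>))"
        unfolding E.span_insert using E.span_base by blast
    qed
  qed
  moreover have "u0 \<notin> U \<inter> ker \<alpha>" using u0 by (auto simp: ker_def)
  ultimately have "E.has_dim U (Suc m)" using E.has_dim_insert[OF m] by metis
  then show ?thesis using that m E.has_dim_unique[OF U] by blast
qed

lemma has_dim_not_null:
  assumes "E.has_dim U (Suc n)"
  obtains \<xi> where "\<not> null U \<xi>"
proof -
  have "U \<noteq> {0}"
  proof
    assume "U = {0}"
    then have "E.has_dim U 0" unfolding E.has_dim_def by (intro exI[of _ "{}"]) (simp add: E.independent_empty)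
    then show False using E.has_dim_unique assms by blast
  qed
  then obtain u where "u \<in> U" "u \<noteq> 0" using E.subspace_0[OF E.has_dim_subspace[OF assms]] by blast
  then obtain \<beta> where "\<not> null U \<beta>" using separation[OF E.subspace_single_0, of u] by (force simp: null_def)
  then show ?thesis using that by blast
qed

text \<open>A form of degree \<open>d\<close> is represented by its polarization, a function on multisets of size \<open>d\<close>
  of vectors in the dual space that is linear in each entry; values on multisets of other sizes are
  irrelevant. Adding \<open>\<alpha>\<close> to the multiset is \<open>1/d\<close> times the derivative in direction \<open>\<alpha>\<close>.\<close>

definition multilinear :: "('x multiset \<Rightarrow> 'a) \<Rightarrow> bool" where
  "multilinear F \<longleftrightarrow> (\<forall>M \<xi> \<eta>. F (add_mset (\<xi> + \<eta>) M) = F (add_mset \<xi> M) + F (add_mset \<eta> M)) \<and>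
     (\<forall>M c \<xi>. F (add_mset (c \<odot> \<xi>) M) = c * F (add_mset \<xi> M))"

lemma multilinear_add: "multilinear F \<Longrightarrow> F (add_mset (\<xi> + \<eta>) M) = F (add_mset \<xi> M) + F (add_mset \<eta> M)"
  and multilinear_scale: "multilinear F \<Longrightarrow> F (add_mset (c \<odot> \<xi>) M) = c * F (add_mset \<xi> M)"
  by (simp_all add: multilinear_def)

lemma multilinear_zero: "multilinear F \<Longrightarrow> F (add_mset 0 M) = 0"
  using multilinear_scale[of F 0 0 M] by simp

lemma multilinear_uminus: "multilinear F \<Longrightarrow> F (add_mset (- \<xi>) M) = - F (add_mset \<xi> M)"
  using multilinear_add[of F \<xi> "- \<xi>" M] multilinear_zero[of F M]
  by (simp add: eq_neg_iff_add_eq_0 add.commute)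

lemma multilinear_diff: "multilinear F \<Longrightarrow> F (add_mset (\<xi> - \<eta>) M) = F (add_mset \<xi> M) - F (add_mset \<eta> M)"
  using multilinear_add[of F \<xi> "- \<eta>" M] by (simp add: multilinear_uminus)

lemma multilinear_contract:
  "multilinear F \<Longrightarrow> multilinear (\<lambda>M. F (add_mset \<alpha> M))"
  by (simp add: multilinear_def add_mset_commute[of \<alpha>])

lemma multilinear_plus:
  "multilinear F \<Longrightarrow> multilinear G \<Longrightarrow> multilinear (\<lambda>M. F M + G M)"
  by (simp add: multilinear_def algebra_simps)

lemma multilinear_minus:
  "multilinear F \<Longrightarrow> multilinear G \<Longrightarrow> multilinear (\<lambda>M. F M - G M)"
  by (simp add: multilinear_def algebra_simps)

lemma multilinear_times:
  "multilinear F \<Longrightarrow> multilinear (\<lambda>M. c * F M)"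
  by (simp add: multilinear_def algebra_simps)

text \<open>The polarization of the power of l whose exponent is the size of the multiset. One
  function serves all degrees, and contraction with \<xi> is multiplication by the scalar
  \<open>pr \<xi> l\<close>.\<close>

definition pow :: "'b \<Rightarrow> 'x multiset \<Rightarrow> 'a" where
  "pow l M = (\<Prod>\<xi>\<in>#M. pr \<xi> l)"

lemma pow_add_mset [simp]: "pow l (add_mset \<xi> M) = pr \<xi> l * pow l M"
  by (simp add: pow_def)

lemma pow_empty [simp]: "pow l {#} = 1"
  by (simp add: pow_def)

lemma pow_replicate [simp]: "pow l (replicate_mset n \<xi>) = pr \<xi> l ^ n"
  by (simp add: pow_def)

lemma multilinear_pow: "multilinear (pow l)"
  by (simp add: multilinear_def pr_simps algebra_simps)

definition power_sum :: "('a \<times> 'b) list \<Rightarrow> 'x multiset \<Rightarrow> 'a" where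
  "power_sum L M = (\<Sum>(c, l)\<leftarrow>L. c * pow l M)"

lemma power_sum_Nil [simp]: "power_sum [] M = 0"
  and power_sum_Cons [simp]: "power_sum ((c, l) # L) M = c * pow l M + power_sum L M"
  and power_sum_append [simp]: "power_sum (L @ L') M = power_sum L M + power_sum L' M"
  by (simp_all add: power_sum_def)

lemma multilinear_power_sum: "multilinear (power_sum L)"
proof (induction L)
  case Nil
  then show ?case by (simp add: multilinear_def)
next
  case (Cons a L)
  obtain c l where "a = (c, l)" by (cases a)
  then show ?case
    using multilinear_plus[OF multilinear_times[OF multilinear_pow, of c l] Cons.IH]
    by (simp add: fun_eq_iff[symmetric] flip: power_sum_Cons)
qed

text \<open>Coefficients are kept until the end, where they are absorbed by taking roots. They have
  to be nonzero: a zero coefficient would turn its linear form into 0, which may lie in the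
  cone.\<close>

definition waring :: "nat \<Rightarrow> 'b set \<Rightarrow> nat \<Rightarrow> ('x multiset \<Rightarrow> 'a) \<Rightarrow> bool" where
  "waring d A N F \<longleftrightarrow> (\<exists>L. length L \<le> N \<and> (\<forall>(c, l)\<in>set L. c \<noteq> 0 \<and> l \<in> A) \<and>
     (\<forall>M. size M = d \<longrightarrow> F M = power_sum L M))"

lemma waring_mono: "waring d A N F \<Longrightarrow> A \<subseteq> A' \<Longrightarrow> N \<le> N' \<Longrightarrow> waring d A' N' F"
  unfolding waring_def by (elim exE conjE, rule_tac x = L in exI) auto

lemma waring_add:
  assumes "waring d A N F" "waring d A N' G" "\<And>M. size M = d \<Longrightarrow> H M = F M + G M"
  shows "waring d A (N + N') H"
proof -
  obtain L L' where "length L \<le> N" "\<forall>(c, l)\<in>set L. c \<noteq> 0 \<and> l \<in> A"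
    "\<forall>M. size M = d \<longrightarrow> F M = power_sum L M"
    "length L' \<le> N'" "\<forall>(c, l)\<in>set L'. c \<noteq> 0 \<and> l \<in> A"
    "\<forall>M. size M = d \<longrightarrow> G M = power_sum L' M"
    using assms(1,2) unfolding waring_def by blast
  then show ?thesis unfolding waring_def using assms(3)
    by (intro exI[of _ "L @ L'"]) auto
qed

lemma waring_single: "l \<in> A \<Longrightarrow> (\<And>M. size M = d \<Longrightarrow> F M = c * pow l M) \<Longrightarrow> waring d A 1 F"
  unfolding waring_def
  by (cases "c = 0", rule exI[of _ "[]"], simp, rule exI[of _ "[(c, l)]"], simp)

text \<open>\<open>U\<close> is the space of essential variables of the form \<open>F\<close> of degree \<open>d\<close>.\<close>

definition has_support :: "nat \<Rightarrow> ('x multiset \<Rightarrow> 'a) \<Rightarrow> 'b set \<Rightarrow> bool" where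
  "has_support d F U \<longleftrightarrow>
     (\<forall>\<beta>. (\<forall>M. Suc (size M) = d \<longrightarrow> F (add_mset \<beta> M) = 0) \<longleftrightarrow> null U \<beta>)"

lemma has_supportD:
  "has_support d F U \<Longrightarrow> null U \<beta> \<Longrightarrow> Suc (size M) = d \<Longrightarrow> F (add_mset \<beta> M) = 0"
  by (auto simp: has_support_def)

lemma has_support_nonzero:
  assumes "has_support d F U" "\<not> null U \<beta>"
  obtains M where "Suc (size M) = d" "F (add_mset \<beta> M) \<noteq> 0"
  using assms by (auto simp: has_support_def)

text \<open>The half of \<open>has_support\<close> that survives the subtraction of powers of forms
  in U; the space may be too large.\<close>

definition lives_on :: "nat \<Rightarrow> ('x multiset \<Rightarrow> 'a) \<Rightarrow> 'b set \<Rightarrow> bool" where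
  "lives_on d F U \<longleftrightarrow>
     (\<forall>\<beta> M. null U \<beta> \<longrightarrow> Suc (size M) = d \<longrightarrow> F (add_mset \<beta> M) = 0)"

text \<open>Modulo directions null on U, a direction null on \<open>U \<inter> ker \<alpha>\<close>
  is a multiple of \<alpha>, and F is killed by both kinds.\<close>

lemma lives_on_hyperplane:
  assumes F: "multilinear F" and U: "E.subspace U" "lives_on d F U"
    and \<alpha>: "\<And>M. Suc (size M) = d \<Longrightarrow> F (add_mset \<alpha> M) = 0"
  shows "lives_on d F (U \<inter> ker \<alpha>)"
proof (cases "null U \<alpha>")
  case True
  then have "U \<inter> ker \<alpha> = U" by (auto simp: null_def ker_def)
  then show ?thesis using U by simp
next
  case False
  then obtain u0 where u0: "u0 \<in> U" "pr \<alpha> u0 \<noteq> 0" by (auto simp: null_def)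
  show ?thesis
    unfolding lives_on_def
  proof (intro allI impI)
    fix \<xi> :: 'x and M :: "'x multiset" assume \<xi>: "null (U \<inter> ker \<alpha>) \<xi>" and M: "Suc (size M) = d"
    define c where "c = pr \<xi> u0 / pr \<alpha> u0"
    have "null U (\<xi> - c \<odot> \<alpha>)"
      unfolding null_def
    proof
      fix u assume u: "u \<in> U"
      have "u - (pr \<alpha> u / pr \<alpha> u0) \<cdot> u0 \<in> U \<inter> ker \<alpha>"
        using u u0 U by (auto simp: ker_def pr_simps E.subspace_diff E.subspace_scale)
      then have "pr \<xi> (u - (pr \<alpha> u / pr \<alpha> u0) \<cdot> u0) = 0" using \<xi> by (auto simp: null_def)
      then show "pr (\<xi> - c \<odot> \<alpha>) u = 0" by (simp add: pr_simps c_def)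
    qed
    then have "F (add_mset (\<xi> - c \<odot> \<alpha>) M) = 0" using U(2) M by (simp add: lives_on_def)
    then show "F (add_mset \<xi> M) = 0"
      using \<alpha>[OF M] by (simp add: multilinear_diff[OF F] multilinear_scale[OF F])
  qed
qed

text \<open>As long as some \<beta> that is not null on the current space kills F, the space can be
  cut down to its hyperplane \<beta> = 0, and the dimension drops.\<close>

lemma support_exists:
  assumes F: "multilinear F" and "E.has_dim U n" "lives_on d F U"
  shows "\<exists>W m. W \<subseteq> U \<and> has_support d F W \<and> E.has_dim W m \<and> m \<le> n \<and> (W \<noteq> U \<longrightarrow> m < n)"
  using assms(2,3)
proof (induction n arbitrary: U rule: less_induct)
  case (less n U)
  show ?case
  proof (cases "has_support d F U")
    case True
    then show ?thesis using less.prems by blast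
  next
    case False
    then obtain \<beta> where \<beta>: "\<not> null U \<beta>" "\<And>M. Suc (size M) = d \<Longrightarrow> F (add_mset \<beta> M) = 0"
      using less.prems(2) unfolding has_support_def lives_on_def by blast
    obtain m where m: "n = Suc m" "E.has_dim (U \<inter> ker \<beta>) m"
      using has_dim_hyperplane[OF less.prems(1) \<beta>(1)] .
    have "lives_on d F (U \<inter> ker \<beta>)"
      using lives_on_hyperplane[OF F E.has_dim_subspace[OF less.prems(1)] less.prems(2) \<beta>(2)] .
    from less.IH[OF _ m(2) this] m(1)
    obtain W k where "W \<subseteq> U \<inter> ker \<beta>" "has_support d F W" "E.has_dim W k" "k \<le> m" by auto
    then show ?thesis using m(1) by (intro exI[of _ W] exI[of _ k]) auto
  qed
qed

text \<open>A direction \<gamma> null on U with \<gamma>(l) = 1 kills G. If \<beta> kills the sum,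
  evaluation on \<beta> and d - 1 copies of \<gamma> leaves c \<beta>(l); at least one copy is
  needed, hence d is at least 2.\<close>

lemma has_support_add_pow:
  assumes G: "has_support d G U" and U: "E.subspace U" "l \<notin> U" and c: "c \<noteq> 0" and d: "d \<ge> 2"
  shows "has_support d (\<lambda>M. G M + c * pow l M) (E.span (insert l U))"
  unfolding has_support_def null_span null_insert
proof (rule allI, rule iffI)
  fix \<beta> assume *: "\<forall>M. Suc (size M) = d \<longrightarrow> G (add_mset \<beta> M) + c * pow l (add_mset \<beta> M) = 0"
  obtain \<gamma> where \<gamma>: "null U \<gamma>" "pr \<gamma> l = 1" using separation[OF U] by (auto simp: null_def)
  obtain e where e: "d = Suc (Suc e)" using d by (metis add_2_eq_Suc le_Suc_ex)
  have "G (add_mset \<gamma> (add_mset \<beta> (replicate_mset e \<gamma>))) = 0"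
    by (rule has_supportD[OF G \<gamma>(1)]) (simp add: e)
  then have "G (add_mset \<beta> (replicate_mset (Suc e) \<gamma>)) = 0" by (simp add: add_mset_commute)
  moreover have "G (add_mset \<beta> (replicate_mset (Suc e) \<gamma>)) + c * pow l (add_mset \<beta> (replicate_mset (Suc e) \<gamma>)) = 0"
    using *[rule_format, of "replicate_mset (Suc e) \<gamma>"] e by simp
  ultimately have 1: "pr \<beta> l = 0" using c \<gamma>(2) by simp
  then have "\<forall>M. Suc (size M) = d \<longrightarrow> G (add_mset \<beta> M) = 0" using * by simp
  then show "pr \<beta> l = 0 \<and> null U \<beta>" using 1 G by (simp add: has_support_def)
next
  fix \<beta> assume "pr \<beta> l = 0 \<and> null U \<beta>"
  then show "\<forall>M. Suc (size M) = d \<longrightarrow> G (add_mset \<beta> M) + c * pow l (add_mset \<beta> M) = 0"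
    using has_supportD[OF G] by simp
qed

text \<open>If the remainder \<open>G\<close> after integration does not have full support in the hyperplane, one power
  \<open>c * pow l\<close> is moved from the integral to \<open>G\<close>.\<close>

lemma waring_integrate:
  assumes F: "multilinear F" and sup: "has_support d F U"
    and dim: "E.has_dim U n" "n \<ge> 2" and d: "d \<ge> 2"
    and \<alpha>: "\<not> null U \<alpha>" and h: "u \<in> U" "pr \<alpha> u = 0" "h u \<noteq> 0"
    and w: "waring (d - 1) {l \<in> U. h l \<noteq> 0 \<and> pr \<alpha> l \<noteq> 0} r (\<lambda>M. F (add_mset \<alpha> M))"
    and IH: "\<And>G W m. multilinear G \<Longrightarrow> has_support d G W \<Longrightarrow> E.has_dim W m \<Longrightarrow> W \<subseteq> U \<Longrightarrow>
      1 \<le> m \<Longrightarrow> m < n \<Longrightarrow> \<exists>u\<in>W. h u \<noteq> (0::'a) \<Longrightarrow> waring d {l \<in> W. h l \<noteq> 0} b G"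
  shows "waring d {l \<in> U. h l \<noteq> 0} (r + b) F"
proof -
  let ?A = "{l \<in> U. h l \<noteq> 0}"
  have sU: "E.subspace U" using dim(1) by (rule E.has_dim_subspace)
  obtain L where L: "length L \<le> r" "\<And>c l. (c, l) \<in> set L \<Longrightarrow> c \<noteq> 0 \<and> l \<in> U \<and> h l \<noteq> 0 \<and> pr \<alpha> l \<noteq> 0"
    "\<And>M. size M = d - 1 \<Longrightarrow> F (add_mset \<alpha> M) = power_sum L M"
    using w unfolding waring_def by blast
  \<comment> \<open>Contracting \<open>pow l\<close> with \<alpha> multiplies it by \<alpha>(l),
    with no factor d, so division by \<alpha>(l) integrates a power.\<close>
  define I where "I = map (\<lambda>(c, l). (c / pr \<alpha> l, l))"
  have I_\<alpha>: "power_sum (I L') (add_mset \<alpha> M) = power_sum L' M" if "set L' \<subseteq> set L" for L' M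
    using that
  proof (induction L')
    case (Cons a L')
    then show ?case using L(2)[of "fst a" "snd a"] by (cases a) (auto simp: I_def)
  qed (simp add: I_def)
  have I_null: "power_sum (I L') (add_mset \<beta> M) = 0" if "set L' \<subseteq> set L" "null U \<beta>" for L' M \<beta>
    using that(1)
  proof (induction L')
    case (Cons a L')
    then show ?case using L(2)[of "fst a" "snd a"] that(2)
      by (cases a) (auto simp: I_def null_def)
  qed (simp add: I_def)
  have I_set: "\<forall>(c, l)\<in>set (I L'). c \<noteq> 0 \<and> l \<in> ?A" if "set L' \<subseteq> set L" for L'
    using that L(2) by (auto simp: I_def)
  define G where "G M = F M - power_sum (I L) M" for M
  have G: "multilinear G"
    unfolding G_def by (intro multilinear_minus F multilinear_power_sum)
  have "lives_on d G U"
    using has_supportD[OF sup] by (simp add: lives_on_def G_def I_null)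
  moreover have "G (add_mset \<alpha> M) = 0" if "Suc (size M) = d" for M
    using that L(3)[of M] by (auto simp: G_def I_\<alpha>)
  ultimately have lives: "lives_on d G (U \<inter> ker \<alpha>)"
    using lives_on_hyperplane[OF G sU] by blast
  obtain k where k: "n = Suc k" "E.has_dim (U \<inter> ker \<alpha>) k"
    using has_dim_hyperplane[OF dim(1) \<alpha>] .
  obtain W m where W: "W \<subseteq> U \<inter> ker \<alpha>" "has_support d G W" "E.has_dim W m" "m \<le> k"
    "W \<noteq> U \<inter> ker \<alpha> \<Longrightarrow> m < k"
    using support_exists[OF G k(2) lives] by blast
  have F_split: "F M = power_sum (I L) M + G M" for M by (simp add: G_def)
  have wI: "waring d ?A (length L') (power_sum (I L'))" if "set L' \<subseteq> set L" for L'
    unfolding waring_def using I_set[OF that] by (intro exI[of _ "I L'"]) (simp add: I_def)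
  show ?thesis
  proof (cases "W = U \<inter> ker \<alpha>")
    case True
    have "waring d {l \<in> W. h l \<noteq> 0} b G"
      using IH[OF G W(2,3)] W(1) True h k dim(2) E.has_dim_unique[OF k(2), of m] W(3)
      by (auto simp: ker_def)
    then have "waring d ?A b G" using W(1) by (auto elim: waring_mono)
    from waring_add[OF waring_mono[OF wI[OF order_refl] order_refl L(1)] this]
    show ?thesis using F_split by simp
  next
    case False
    \<comment> \<open>There is a power to move: an empty list would mean \<alpha>F = 0, but \<alpha>
      is not null on the support of F.\<close>
    have "L \<noteq> []"
    proof
      assume "L = []"
      then have "\<forall>M. Suc (size M) = d \<longrightarrow> F (add_mset \<alpha> M) = 0" using L(3) by auto
      then show False using \<alpha> sup by (simp add: has_support_def)
    qed
    then obtain c l L' where Lc: "L = (c, l) # L'" by (cases L) auto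
    have l: "c \<noteq> 0" "l \<in> U" "h l \<noteq> 0" "pr \<alpha> l \<noteq> 0" using L(2)[of c l] Lc by auto
    have lW: "l \<notin> W" using W(1) l(4) by (auto simp: ker_def)
    define c' where "c' = c / pr \<alpha> l"
    define G' where "G' M = G M + c' * pow l M" for M
    have "c' \<noteq> 0" using l by (simp add: c'_def)
    then have sup': "has_support d G' (E.span (insert l W))"
      unfolding G'_def using has_support_add_pow[OF W(2) E.has_dim_subspace[OF W(3)] lW _ d] by blast
    have sub: "E.span (insert l W) \<subseteq> U" using l(2) W(1) sU by (intro E.span_minimal) auto
    have "waring d {x \<in> E.span (insert l W). h x \<noteq> 0} b G'"
    proof (rule IH[OF _ sup' E.has_dim_insert[OF W(3) lW] sub])
      show "multilinear G'"
        unfolding G'_def by (intro multilinear_plus multilinear_times multilinear_pow G)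
      show "\<exists>u\<in>E.span (insert l W). h u \<noteq> 0" using l(3) by (auto intro: E.span_base)
    qed (use W(5)[OF False] k in auto)
    then have "waring d ?A b G'" using sub by (auto elim: waring_mono)
    moreover have "waring d ?A r (power_sum (I L'))"
      using waring_mono[OF wI[of L'] order_refl, of r] L(1) Lc by auto
    moreover have "F M = power_sum (I L') M + G' M" for M
      by (simp add: F_split G'_def Lc I_def c'_def)
    ultimately show ?thesis using waring_add by blast
  qed
qed

end

section \<open>Derivatives in good directions\<close>

text \<open>The arguments are shifted: \<open>waring_bound n d\<close> is \<open>B(n + 1, d + 1)\<close>.\<close>

fun waring_bound :: "nat \<Rightarrow> nat \<Rightarrow> nat" where
  "waring_bound 0 d = 1"
| "waring_bound (Suc n) 0 = 1"
| "waring_bound (Suc n) (Suc d) =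
     (if n = 1 \<and> d = 1 then 5 else waring_bound n (Suc d) + waring_bound (Suc n) d)"

lemma waring_bound_pos: "waring_bound n d > 0"
  by (induction n d rule: waring_bound.induct) auto

lemma waring_bound_Suc_less: "waring_bound n (Suc d) < waring_bound (Suc n) (Suc d)"
proof (cases "n = 1 \<and> d = 1")
  case True
  then show ?thesis by (simp add: numeral_2_eq_2)
qed (use waring_bound_pos[of "Suc n" d] in auto)

lemma waring_bound_mono: "m \<le> n \<Longrightarrow> waring_bound m d \<le> waring_bound n d"
proof (cases d)
  case 0
  have "waring_bound k 0 = 1" for k by (cases k) auto
  then show ?thesis using 0 by simp
next
  case (Suc e)
  assume "m \<le> n"
  moreover have "mono (\<lambda>n. waring_bound n (Suc e))"
    by (rule incseq_SucI) (use waring_bound_Suc_less in \<open>simp add: less_imp_le del: waring_bound.simps\<close>)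
  ultimately show ?thesis using Suc by (simp add: mono_def del: waring_bound.simps)
qed

context dual_pair
begin

text \<open>Polynomiality is asked along parabolas and not just along lines because the linear forms
  used for ternary cubics move on a conic. Only this and the invariance of the zero set are
  recorded, so that h can be multiplied by a linear function.\<close>

definition cone_fun :: "('b \<Rightarrow> 'a) \<Rightarrow> bool" where
  "cone_fun h \<longleftrightarrow> (\<forall>a b c. polynomial_fun (\<lambda>t. h (a + t \<cdot> b + (t * t) \<cdot> c))) \<and>
     (\<forall>c u. c \<noteq> 0 \<longrightarrow> h (c \<cdot> u) = 0 \<longleftrightarrow> h u = 0)"

lemma cone_fun_line: "cone_fun h \<Longrightarrow> polynomial_fun (\<lambda>t. h (a + t \<cdot> b))"
proof -
  assume "cone_fun h"
  then have "polynomial_fun (\<lambda>t. h (a + t \<cdot> b + (t * t) \<cdot> 0))" unfolding cone_fun_def by blast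
  then show ?thesis by simp
qed

lemma cone_fun_times_pr: "cone_fun h \<Longrightarrow> cone_fun (\<lambda>u. h u * pr \<alpha> u)"
  unfolding cone_fun_def by (auto intro!: poly_intros simp: pr_simps)

lemma generic_cone_fun:
  assumes "cone_fun h" "u \<in> U" "h u \<noteq> 0"
  shows "E.generic U (\<lambda>u. h u \<noteq> 0)"
  using assms cone_fun_line by (intro E.genericI) auto

lemma generic_pr:
  assumes "\<not> null U \<alpha>"
  shows "E.generic U (\<lambda>u. pr \<alpha> u \<noteq> 0)"
proof -
  obtain u where "u \<in> U" "pr \<alpha> u \<noteq> 0" using assms by (auto simp: null_def)
  then show ?thesis by (intro E.genericI) (auto simp: pr_simps intro!: poly_intros)
qed

lemma cone_fun_times_pr_nonzero:
  assumes "E.subspace U" "cone_fun h" "u \<in> U" "h u \<noteq> 0" "\<not> null U \<alpha>"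
  obtains v where "v \<in> U" "h v \<noteq> 0" "pr \<alpha> v \<noteq> 0"
  using E.generic_ex[OF E.generic_conj[OF assms(1) generic_cone_fun[OF assms(2-4)] generic_pr[OF assms(5)]]]
  by auto

text \<open>On the line from \<open>p\<close> in the direction of a basis vector, a hyperplane inside the zero set of
  \<open>h\<close> can only be met at one of the finitely many zeros of \<open>h\<close>.\<close>

lemma finite_hyperplanes_in_zero_set:
  assumes h: "cone_fun h" and U: "E.has_dim U n" and p: "p \<in> U" "h p \<noteq> 0"
  shows "\<exists>K. finite K \<and> (\<forall>\<kappa>\<in>K. \<not> null U \<kappa>) \<and>
    (\<forall>\<beta>. (\<forall>u\<in>U. pr \<beta> u = 0 \<longrightarrow> h u = 0) \<longrightarrow> (\<exists>\<kappa>\<in>K. \<exists>c. c \<noteq> 0 \<and> null U (\<beta> - c \<odot> \<kappa>)))"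
proof -
  obtain B where B: "finite B" "E.span B = U" using U by (auto simp: E.has_dim_def)
  have sU: "E.subspace U" using U by (rule E.has_dim_subspace)
  \<comment> \<open>Scaled to the value 1 at p, a functional \<beta> is determined modulo
    \<open>null U\<close> by its values on the basis B. A value v = \<beta>(b) other than 0 makes p
    - b/v a point of the hyperplane, so -1/v is a zero of h on the line: each b allows finitely many
    values.\<close>
  define bad where "bad = {\<beta>. pr \<beta> p = 1 \<and> (\<forall>u\<in>U. pr \<beta> u = 0 \<longrightarrow> h u = 0)}"
  define R where "R b = {t. h (p + t \<cdot> b) = 0}" for b
  have fin: "finite (R b)" for b
    unfolding R_def using polynomial_fun_finite_zeros[OF cone_fun_line[OF h, of p b], of 0] p by simp
  define f where "f \<beta> = restrict (pr \<beta>) B" for \<beta>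
  have "f ` bad \<subseteq> PiE B (\<lambda>b. insert 0 ((\<lambda>t. - 1 / t) ` R b))"
  proof
    fix g assume "g \<in> f ` bad"
    then obtain \<beta> where \<beta>: "g = f \<beta>" "pr \<beta> p = 1" "\<And>u. u \<in> U \<Longrightarrow> pr \<beta> u = 0 \<Longrightarrow> h u = 0"
      by (auto simp: bad_def)
    have "pr \<beta> b \<in> insert 0 ((\<lambda>t. - 1 / t) ` R b)" if b: "b \<in> B" for b
    proof (cases "pr \<beta> b = 0")
      case False
      have "b \<in> U" using b B E.span_base by blast
      then have "p + (- 1 / pr \<beta> b) \<cdot> b \<in> U" using p sU by (intro E.subspace_add E.subspace_scale)
      moreover have "pr \<beta> (p + (- 1 / pr \<beta> b) \<cdot> b) = 0" using False \<beta>(2) by (simp add: pr_simps)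
      ultimately have "- 1 / pr \<beta> b \<in> R b" using \<beta>(3) by (simp add: R_def)
      then show ?thesis using False by (intro insertI2 image_eqI[of _ _ "- 1 / pr \<beta> b"]) auto
    qed simp
    then show "g \<in> PiE B (\<lambda>b. insert 0 ((\<lambda>t. - 1 / t) ` R b))" by (simp add: \<beta>(1) f_def)
  qed
  then have "finite (f ` bad)"
    by (rule finite_subset) (intro finite_PiE B, use fin in auto)
  then obtain K where K: "K \<subseteq> bad" "finite K" "f ` bad = f ` K"
    using finite_subset_image[of "f ` bad" f bad] by auto
  show ?thesis
  proof (intro exI conjI ballI allI impI)
    show "finite K" by (rule K)
    show "\<not> null U \<kappa>" if "\<kappa> \<in> K" for \<kappa> using that K(1) p(1) by (force simp: bad_def null_def)
  next
    fix \<beta> assume \<beta>: "\<forall>u\<in>U. pr \<beta> u = 0 \<longrightarrow> h u = 0"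
    then have \<beta>p: "pr \<beta> p \<noteq> 0" using p by auto
    then have "(1 / pr \<beta> p) \<odot> \<beta> \<in> bad" using \<beta> by (auto simp: bad_def pr_simps)
    then obtain \<kappa> where \<kappa>: "\<kappa> \<in> K" "f ((1 / pr \<beta> p) \<odot> \<beta>) = f \<kappa>" using K(3) by blast
    have "null B (\<beta> - pr \<beta> p \<odot> \<kappa>)"
      unfolding null_def
    proof
      fix b assume "b \<in> B"
      then have "pr \<kappa> b = pr ((1 / pr \<beta> p) \<odot> \<beta>) b" using \<kappa>(2) by (metis f_def restrict_apply')
      then show "pr (\<beta> - pr \<beta> p \<odot> \<kappa>) b = 0" using \<beta>p by (simp add: pr_simps)
    qed
    then have "null U (\<beta> - pr \<beta> p \<odot> \<kappa>)" using null_span[of B] B(2) by simp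
    then show "\<exists>\<kappa>\<in>K. \<exists>c. c \<noteq> 0 \<and> null U (\<beta> - c \<odot> \<kappa>)" using \<kappa>(1) \<beta>p by blast
  qed
qed

lemma multilinear_line:
  "multilinear F \<Longrightarrow> polynomial_fun (\<lambda>t. F (add_mset (p + t \<odot> q) M))"
  by (simp add: multilinear_add multilinear_scale) (intro poly_intros)

lemma multilinear_add2:
  "multilinear F \<Longrightarrow> F (add_mset \<gamma> (add_mset (\<xi> + \<eta>) M)) = F (add_mset \<gamma> (add_mset \<xi> M)) + F (add_mset \<gamma> (add_mset \<eta> M))"
  using multilinear_add[OF multilinear_contract] .

lemma multilinear_scale2:
  "multilinear F \<Longrightarrow> F (add_mset \<gamma> (add_mset (c \<odot> \<xi>) M)) = c * F (add_mset \<gamma> (add_mset \<xi> M))"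
  using multilinear_scale[OF multilinear_contract] .

lemma multilinear_line2:
  assumes F: "multilinear F"
  shows "polynomial_fun (\<lambda>t. F (add_mset (p + t \<odot> q) (add_mset (p + t \<odot> q) M)))"
proof -
  have "F (add_mset (p + t \<odot> q) (add_mset (p + t \<odot> q) M)) =
      F (add_mset p (add_mset p M)) + 2 * t * F (add_mset p (add_mset q M)) + t * t * F (add_mset q (add_mset q M))" for t
    by (simp add: multilinear_add[OF F] multilinear_scale[OF F] multilinear_add2[OF F]
        multilinear_scale2[OF F] add_mset_commute[of q p M] algebra_simps)
  then show ?thesis by (simp) (intro poly_intros)
qed

text \<open>The form F has degree d + 2. The first clause keeps \<alpha> from being null on the
  support of \<alpha>F, so that forms with \<alpha>(l) \<noteq> 0 are available. The second gives
  the hyperplane \<alpha> = 0, where the remainder lives, a vector outside the cone. The third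
  prevents the support of \<alpha>F from being a hyperplane of U inside the cone.\<close>

definition good_direction :: "nat \<Rightarrow> ('x multiset \<Rightarrow> 'a) \<Rightarrow> 'b set \<Rightarrow> ('b \<Rightarrow> 'a) \<Rightarrow> 'x \<Rightarrow> bool" where
  "good_direction d F U h \<alpha> \<longleftrightarrow>
     (\<exists>M. size M = d \<and> F (add_mset \<alpha> (add_mset \<alpha> M)) \<noteq> 0) \<and>
     (\<exists>u\<in>U. pr \<alpha> u = 0 \<and> h u \<noteq> 0) \<and>
     (\<forall>\<beta>. (\<forall>u\<in>U. pr \<beta> u = 0 \<longrightarrow> h u = 0) \<longrightarrow> (\<exists>M. size M = d \<and> F (add_mset \<beta> (add_mset \<alpha> M)) \<noteq> 0))"

text \<open>The third clause quantifies over all \<beta>, but up to scalars and null directions only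
  the finitely many \<kappa> in \<open>K\<close> occur, and each of them has \<kappa>F \<noteq> 0.
  The second clause says that \<alpha> itself is no such \<beta>.\<close>

lemma generic_good_direction:
  assumes F: "multilinear F" and sup: "has_support (Suc (Suc d)) F U"
    and U: "E.has_dim U (Suc (Suc n))" and h: "cone_fun h" "p \<in> U" "h p \<noteq> 0"
  shows "X.generic UNIV (good_direction d F U h)"
proof -
  have sU: "E.subspace U" using U by (rule E.has_dim_subspace)
  obtain K where K: "finite K" "\<forall>\<kappa>\<in>K. \<not> null U \<kappa>"
    "\<forall>\<beta>. (\<forall>u\<in>U. pr \<beta> u = 0 \<longrightarrow> h u = 0) \<longrightarrow> (\<exists>\<kappa>\<in>K. \<exists>c. c \<noteq> 0 \<and> null U (\<beta> - c \<odot> \<kappa>))"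
    using finite_hyperplanes_in_zero_set[OF h(1) U h(2,3)] by (elim exE conjE) (rule that)
  have split2: "\<exists>\<gamma> M. size M = d \<and> F (add_mset \<beta> (add_mset \<gamma> M)) \<noteq> 0" if nb: "\<not> null U \<beta>" for \<beta>
  proof -
    obtain M where M: "Suc (size M) = Suc (Suc d)" "F (add_mset \<beta> M) \<noteq> 0"
      using has_support_nonzero[OF sup nb] .
    then obtain \<gamma> M' where "M = add_mset \<gamma> M'" using size_eq_Suc_imp_eq_union[of M d] by auto
    then show ?thesis using M by auto
  qed
  have g1: "X.generic UNIV (\<lambda>\<alpha>. \<exists>M. size M = d \<and> F (add_mset \<beta> (add_mset \<alpha> M)) \<noteq> 0)"
    if \<beta>: "\<not> null U \<beta>" for \<beta>
  proof -
    obtain \<gamma> M where M: "size M = d" "F (add_mset \<beta> (add_mset \<gamma> M)) \<noteq> 0" using split2[OF \<beta>] by blast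
    have "X.generic UNIV (\<lambda>\<alpha>. F (add_mset \<beta> (add_mset \<alpha> M)) \<noteq> 0)"
      using multilinear_line[OF multilinear_contract[OF F]] M(2) by (intro X.genericI) auto
    then show ?thesis by (rule X.generic_mono) (use M in auto)
  qed
  have g2: "X.generic UNIV (\<lambda>\<alpha>. pr \<alpha> u \<noteq> 0)" if u: "u \<noteq> 0" for u
  proof -
    obtain \<xi> where "pr \<xi> u = 1" using separation[OF E.subspace_single_0, of u] u by auto
    then show ?thesis by (intro X.genericI[of _ _ \<xi>]) (auto simp: pr_simps intro!: poly_intros)
  qed
  have g3: "X.generic UNIV (\<lambda>\<alpha>. \<exists>M. size M = d \<and> F (add_mset \<alpha> (add_mset \<alpha> M)) \<noteq> 0)"
  proof -
    obtain \<beta> where "\<not> null U \<beta>" using has_dim_not_null[OF U] .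
    then obtain \<gamma> M where M: "size M = d" "F (add_mset \<beta> (add_mset \<gamma> M)) \<noteq> 0" using split2 by blast
    \<comment> \<open>A symmetric bilinear form that vanishes on the diagonal is zero in
      characteristic 0.\<close>
    have "\<exists>\<alpha>. F (add_mset \<alpha> (add_mset \<alpha> M)) \<noteq> 0"
    proof (rule ccontr)
      assume "\<nexists>\<alpha>. F (add_mset \<alpha> (add_mset \<alpha> M)) \<noteq> 0"
      then have z: "F (add_mset \<alpha> (add_mset \<alpha> M)) = 0" for \<alpha> by blast
      have "0 = F (add_mset (\<beta> + \<gamma>) (add_mset (\<beta> + \<gamma>) M))" using z by simp
      also have "\<dots> = 2 * F (add_mset \<beta> (add_mset \<gamma> M))"
        using z[of \<beta>] z[of \<gamma>]
        by (simp add: multilinear_add[OF F] multilinear_add2[OF F] add_mset_commute[of \<gamma> \<beta> M])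
      finally show False using M(2) by simp
    qed
    then obtain \<alpha> where "F (add_mset \<alpha> (add_mset \<alpha> M)) \<noteq> 0" by blast
    then have "X.generic UNIV (\<lambda>\<alpha>. F (add_mset \<alpha> (add_mset \<alpha> M)) \<noteq> 0)"
      using multilinear_line2[OF F] by (intro X.genericI) auto
    then show ?thesis by (rule X.generic_mono) (use M in auto)
  qed
  \<comment> \<open>Each hyperplane \<kappa> = 0 contains a nonzero vector because U has dimension
    at least 2. If \<alpha> does not vanish on it, \<alpha> is not proportional to \<kappa> modulo
    null directions.\<close>
  have "\<forall>\<kappa>. \<exists>u. \<kappa> \<in> K \<longrightarrow> u \<in> U \<inter> ker \<kappa> \<and> u \<noteq> 0"
  proof
    fix \<kappa>
    show "\<exists>u. \<kappa> \<in> K \<longrightarrow> u \<in> U \<inter> ker \<kappa> \<and> u \<noteq> 0"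
    proof (cases "\<kappa> \<in> K")
      case True
      obtain m where m: "Suc (Suc n) = Suc m" "E.has_dim (U \<inter> ker \<kappa>) m"
        using has_dim_hyperplane[OF U K(2)[rule_format, OF True]] .
      then obtain \<xi> where "\<not> null (U \<inter> ker \<kappa>) \<xi>" using has_dim_not_null[of "U \<inter> ker \<kappa>" n] by auto
      then show ?thesis unfolding null_def using pr_zero_right by blast
    qed simp
  qed
  then obtain w where w: "\<And>\<kappa>. \<kappa> \<in> K \<Longrightarrow> w \<kappa> \<in> U \<and> pr \<kappa> (w \<kappa>) = 0 \<and> w \<kappa> \<noteq> 0"
    unfolding choice_iff by (auto simp: ker_def)
  have "X.generic UNIV (\<lambda>\<alpha>. (\<exists>M. size M = d \<and> F (add_mset \<alpha> (add_mset \<alpha> M)) \<noteq> 0) \<and>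
      (\<forall>\<kappa>\<in>K. (\<exists>M. size M = d \<and> F (add_mset \<kappa> (add_mset \<alpha> M)) \<noteq> 0) \<and> pr \<alpha> (w \<kappa>) \<noteq> 0))"
    using w K(2) by (intro X.generic_conj X.generic_ball g3 K(1) g1 g2 X.subspace_UNIV) auto
  then show ?thesis
  proof (rule X.generic_mono)
    fix \<alpha> assume a: "(\<exists>M. size M = d \<and> F (add_mset \<alpha> (add_mset \<alpha> M)) \<noteq> 0) \<and>
      (\<forall>\<kappa>\<in>K. (\<exists>M. size M = d \<and> F (add_mset \<kappa> (add_mset \<alpha> M)) \<noteq> 0) \<and> pr \<alpha> (w \<kappa>) \<noteq> 0)"
    have 1: "\<exists>u\<in>U. pr \<alpha> u = 0 \<and> h u \<noteq> 0"
    proof (rule ccontr)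
      assume "\<not> ?thesis"
      then obtain \<kappa> c where \<kappa>: "\<kappa> \<in> K" "null U (\<alpha> - c \<odot> \<kappa>)" using K(3)[THEN spec, of \<alpha>] by blast
      then have "pr (\<alpha> - c \<odot> \<kappa>) (w \<kappa>) = 0" using w by (auto simp: null_def)
      then show False using w[OF \<kappa>(1)] a \<kappa>(1) by (simp add: pr_simps)
    qed
    have 2: "\<exists>M. size M = d \<and> F (add_mset \<beta> (add_mset \<alpha> M)) \<noteq> 0" if \<beta>: "\<forall>u\<in>U. pr \<beta> u = 0 \<longrightarrow> h u = 0" for \<beta>
    proof -
      obtain \<kappa> c where \<kappa>: "\<kappa> \<in> K" "c \<noteq> 0" "null U (\<beta> - c \<odot> \<kappa>)" using K(3)[THEN spec, of \<beta>] \<beta> by blast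
      obtain M where M: "size M = d" "F (add_mset \<kappa> (add_mset \<alpha> M)) \<noteq> 0" using a \<kappa>(1) by blast
      have "F (add_mset (\<beta> - c \<odot> \<kappa>) (add_mset \<alpha> M)) = 0"
        by (rule has_supportD[OF sup \<kappa>(3)]) (simp add: M)
      then have "F (add_mset \<beta> (add_mset \<alpha> M)) = c * F (add_mset \<kappa> (add_mset \<alpha> M))"
        by (simp add: multilinear_diff[OF F] multilinear_scale[OF F])
      then show ?thesis using M \<kappa>(2) by auto
    qed
    show "good_direction d F U h \<alpha>" unfolding good_direction_def using a 1 2 by blast
  qed
qed

lemma dual_basis:
  assumes "E.has_dim U n"
  shows "\<exists>B \<phi>. finite B \<and> B \<subseteq> U \<and> (\<forall>\<xi>. null U (\<xi> - (\<Sum>b\<in>B. pr \<xi> b \<odot> \<phi> b)))"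
proof -
  obtain B where B: "E.independent B" "finite B" "E.span B = U"
    using assms by (auto simp: E.has_dim_def)
  have "\<exists>\<xi>. b \<in> B \<longrightarrow> null (B - {b}) \<xi> \<and> pr \<xi> b = 1" for b
  proof (cases "b \<in> B")
    case True
    then have "b \<notin> E.span (B - {b})" using B(1) by (simp add: E.dependent_def)
    from separation[OF E.subspace_span this] show ?thesis
      using null_span[of "B - {b}"] by (auto simp: null_def)
  qed simp
  then obtain \<phi> where \<phi>: "\<And>b. b \<in> B \<Longrightarrow> null (B - {b}) (\<phi> b) \<and> pr (\<phi> b) b = 1" by metis
  have "null B (\<xi> - (\<Sum>b\<in>B. pr \<xi> b \<odot> \<phi> b))" for \<xi>
    unfolding null_def
  proof
    fix a assume a: "a \<in> B"
    have "(\<Sum>b\<in>B. pr \<xi> b * pr (\<phi> b) a) = (\<Sum>b\<in>B. if b = a then pr \<xi> a else 0)"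
      using \<phi> a by (intro sum.cong) (auto simp: null_def)
    then show "pr (\<xi> - (\<Sum>b\<in>B. pr \<xi> b \<odot> \<phi> b)) a = 0" using a B(2) by (simp add: pr_simps)
  qed
  then show ?thesis using B null_span[of B] E.span_superset[of B]
    by (intro exI[of _ B] exI[of _ \<phi>]) simp
qed

text \<open>Double annihilator: a functional on directions that respects \<open>null U\<close> comes
  from a vector of U. In this way derivatives down to degree one become actual linear forms.\<close>

lemma representer:
  assumes U: "E.has_dim U n"
    and add: "\<And>\<xi> \<eta>. f (\<xi> + \<eta>) = f \<xi> + f \<eta>" and scale: "\<And>c \<xi>. f (c \<odot> \<xi>) = c * f \<xi>"
    and null: "\<And>\<xi>. null U \<xi> \<Longrightarrow> f \<xi> = 0"
  obtains p where "p \<in> U" "\<And>\<xi>. f \<xi> = pr \<xi> p"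
proof -
  obtain B \<phi> where B: "finite B" "B \<subseteq> U" "\<forall>\<xi>. null U (\<xi> - (\<Sum>b\<in>B. pr \<xi> b \<odot> \<phi> b))"
    using dual_basis[OF U] by (elim exE conjE) (rule that)
  have f0: "f 0 = 0" using scale[of 0 0] by simp
  have fsum: "f (\<Sum>b\<in>B. pr \<xi> b \<odot> \<phi> b) = (\<Sum>b\<in>B. pr \<xi> b * f (\<phi> b))" for \<xi>
    using B(1) by (induction B rule: finite_induct) (simp_all add: f0 add scale)
  define p where "p = (\<Sum>b\<in>B. f (\<phi> b) \<cdot> b)"
  have "f \<xi> = pr \<xi> p" for \<xi>
  proof -
    have "f \<xi> = f ((\<xi> - (\<Sum>b\<in>B. pr \<xi> b \<odot> \<phi> b)) + (\<Sum>b\<in>B. pr \<xi> b \<odot> \<phi> b))" by simp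
    also have "\<dots> = (\<Sum>b\<in>B. pr \<xi> b * f (\<phi> b))" unfolding add null[OF B(3)[THEN spec]] fsum by simp
    finally show ?thesis by (simp add: p_def pr_simps mult.commute)
  qed
  moreover have "p \<in> U" unfolding p_def
    using B(2) E.has_dim_subspace[OF U] by (intro E.subspace_sum E.subspace_scale) auto
  ultimately show ?thesis using that by blast
qed

text \<open>Indices are shifted as in \<open>waring_bound\<close>: n + 1 essential variables, degree
  d + 1. The function h is universally quantified because the induction replaces it by h times
  \<alpha>.\<close>

definition waring_claim :: "nat \<Rightarrow> nat \<Rightarrow> bool" where
  "waring_claim n d \<longleftrightarrow> (\<forall>F U h. multilinear F \<longrightarrow> has_support (Suc d) F U \<longrightarrow> E.has_dim U (Suc n) \<longrightarrow>
     cone_fun h \<longrightarrow> (\<exists>u\<in>U. h u \<noteq> 0) \<longrightarrow> waring (Suc d) {l \<in> U. h l \<noteq> 0} (waring_bound n d) F)"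

lemma waring_claimD:
  "waring_claim n d \<Longrightarrow> multilinear F \<Longrightarrow> has_support (Suc d) F U \<Longrightarrow> E.has_dim U (Suc n) \<Longrightarrow>
   cone_fun h \<Longrightarrow> u \<in> U \<Longrightarrow> h u \<noteq> 0 \<Longrightarrow> waring (Suc d) {l \<in> U. h l \<noteq> 0} (waring_bound n d) F"
  unfolding waring_claim_def by blast

lemma has_dim_singleton: "u \<noteq> 0 \<Longrightarrow> E.has_dim (E.span {u}) 1"
  using E.has_dim_span[of "{u}"] by simp

lemma has_dim_subset_eq:
  assumes "E.has_dim U n" "E.has_dim W n" "W \<subseteq> U"
  shows "W = U"
proof (rule ccontr)
  assume "W \<noteq> U"
  then obtain m where "E.has_dim W m" "m < n"
    using E.has_dim_subset[OF assms(1) E.has_dim_subspace[OF assms(2)] assms(3)] by blast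
  then show False using E.has_dim_unique[OF assms(2)] by blast
qed

lemma waring_claim_one_variable: "waring_claim 0 d"
  unfolding waring_claim_def
proof (intro allI impI)
  fix F U and h :: "'b \<Rightarrow> 'a"
  assume F: "multilinear F" and sup: "has_support (Suc d) F U" and U: "E.has_dim U (Suc 0)"
    and h: "cone_fun h" "\<exists>u\<in>U. h u \<noteq> 0"
  obtain \<alpha> where \<alpha>: "\<not> null U \<alpha>" using has_dim_not_null[OF U] .
  have sU: "E.subspace U" using U by (rule E.has_dim_subspace)
  obtain u where u: "u \<in> U" "h u \<noteq> 0" "pr \<alpha> u \<noteq> 0"
    using h cone_fun_times_pr_nonzero[OF sU h(1) _ _ \<alpha>] by blast
  have "u \<noteq> 0" using u(3) by auto
  then have Uu: "E.span {u} = U"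
    using has_dim_subset_eq[OF U] has_dim_singleton E.span_minimal[of "{u}" U] sU u(1) by simp
  define \<xi>0 where "\<xi>0 = (1 / pr \<alpha> u) \<odot> \<alpha>"
  have \<xi>0: "pr \<xi>0 u = 1" using u by (simp add: \<xi>0_def pr_simps)
  \<comment> \<open>Modulo null directions every \<xi> is a multiple of \<open>\<xi>0\<close>.
    Entries are replaced one at a time, and k counts the copies of \<open>\<xi>0\<close> present so
    far.\<close>
  have *: "F (M + replicate_mset k \<xi>0) = pow u M * F (replicate_mset (Suc d) \<xi>0)" if "size M + k = Suc d" for M k
    using that
  proof (induction M arbitrary: k)
    case (add \<xi> M)
    have "null U (\<xi> - pr \<xi> u \<odot> \<xi>0)" using \<xi>0 
      unfolding Uu[symmetric] null_span by (simp add: pr_simps null_def)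
    then have "F (add_mset (\<xi> - pr \<xi> u \<odot> \<xi>0) (M + replicate_mset k \<xi>0)) = 0"
      by (rule has_supportD[OF sup]) (use add.prems in simp)
    then have "F (add_mset \<xi> (M + replicate_mset k \<xi>0)) = pr \<xi> u * F (M + replicate_mset (Suc k) \<xi>0)"
      by (simp add: multilinear_diff[OF F] multilinear_scale[OF F])
    also have "\<dots> = pr \<xi> u * (pow u M * F (replicate_mset (Suc d) \<xi>0))"
      using add.IH[of "Suc k"] add.prems by simp
    finally show ?case by simp
  qed simp
  have "waring (Suc d) {l \<in> U. h l \<noteq> 0} 1 F"
  proof (rule waring_single)
    show "u \<in> {l \<in> U. h l \<noteq> 0}" using u by simp
    show "F M = F (replicate_mset (Suc d) \<xi>0) * pow u M" if "size M = Suc d" for M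
      using *[of M 0] that by (simp add: mult.commute del: replicate_mset_Suc)
  qed
  then show "waring (Suc d) {l \<in> U. h l \<noteq> 0} (waring_bound 0 d) F" by simp
qed

lemma contract_representer:
  assumes F: "multilinear F" and sup: "has_support (Suc (size M)) F U" and U: "E.has_dim U n"
  obtains p where "p \<in> U" "\<And>\<xi>. F (add_mset \<xi> M) = pr \<xi> p"
  by (rule representer[OF U, of "\<lambda>\<xi>. F (add_mset \<xi> M)"])
     (use F has_supportD[OF sup] in \<open>auto simp: multilinear_add multilinear_scale\<close>)

text \<open>A form of degree one is a single vector p with support \<open>span {p}\<close>, so for n
  > 0 no form meets the hypotheses.\<close>

lemma waring_claim_linear: "waring_claim n 0"
proof (cases n)
  case 0
  then show ?thesis using waring_claim_one_variable by simp
next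
  case (Suc m)
  show ?thesis
    unfolding waring_claim_def
  proof (intro allI impI, rule ccontr)
    fix F U h assume F: "multilinear F" and sup: "has_support (Suc 0) F U" and U: "E.has_dim U (Suc n)"
    obtain p where p: "p \<in> U" "\<And>\<xi>. F {#\<xi>#} = pr \<xi> p"
      using contract_representer[OF F, of "{#}"] sup U by auto
    have "U \<subseteq> E.span {p}"
    proof
      fix u assume u: "u \<in> U"
      show "u \<in> E.span {p}"
      proof (rule ccontr)
        assume "u \<notin> E.span {p}"
        from separation[OF E.subspace_span this]
        obtain \<beta> where \<beta>: "null (E.span {p}) \<beta>" "pr \<beta> u = 1" by (auto simp: null_def)
        then have "F {#\<beta>#} = 0" using p(2)[of \<beta>] E.span_base[of p "{p}"] by (simp add: null_def)
        then have "null U \<beta>" using sup by (simp add: has_support_def)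
        then show False using u \<beta>(2) by (simp add: null_def)
      qed
    qed
    then have "E.span {p} = U" using E.span_minimal[of "{p}" U] p(1) E.has_dim_subspace[OF U] by auto
    moreover have "p \<noteq> 0"
    proof
      assume "p = 0"
      then have "null U \<xi>" for \<xi> using p(2) sup by (simp add: has_support_def)
      then show False using has_dim_not_null[OF U] by blast
    qed
    ultimately have "E.has_dim U 1" using has_dim_singleton[of p] by simp
    then show False using E.has_dim_unique[OF U] Suc by auto
  qed
qed

lemma waring_claim_step:
  assumes F: "multilinear F" and sup: "has_support (Suc (Suc d)) F U" and U: "E.has_dim U (Suc (Suc n))"
    and h: "cone_fun h" and \<alpha>: "\<exists>u\<in>U. pr \<alpha> u = 0 \<and> h u \<noteq> 0" "\<not> null U \<alpha>"
    and w: "waring (Suc d) {l \<in> U. h l \<noteq> 0 \<and> pr \<alpha> l \<noteq> 0} r (\<lambda>M. F (add_mset \<alpha> M))"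
    and IH: "\<And>m. m \<le> n \<Longrightarrow> waring_claim m (Suc d)"
  shows "waring (Suc (Suc d)) {l \<in> U. h l \<noteq> 0} (r + waring_bound n (Suc d)) F"
proof -
  obtain u where u: "u \<in> U" "pr \<alpha> u = 0" "h u \<noteq> 0" using \<alpha>(1) by blast
  show ?thesis
  proof (rule waring_integrate[where h = h, OF F sup U _ _ \<alpha>(2) u])
    fix G W m assume "multilinear G" "has_support (Suc (Suc d)) G W" "E.has_dim W m" "W \<subseteq> U"
      and m: "1 \<le> m" "m < Suc (Suc n)" and "\<exists>u\<in>W. h u \<noteq> 0"
    moreover obtain k where k: "m = Suc k" using m by (cases m) auto
    moreover have "waring_claim k (Suc d)" using IH[of k] m k by simp
    ultimately have "waring (Suc (Suc d)) {l \<in> W. h l \<noteq> 0} (waring_bound k (Suc d)) G"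
      using h unfolding waring_claim_def by blast
    then show "waring (Suc (Suc d)) {l \<in> W. h l \<noteq> 0} (waring_bound n (Suc d)) G"
      by (rule waring_mono) (use m k in \<open>auto intro: waring_bound_mono\<close>)
  qed (use w in simp_all)
qed

text \<open>This replaces the nonvanishing of the Hessian, which can fail.\<close>

lemma derivative_support:
  assumes F: "multilinear F" and U: "E.has_dim U (Suc (Suc n))"
    and h: "p \<in> U" "h p \<noteq> 0"
    and \<alpha>: "good_direction d F U h \<alpha>"
    and W: "W \<subseteq> U" "has_support (Suc d) (\<lambda>M. F (add_mset \<alpha> M)) W" "E.has_dim W k" "k \<le> Suc (Suc n)"
  shows "\<not> null W \<alpha>" and "(\<exists>u\<in>W. h u \<noteq> 0) \<or> k \<le> n"
proof -
  have sW: "E.subspace W" using W(3) by (rule E.has_dim_subspace)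
  obtain M0 where M0: "size M0 = d" "F (add_mset \<alpha> (add_mset \<alpha> M0)) \<noteq> 0"
    using \<alpha> by (auto simp: good_direction_def)
  show "\<not> null W \<alpha>" using has_supportD[OF W(2), of \<alpha> M0] M0 by auto
  show "(\<exists>u\<in>W. h u \<noteq> 0) \<or> k \<le> n"
  proof (cases "\<exists>u\<in>W. h u \<noteq> 0")
    case False
    then have hW: "h u = 0" if "u \<in> W" for u using that by blast
    have "W \<noteq> U" using hW h by blast
    then have "k \<noteq> Suc (Suc n)" using has_dim_subset_eq[OF U _ W(1)] W(3) by blast
    \<comment> \<open>Otherwise W is a hyperplane \<beta> = 0 of U inside the cone, and
      \<beta>\<alpha>F \<noteq> 0 because \<alpha> is good; but \<beta> is null on W and kills
      \<alpha>F.\<close>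
    moreover have "k \<noteq> Suc n"
    proof
      assume k: "k = Suc n"
      obtain v where v: "v \<in> U" "v \<notin> W" using \<open>W \<noteq> U\<close> W(1) by blast
      obtain \<beta> where \<beta>: "null W \<beta>" "pr \<beta> v = 1" using separation[OF sW v(2)] by (auto simp: null_def)
      have nU: "\<not> null U \<beta>" using v(1) \<beta>(2) by (metis null_def zero_neq_one)
      obtain m where m: "Suc (Suc n) = Suc m" "E.has_dim (U \<inter> ker \<beta>) m"
        using has_dim_hyperplane[OF U nU] .
      have "W = U \<inter> ker \<beta>"
        using has_dim_subset_eq[of "U \<inter> ker \<beta>" m W] m W(1,3) k \<beta>(1) by (auto simp: null_def ker_def)
      then have "\<forall>u\<in>U. pr \<beta> u = 0 \<longrightarrow> h u = 0" using hW by (auto simp: ker_def)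
      then obtain M where "size M = d" "F (add_mset \<beta> (add_mset \<alpha> M)) \<noteq> 0"
        using \<alpha> unfolding good_direction_def by blast
      then show False using has_supportD[OF W(2) \<beta>(1), of M] by (simp add: add_mset_commute)
    qed
    ultimately show ?thesis using W(4) by simp
  qed simp
qed

text \<open>Using h times \<alpha> makes the resulting forms fit for integration. If W lies in the
  cone, its dimension is at most n; splitting off the power of one form outside the cone leaves at
  most n + 1 variables, and the strict growth of \<open>waring_bound\<close> pays for that power.
  The sharper count in the first case yields 5 for ternary cubics whose derivative has rank
  2.\<close>

lemma derivative_waring:
  assumes F: "multilinear F" and sup: "has_support (Suc (Suc (Suc d))) F U"
    and U: "E.has_dim U (Suc (Suc n))"
    and h: "cone_fun h" "p \<in> U" "h p \<noteq> 0"
    and \<alpha>: "good_direction (Suc d) F U h \<alpha>"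
    and W: "W \<subseteq> U" "has_support (Suc (Suc d)) (\<lambda>M. F (add_mset \<alpha> M)) W" "E.has_dim W k" "k \<le> Suc (Suc n)"
    and IH: "\<And>m. m \<le> Suc n \<Longrightarrow> waring_claim m (Suc d)"
  shows "waring (Suc (Suc d)) {l \<in> U. h l \<noteq> 0 \<and> pr \<alpha> l \<noteq> 0}
    (if \<exists>u\<in>W. h u \<noteq> 0 then waring_bound (k - 1) (Suc d) else waring_bound (Suc n) (Suc d))
    (\<lambda>M. F (add_mset \<alpha> M))"
proof -
  have sU: "E.subspace U" using U by (rule E.has_dim_subspace)
  have sW: "E.subspace W" using W(3) by (rule E.has_dim_subspace)
  define D where "D M = F (add_mset \<alpha> M)" for M
  have D: "multilinear D" unfolding D_def using F by (rule multilinear_contract)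
  have supD: "has_support (Suc (Suc d)) D W" using W(2) by (simp add: D_def[abs_def])
  define h' where "h' u = h u * pr \<alpha> u" for u
  have h': "cone_fun h'" unfolding h'_def using h(1) by (rule cone_fun_times_pr)
  have \<alpha>W: "\<not> null W \<alpha>" and kn: "(\<exists>u\<in>W. h u \<noteq> 0) \<or> k \<le> n"
    using derivative_support[OF F U h(2,3) \<alpha> W] by blast+
  then have \<alpha>U: "\<not> null U \<alpha>" using W(1) by (auto simp: null_def)
  have "k \<noteq> 0" 
  proof
    assume "k = 0"
    then have "W = {0}" using W(3) E.has_dim_zeroD by simp
    then show False using \<alpha>W by (simp add: null_def)
  qed
  then obtain k' where k': "k = Suc k'" using not0_implies_Suc by blast
  show ?thesis
  proof (cases "\<exists>u\<in>W. h u \<noteq> 0")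
    case True
    then obtain u where u: "u \<in> W" "h' u \<noteq> 0"
      using cone_fun_times_pr_nonzero[OF sW h(1) _ _ \<alpha>W] unfolding h'_def by (metis mult_eq_0_iff)
    have "waring (Suc (Suc d)) {l \<in> W. h' l \<noteq> 0} (waring_bound k' (Suc d)) D"
      by (rule waring_claimD[OF _ D supD _ h' u]) (use IH[of k'] W(3,4) k' in auto)
    then have "waring (Suc (Suc d)) {l \<in> U. h l \<noteq> 0 \<and> pr \<alpha> l \<noteq> 0} (waring_bound k' (Suc d)) D"
      by (rule waring_mono) (use W(1) in \<open>auto simp: h'_def\<close>)
    then show ?thesis using True k' unfolding D_def by simp
  next
    case False
    then have hW: "h u = 0" if "u \<in> W" for u using that by blast
    have k: "Suc k' \<le> n" using kn False k' by simp
    obtain m where m: "m \<in> U" "h m \<noteq> 0" "pr \<alpha> m \<noteq> 0"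
      using cone_fun_times_pr_nonzero[OF sU h(1) h(2,3) \<alpha>U] by blast
    have mW: "m \<notin> W" using m(2) hW by blast
    define D' where "D' M = D M + (- 1) * pow m M" for M
    have D': "multilinear D'" unfolding D'_def by (intro multilinear_plus multilinear_times multilinear_pow D)
    have supD': "has_support (Suc (Suc d)) D' (E.span (insert m W))"
      unfolding D'_def by (rule has_support_add_pow[OF supD sW mW]) auto
    have sub: "E.span (insert m W) \<subseteq> U" using m(1) W(1) sU by (intro E.span_minimal) auto
    have "waring (Suc (Suc d)) {l \<in> E.span (insert m W). h' l \<noteq> 0} (waring_bound (Suc k') (Suc d)) D'"
      by (rule waring_claimD[OF _ D' supD' _ h', of _ m])
        (use IH[of "Suc k'"] k E.has_dim_insert[OF W(3) mW] m k' in \<open>auto simp: h'_def E.span_base\<close>)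
    then have "waring (Suc (Suc d)) {l \<in> U. h' l \<noteq> 0} (waring_bound n (Suc d)) D'"
      by (rule waring_mono) (use sub k in \<open>auto intro: waring_bound_mono simp del: waring_bound.simps\<close>)
    moreover have "waring (Suc (Suc d)) {l \<in> U. h' l \<noteq> 0} 1 (pow m)"
      by (rule waring_single[of m _ _ _ 1]) (use m in \<open>auto simp: h'_def\<close>)
    moreover have "D M = D' M + pow m M" for M by (simp add: D'_def)
    ultimately have "waring (Suc (Suc d)) {l \<in> U. h' l \<noteq> 0} (waring_bound n (Suc d) + 1) D"
      by (rule waring_add)
    then have "waring (Suc (Suc d)) {l \<in> U. h' l \<noteq> 0} (waring_bound (Suc n) (Suc d)) D"
      by (rule waring_mono[OF _ order_refl])
        (use waring_bound_Suc_less[of n d] in \<open>simp del: waring_bound.simps\<close>)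
    then show ?thesis using False unfolding D_def h'_def by simp
  qed
qed

end

section \<open>Ternary cubics\<close>

text \<open>Since the rows are orthogonal, the transpose with its columns divided by the weights is
  a right inverse, hence also a left inverse.\<close>

lemma orthogonal_columns:
  fixes N :: "nat \<Rightarrow> nat \<Rightarrow> 'a::field"
  assumes rows: "\<And>i j. i < n \<Longrightarrow> j < n \<Longrightarrow> (\<Sum>k<n. N i k * N j k) = (if i = j then w i else 0)"
    and w: "\<And>i. i < n \<Longrightarrow> w i \<noteq> 0"
    and jk: "j < n" "k < n"
  shows "(\<Sum>i<n. N i j * N i k / w i) = (if j = k then 1 else 0)"
proof -
  define A where "A = mat n n (\<lambda>(i, k). N i k)"
  define B where "B = mat n n (\<lambda>(k, j). N j k / w j)"
  have AB: "A \<in> carrier_mat n n" "B \<in> carrier_mat n n" by (simp_all add: A_def B_def)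
  have "A * B = 1\<^sub>m n"
  proof (rule eq_matI)
    fix i j assume "i < dim_row (1\<^sub>m n :: 'a mat)" "j < dim_col (1\<^sub>m n :: 'a mat)"
    then have ij: "i < n" "j < n" by auto
    have "(A * B) $$ (i, j) = (\<Sum>k<n. N i k * (N j k / w j))"
      using ij by (simp add: A_def B_def scalar_prod_def atLeast0LessThan)
    also have "\<dots> = (\<Sum>k<n. N i k * N j k) / w j" by (simp add: sum_divide_distrib)
    also have "\<dots> = (if i = j then 1 else 0)" using rows[OF ij] w ij by simp
    finally show "(A * B) $$ (i, j) = 1\<^sub>m n $$ (i, j)" using ij by simp
  qed (simp_all add: A_def B_def)
  then have "B * A = 1\<^sub>m n" using mat_mult_left_right_inverse[OF AB] by simp
  then have "(B * A) $$ (j, k) = (if j = k then 1 else 0)" using jk by simp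
  moreover have "(B * A) $$ (j, k) = (\<Sum>i<n. N i j / w i * N i k)"
    using jk by (simp add: A_def B_def scalar_prod_def atLeast0LessThan)
  ultimately show ?thesis by simp
qed

lemma cubic_distinct_roots:
  fixes b c d :: "'a::{alg_closed_field,field_char_0}"
  assumes "\<And>p. p ^ 3 + b * p ^ 2 + c * p + d = 0 \<Longrightarrow> 3 * p ^ 2 + 2 * b * p + c \<noteq> 0"
  obtains p1 p2 p3 where "p1 \<noteq> p2" "p1 \<noteq> p3" "p2 \<noteq> p3"
    "p1 ^ 3 + b * p1 ^ 2 + c * p1 + d = 0" "p2 ^ 3 + b * p2 ^ 2 + c * p2 + d = 0"
    "p3 ^ 3 + b * p3 ^ 2 + c * p3 + d = 0"
proof -
  obtain p1 where "poly [:d, c, b, 1:] p1 = 0"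
    using alg_closed_imp_poly_has_root[of "[:d, c, b, 1:]"] by auto
  then have p1: "p1 ^ 3 + b * p1 ^ 2 + c * p1 + d = 0"
    by (simp add: algebra_simps power2_eq_square power3_eq_cube)
  \<comment> \<open>The quotient of the cubic by the factor x - p1.\<close>
  obtain p2 where "poly [:c + b * p1 + p1 ^ 2, b + p1, 1:] p2 = 0"
    using alg_closed_imp_poly_has_root[of "[:c + b * p1 + p1 ^ 2, b + p1, 1:]"] by auto
  then have p2: "p2 ^ 2 + (b + p1) * p2 + (c + b * p1 + p1 ^ 2) = 0"
    by (simp add: algebra_simps power2_eq_square)
  define p3 where "p3 = - b - p1 - p2"
  have b: "b = - p1 - p2 - p3" by (simp add: p3_def)
  have "c = - (p2 ^ 2 + (b + p1) * p2 + b * p1 + p1 ^ 2)"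
    by (rule eq_neg_iff_add_eq_0[THEN iffD2]) (use p2 in \<open>simp add: ac_simps\<close>)
  also have "\<dots> = p1 * p2 + p1 * p3 + p2 * p3" unfolding b by Groebner_Basis.algebra
  finally have c: "c = p1 * p2 + p1 * p3 + p2 * p3" .
  have "d = - (p1 ^ 3 + b * p1 ^ 2 + c * p1)"
    by (rule eq_neg_iff_add_eq_0[THEN iffD2]) (use p1 in \<open>simp add: ac_simps\<close>)
  also have "\<dots> = - p1 * p2 * p3" unfolding b c by Groebner_Basis.algebra
  finally have d: "d = - p1 * p2 * p3" .
  have roots: "p ^ 3 + b * p ^ 2 + c * p + d = (p - p1) * (p - p2) * (p - p3)" for p
    unfolding b c d by Groebner_Basis.algebra
  have deriv: "3 * p ^ 2 + 2 * b * p + c = (p - p1) * (p - p2) + (p - p1) * (p - p3) + (p - p2) * (p - p3)" for p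
    unfolding b c by Groebner_Basis.algebra
  have "p1 \<noteq> p2" using assms[of p1] unfolding roots deriv by auto
  moreover have "p1 \<noteq> p3" using assms[of p1] unfolding roots deriv by auto
  moreover have "p2 \<noteq> p3" using assms[of p2] unfolding roots deriv by auto
  ultimately show ?thesis using that[of p1 p2 p3] unfolding roots by simp
qed

context dual_pair
begin

definition tri :: "('x multiset \<Rightarrow> 'a) \<Rightarrow> 'x \<Rightarrow> 'x \<Rightarrow> 'x \<Rightarrow> 'a" where
  "tri F a b c = F {#a, b, c#}"

lemma tri_sym: "tri F a b c = tri F b a c" "tri F a b c = tri F a c b"
  by (simp_all add: tri_def add_mset_commute)

lemma tri_linear:
  assumes F: "multilinear F"
  shows "tri F (a + a') b c = tri F a b c + tri F a' b c"
    "tri F a (b + b') c = tri F a b c + tri F a b' c"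
    "tri F a b (c + c') = tri F a b c + tri F a b c'"
    "tri F (t \<odot> a) b c = t * tri F a b c"
    "tri F a (t \<odot> b) c = t * tri F a b c"
    "tri F a b (t \<odot> c) = t * tri F a b c"
    "tri F (a - a') b c = tri F a b c - tri F a' b c"
    "tri F a (b - b') c = tri F a b c - tri F a b' c"
    "tri F a b (c - c') = tri F a b c - tri F a b c'"
proof -
  have 1: "tri F (a + a') b c = tri F a b c + tri F a' b c"
    and 2: "tri F (t \<odot> a) b c = t * tri F a b c"
    and 3: "tri F (a - a') b c = tri F a b c - tri F a' b c" for a a' b c t
    by (simp_all add: tri_def multilinear_add[OF F] multilinear_scale[OF F] multilinear_diff[OF F])
  have s: "tri F a b c = tri F c b a" for a b c using tri_sym by metis
  show "tri F (a + a') b c = tri F a b c + tri F a' b c"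
    "tri F (t \<odot> a) b c = t * tri F a b c"
    "tri F (a - a') b c = tri F a b c - tri F a' b c" by (fact 1 2 3)+
  show "tri F a (b + b') c = tri F a b c + tri F a b' c" using 1[of b b' a c] by (metis tri_sym(1))
  show "tri F a (t \<odot> b) c = t * tri F a b c" using 2[of t b a c] by (metis tri_sym(1))
  show "tri F a (b - b') c = tri F a b c - tri F a b' c" using 3[of b b' a c] by (metis tri_sym(1))
  show "tri F a b (c + c') = tri F a b c + tri F a b c'" using 1[of c c' b a] by (metis s)
  show "tri F a b (t \<odot> c) = t * tri F a b c" using 2[of t c b a] by (metis s)
  show "tri F a b (c - c') = tri F a b c - tri F a b c'" using 3[of c c' b a] by (metis s)
qed

lemma size2_mset:
  assumes "size M = 2"
  shows "\<exists>a b. M = {#a, b#}"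
proof -
  obtain a N where N: "M = add_mset a N" using size_eq_Suc_imp_eq_union[of M 1] assms by auto
  then have "size N = 1" using assms by simp
  then show ?thesis using N size_1_singleton_mset[of N] by auto
qed

lemma size3_mset:
  assumes "size M = 3"
  shows "\<exists>a b c. M = {#a, b, c#}"
proof -
  obtain a N where N: "M = add_mset a N" using size_eq_Suc_imp_eq_union[of M 2] assms by auto
  then have "size N = 2" using assms by simp
  then show ?thesis using N size2_mset[of N] by auto
qed

lemma has_support_cubic: "has_support 3 F U \<longleftrightarrow> (\<forall>\<beta>. (\<forall>\<xi> \<zeta>. tri F \<beta> \<xi> \<zeta> = 0) \<longleftrightarrow> null U \<beta>)"
proof -
  have "(\<forall>M. Suc (size M) = 3 \<longrightarrow> F (add_mset \<beta> M) = 0) \<longleftrightarrow> (\<forall>\<xi> \<zeta>. tri F \<beta> \<xi> \<zeta> = 0)" for \<beta>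
  proof
    assume *: "\<forall>\<xi> \<zeta>. tri F \<beta> \<xi> \<zeta> = 0"
    show "\<forall>M. Suc (size M) = 3 \<longrightarrow> F (add_mset \<beta> M) = 0"
    proof (intro allI impI)
      fix M :: "'x multiset" assume "Suc (size M) = 3"
      then obtain a b where "M = {#a, b#}" using size2_mset[of M] by auto
      then show "F (add_mset \<beta> M) = 0" using * by (simp add: tri_def)
    qed
  qed (simp add: tri_def)
  then show ?thesis by (simp add: has_support_def)
qed

lemma pow_scale: "pow (c \<cdot> l) M = c ^ size M * pow l M"
  by (induction M) (simp_all add: pr_simps)

text \<open>Five cubes in the normal form
  \<open>x\<^sup>3 + 3 x (y\<^sup>2 + z\<^sup>2) + (binary cubic in y, z)\<close>: besides \<open>y\<^sup>3\<close> and \<open>z\<^sup>3\<close> we use the cubes of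
  \<open>x + p y + q z\<close> where \<open>(p, q)\<close> runs through the support of a three point measure on the plane with
  mean zero, identity covariance and prescribed mixed third moments. Multiplication by the first
  coordinate is then a symmetric operator on the functions on these points, whose characteristic
  polynomial depends linearly on one free parameter \<open>k\<close>, the third moment in \<open>p\<close>.\<close>

lemma three_point_measure:
  fixes c1 r :: 'a
  assumes c1: "c1 \<noteq> 0" and r: "r \<noteq> 0" and Z: "finite Z"
  shows "\<exists>P Q w :: nat \<Rightarrow> 'a.
    (\<forall>i<3. P i \<notin> Z \<and> P i \<noteq> r \<and> Q i = c1 * P i / (P i - r)) \<and>
    (\<Sum>i<3. w i) = 1 \<and> (\<Sum>i<3. w i * P i) = 0 \<and> (\<Sum>i<3. w i * Q i) = 0 \<and>
    (\<Sum>i<3. w i * P i ^ 2) = 1 \<and> (\<Sum>i<3. w i * P i * Q i) = 0 \<and> (\<Sum>i<3. w i * Q i ^ 2) = 1 \<and>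
    (\<Sum>i<3. w i * P i ^ 2 * Q i) = c1 \<and> (\<Sum>i<3. w i * P i * Q i ^ 2) = r"
proof -
  \<comment> \<open>On the curve q = c1 p / (p - r), \<open>disc p\<close> is (p - r)^2 times 1 +
    p^2 + q^2, the norm whose inverse becomes a weight. It is also the numerator of the derivative
    of \<open>\<kappa>\<close> below. So one condition excludes isotropic points and double
    roots.\<close>
  define disc where "disc p = p ^ 2 * (p - r) ^ 2 + (p - r) ^ 2 + c1 ^ 2 * p ^ 2" for p
  have "finite {p. disc p = 0}"
  proof (rule polynomial_fun_finite_zeros)
    show "polynomial_fun disc" unfolding disc_def by (intro poly_intros)
    show "disc r \<noteq> 0" using c1 r by (simp add: disc_def)
  qed
  then have fin: "finite (Z \<union> {p. disc p = 0})" using Z by simp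
  \<comment> \<open>In the basis 1, p, q multiplication by p has the symmetric matrix with rows (0,
    1, 0), (1, k, c1), (0, c1, r). The cubic in \<open>root\<close> is its characteristic
    polynomial; solved for k it gives \<open>\<kappa>\<close>. The last row gives q = c1 p / (p -
    r).\<close>
  define \<kappa> where "\<kappa> p = (p ^ 2 - 1) / p - c1 ^ 2 / (p - r)" for p
  obtain k where k: "k \<notin> \<kappa> ` (Z \<union> {p. disc p = 0})"
    using ex_new_if_finite[OF infinite_UNIV_char_0, of "\<kappa> ` (Z \<union> {p. disc p = 0})"] fin by blast
  have root: "p \<noteq> 0 \<and> p \<noteq> r \<and> k = \<kappa> p"
    if p: "p ^ 3 + (- (k + r)) * p ^ 2 + (k * r - 1 - c1 ^ 2) * p + r = 0" for p
  proof -
    have e: "(p ^ 2 - 1 - k * p) * (p - r) = c1 ^ 2 * p" using p by Groebner_Basis.algebra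
    have "p \<noteq> 0" using p r by auto
    moreover have "p \<noteq> r" using e c1 r by auto
    moreover have "k = \<kappa> p" using e calculation by (simp add: \<kappa>_def field_simps)
    ultimately show ?thesis by simp
  qed
  have not_bad: "p \<notin> Z \<and> disc p \<noteq> 0"
    if p: "p ^ 3 + (- (k + r)) * p ^ 2 + (k * r - 1 - c1 ^ 2) * p + r = 0" for p
    using root[OF p] k by auto
  have "3 * p ^ 2 + 2 * (- (k + r)) * p + (k * r - 1 - c1 ^ 2) \<noteq> 0"
    if p: "p ^ 3 + (- (k + r)) * p ^ 2 + (k * r - 1 - c1 ^ 2) * p + r = 0" for p
  proof
    assume d: "3 * p ^ 2 + 2 * (- (k + r)) * p + (k * r - 1 - c1 ^ 2) = 0"
    have "disc p = 0" unfolding disc_def using p d by Groebner_Basis.algebra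
    then show False using not_bad[OF p] by simp
  qed
  from cubic_distinct_roots[OF this]
  obtain p1 p2 p3 where distinct: "p1 \<noteq> p2" "p1 \<noteq> p3" "p2 \<noteq> p3"
    and roots: "p1 ^ 3 + (- (k + r)) * p1 ^ 2 + (k * r - 1 - c1 ^ 2) * p1 + r = 0"
      "p2 ^ 3 + (- (k + r)) * p2 ^ 2 + (k * r - 1 - c1 ^ 2) * p2 + r = 0"
      "p3 ^ 3 + (- (k + r)) * p3 ^ 2 + (k * r - 1 - c1 ^ 2) * p3 + r = 0" by blast
  define P where "P i = (if i = 0 then p1 else if i = 1 then p2 else p3)" for i :: nat
  have i3: "i < 3 \<Longrightarrow> i = 0 \<or> i = 1 \<or> i = 2" for i :: nat by auto
  have P_root: "P i ^ 3 + (- (k + r)) * P i ^ 2 + (k * r - 1 - c1 ^ 2) * P i + r = 0" for i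
    using roots by (simp add: P_def)
  have P_inj: "P i \<noteq> P j" if "i < 3" "j < 3" "i \<noteq> j" for i j
    using that distinct i3[of i] i3[of j] by (auto simp: P_def)
  define Q where "Q i = c1 * P i / (P i - r)" for i
  have Pr: "P i \<noteq> r" "P i \<noteq> 0" "P i - r \<noteq> 0" for i using root[OF P_root] by auto
  have PQ: "P i * Q i = c1 * P i + r * Q i" for i
    using Pr[of i] by (simp add: Q_def field_simps)
  define N where "N i j = (if j = 0 then 1 else if j = 1 then P i else Q i)" for i j :: nat
  define v where "v i = 1 + P i ^ 2 + Q i ^ 2" for i
  have sum3: "(\<Sum>k<3. f k) = f 0 + f 1 + f 2" for f :: "nat \<Rightarrow> 'a"
    by (simp add: numeral_3_eq_3 numeral_2_eq_2)
  have v0: "v i \<noteq> 0" for i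
  proof -
    have "v i * (P i - r) ^ 2 = disc (P i)"
      unfolding v_def disc_def using PQ[of i] by Groebner_Basis.algebra
    then show ?thesis using not_bad[OF P_root[of i]] by auto
  qed
  \<comment> \<open>Eigenvectors (1, p, q) of a symmetric matrix for distinct eigenvalues are
    orthogonal.\<close>
  have orth: "1 + P i * P j + Q i * Q j = 0" if "i < 3" "j < 3" "i \<noteq> j" for i j
  proof -
    have "(P i - P j) * ((P i - r) * (P j - r) * (1 + P i * P j) + c1 ^ 2 * P i * P j) = 0"
      using P_root[of i] P_root[of j] by Groebner_Basis.algebra
    then have "(P i - r) * (P j - r) * (1 + P i * P j) + c1 ^ 2 * P i * P j = 0"
      using P_inj[OF that] by simp
    moreover have "(P i - r) * (P j - r) * (1 + P i * P j + Q i * Q j) =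
        (P i - r) * (P j - r) * (1 + P i * P j) + c1 ^ 2 * P i * P j"
      using PQ[of i] PQ[of j] by Groebner_Basis.algebra
    ultimately show ?thesis using Pr(3) by (metis mult_eq_0_iff)
  qed
  have rows: "(\<Sum>k<3. N i k * N j k) = (if i = j then v i else 0)" if "i < 3" "j < 3" for i j
    using orth[OF that] by (auto simp: sum3 N_def v_def power2_eq_square)
  \<comment> \<open>Orthonormality of the columns is the list of all moments up to order
    two.\<close>
  have cols: "(\<Sum>i<3. N i j * N i k / v i) = (if j = k then 1 else 0)" if "j < 3" "k < 3" for j k
    using orthogonal_columns[OF rows v0 that] .
  define w where "w i = 1 / v i" for i
  have m: "(\<Sum>i<3. w i) = 1" "(\<Sum>i<3. w i * P i) = 0" "(\<Sum>i<3. w i * Q i) = 0"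
    "(\<Sum>i<3. w i * P i ^ 2) = 1" "(\<Sum>i<3. w i * P i * Q i) = 0" "(\<Sum>i<3. w i * Q i ^ 2) = 1"
    using cols[of 0 0] cols[of 0 1] cols[of 0 2] cols[of 1 1] cols[of 1 2] cols[of 2 2]
    by (simp_all add: N_def w_def power2_eq_square)
  \<comment> \<open>Multiplying p q = c1 p + r q by p, and afterwards by q, reduces the mixed third
    moments to second ones.\<close>
  have "(\<Sum>i<3. w i * P i ^ 2 * Q i) = (\<Sum>i<3. c1 * (w i * P i ^ 2) + r * (w i * P i * Q i))"
  proof (intro sum.cong refl)
    fix i show "w i * P i ^ 2 * Q i = c1 * (w i * P i ^ 2) + r * (w i * P i * Q i)"
      using PQ[of i] by Groebner_Basis.algebra
  qed
  also have "\<dots> = c1" by (simp only: sum.distrib sum_distrib_left[symmetric] m) simp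
  finally have m1: "(\<Sum>i<3. w i * P i ^ 2 * Q i) = c1" .
  have "(\<Sum>i<3. w i * P i * Q i ^ 2) = (\<Sum>i<3. c1 * (w i * P i * Q i) + r * (w i * Q i ^ 2))"
  proof (intro sum.cong refl)
    fix i show "w i * P i * Q i ^ 2 = c1 * (w i * P i * Q i) + r * (w i * Q i ^ 2)" using PQ[of i] by Groebner_Basis.algebra
  qed
  also have "\<dots> = r" by (simp only: sum.distrib sum_distrib_left[symmetric] m) simp
  finally have m2: "(\<Sum>i<3. w i * P i * Q i ^ 2) = r" .
  show ?thesis
    by (rule exI[of _ P], rule exI[of _ Q], rule exI[of _ w])
       (use not_bad[OF P_root] Pr Q_def m m1 m2 in simp)
qed

text \<open>Each entry is replaced by its expansion in S, from which it differs by a null direction;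
  the multiset N in the induction collects the entries already expanded.\<close>

lemma vanishes_on_basis:
  assumes G: "multilinear G" and live: "lives_on d G U"
    and basis: "\<And>\<xi>. null U (\<xi> - (\<Sum>s\<in>S. c \<xi> s \<odot> s))"
    and zero: "\<And>M. set_mset M \<subseteq> S \<Longrightarrow> size M = d \<Longrightarrow> G M = 0"
    and M: "size M = d"
  shows "G M = 0"
proof -
  have gsum: "G (add_mset (\<Sum>s\<in>A. c \<xi> s \<odot> s) M) = (\<Sum>s\<in>A. c \<xi> s * G (add_mset s M))" for A \<xi> M
    by (induction A rule: infinite_finite_induct)
       (simp_all add: multilinear_add[OF G] multilinear_scale[OF G] multilinear_zero[OF G])
  have "G (M + N) = 0" if "set_mset N \<subseteq> S" "size (M + N) = d" for N
    using that
  proof (induction M arbitrary: N)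
    case empty
    then show ?case using zero by simp
  next
    case (add \<xi> M)
    have "G (add_mset (\<xi> - (\<Sum>s\<in>S. c \<xi> s \<odot> s)) (M + N)) = 0"
      using live basis[of \<xi>] add.prems(2) by (simp add: lives_on_def)
    then have "G (add_mset \<xi> (M + N)) = (\<Sum>s\<in>S. c \<xi> s * G (add_mset s (M + N)))"
      by (simp add: multilinear_diff[OF G] gsum)
    also have "\<dots> = 0"
    proof (intro sum.neutral ballI)
      fix s assume "s \<in> S"
      then have "G (M + add_mset s N) = 0" using add.prems by (intro add.IH) auto
      then show "c \<xi> s * G (add_mset s (M + N)) = 0" by simp
    qed
    finally show ?case by simp
  qed
  from this[of "{#}"] M show ?thesis by simp
qed

lemma ternary_cubic_normal_form:
  assumes F: "multilinear F" and live: "lives_on 3 F U" and U: "U = E.span {x, y, z}"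
    and h: "cone_fun h" "h y \<noteq> 0" "h z \<noteq> 0"
    and dual: "pr \<alpha> x = 1" "pr \<alpha> y = 0" "pr \<alpha> z = 0" "pr \<eta> x = 0" "pr \<eta> y = 1" "pr \<eta> z = 0"
      "pr \<zeta> x = 0" "pr \<zeta> y = 0" "pr \<zeta> z = 1"
    and T: "tri F \<alpha> \<alpha> \<alpha> = 1" "tri F \<alpha> \<alpha> \<eta> = 0" "tri F \<alpha> \<alpha> \<zeta> = 0" "tri F \<alpha> \<eta> \<eta> = 1"
      "tri F \<alpha> \<eta> \<zeta> = 0" "tri F \<alpha> \<zeta> \<zeta> = 1" "tri F \<eta> \<eta> \<zeta> \<noteq> 0" "tri F \<eta> \<zeta> \<zeta> \<noteq> 0"
  shows "waring 3 {l \<in> U. h l \<noteq> 0} 5 F"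
proof -
  define c1 where "c1 = tri F \<eta> \<eta> \<zeta>"
  define r where "r = tri F \<eta> \<zeta> \<zeta>"
  have c1: "c1 \<noteq> 0" and r: "r \<noteq> 0" using T by (simp_all add: c1_def r_def)
  \<comment> \<open>This is (p - r) (x + p y + q z) with q = c1 p / (p - r); clearing the
    denominator makes it quadratic in p. At p = r only a nonzero multiple of z is left, which is
    outside the cone, so all but finitely many p are allowed.\<close>
  define curve where "curve p = (- r) \<cdot> x + p \<cdot> (x - r \<cdot> y + c1 \<cdot> z) + (p * p) \<cdot> y" for p
  have "curve r = (c1 * r) \<cdot> z"
    by (simp add: curve_def E.scale_right_distrib E.scale_right_diff_distrib algebra_simps)
  then have "h (curve r) \<noteq> 0" using h(1,3) c1 r by (simp add: cone_fun_def)
  moreover have "polynomial_fun (\<lambda>p. h (curve p))" using h(1) unfolding curve_def cone_fun_def by blast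
  ultimately have Z: "finite {p. h (curve p) = 0}" using polynomial_fun_finite_zeros by blast
  obtain P Q w :: "nat \<Rightarrow> 'a" where
      PQ: "\<forall>i<3. P i \<notin> {p. h (curve p) = 0} \<and> P i \<noteq> r \<and> Q i = c1 * P i / (P i - r)"
    and mom: "(\<Sum>i<3. w i) = 1" "(\<Sum>i<3. w i * P i) = 0" "(\<Sum>i<3. w i * Q i) = 0"
      "(\<Sum>i<3. w i * P i ^ 2) = 1" "(\<Sum>i<3. w i * P i * Q i) = 0" "(\<Sum>i<3. w i * Q i ^ 2) = 1"
      "(\<Sum>i<3. w i * P i ^ 2 * Q i) = c1" "(\<Sum>i<3. w i * P i * Q i ^ 2) = r"
    using three_point_measure[OF c1 r Z] by (elim exE conjE) (rule that)
  \<comment> \<open>The cubes of y and z contribute only to the values at \<eta>\<eta>\<eta> and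
    \<zeta>\<zeta>\<zeta>, the pure third moments that the measure does not control.\<close>
  define c where "c = tri F \<eta> \<eta> \<eta> - (\<Sum>i<3. w i * P i ^ 3)"
  define e where "e = tri F \<zeta> \<zeta> \<zeta> - (\<Sum>i<3. w i * Q i ^ 3)"
  define l where "l i = x + P i \<cdot> y + Q i \<cdot> z" for i
  define G where "G M = F M - ((\<Sum>i<3. w i * pow (l i) M) + (c * pow y M + e * pow z M))" for M
  have sum3: "(\<Sum>k<3. f k) = f 0 + f 1 + f 2" for f :: "nat \<Rightarrow> 'a"
    by (simp add: numeral_3_eq_3 numeral_2_eq_2)
  have G: "multilinear G"
    unfolding G_def sum3 by (intro multilinear_minus multilinear_plus multilinear_times multilinear_pow F)
  have xyz: "x \<in> U" "y \<in> U" "z \<in> U" unfolding U by (simp_all add: E.span_base)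
  have sU: "E.subspace U" unfolding U by simp
  have lU: "l i \<in> U" for i unfolding l_def using xyz sU by (intro E.subspace_add E.subspace_scale)
  have liveG: "lives_on 3 G U"
    using live xyz lU unfolding lives_on_def G_def null_def by auto
  have "null U (\<xi> - (\<Sum>s\<in>{\<alpha>, \<eta>, \<zeta>}. (if s = \<alpha> then pr \<xi> x else if s = \<eta> then pr \<xi> y else pr \<xi> z) \<odot> s))" for \<xi>
  proof -
    have "\<alpha> \<noteq> \<eta>" "\<alpha> \<noteq> \<zeta>" "\<eta> \<noteq> \<zeta>" using dual by auto
    then show ?thesis unfolding U null_span null_insert using dual by (simp add: pr_simps null_def)
  qed
  then have "G M = 0" if "size M = 3" for M
  proof (rule vanishes_on_basis[OF G liveG _ _ that])
    fix M :: "'x multiset" assume M: "set_mset M \<subseteq> {\<alpha>, \<eta>, \<zeta>}" "size M = 3"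
    obtain a b d where abd: "M = {#a, b, d#}" using size3_mset[OF M(2)] by blast
    have G_tri: "G {#a, b, d#} = tri F a b d - ((\<Sum>i<3. w i * (pr a (l i) * pr b (l i) * pr d (l i)))
        + (c * (pr a y * pr b y * pr d y) + e * (pr a z * pr b z * pr d z)))" for a b d
      by (simp add: G_def tri_def mult.assoc)
    have prl: "pr \<alpha> (l i) = 1" "pr \<eta> (l i) = P i" "pr \<zeta> (l i) = Q i" for i
      using dual by (simp_all add: l_def pr_simps)
    have Gs: "G {#\<alpha>, \<alpha>, \<alpha>#} = 0" "G {#\<alpha>, \<alpha>, \<eta>#} = 0" "G {#\<alpha>, \<alpha>, \<zeta>#} = 0" "G {#\<alpha>, \<eta>, \<eta>#} = 0"
      "G {#\<alpha>, \<eta>, \<zeta>#} = 0" "G {#\<alpha>, \<zeta>, \<zeta>#} = 0" "G {#\<eta>, \<eta>, \<eta>#} = 0" "G {#\<eta>, \<eta>, \<zeta>#} = 0"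
      "G {#\<eta>, \<zeta>, \<zeta>#} = 0" "G {#\<zeta>, \<zeta>, \<zeta>#} = 0"
      unfolding G_tri prl using mom T
      by (simp_all add: dual c_def e_def c1_def r_def power2_eq_square power3_eq_cube mult.assoc)
    have "a \<in> {\<alpha>, \<eta>, \<zeta>}" "b \<in> {\<alpha>, \<eta>, \<zeta>}" "d \<in> {\<alpha>, \<eta>, \<zeta>}" using M(1) abd by auto
    then show "G M = 0" unfolding abd using Gs
      by (elim insertE emptyE) (simp_all add: add_mset_commute)
  qed
  then have split: "F M = ((w 0 * pow (l 0) M + w 1 * pow (l 1) M) + w 2 * pow (l 2) M) + (c * pow y M + e * pow z M)"
    if "size M = 3" for M using that by (simp add: G_def sum3)
  let ?A = "{l \<in> U. h l \<noteq> 0}"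
  have wl: "waring 3 ?A 1 (\<lambda>M. w i * pow (l i) M)" if i: "i < 3" for i
  proof (rule waring_single)
    have nz: "P i - r \<noteq> 0" using PQ i by simp
    have "curve (P i) = (P i - r) \<cdot> x + ((P i - r) * P i) \<cdot> y + (c1 * P i) \<cdot> z"
      by (simp add: curve_def E.scale_right_distrib E.scale_right_diff_distrib E.scale_left_distrib
          E.scale_left_diff_distrib algebra_simps)
    also have "c1 * P i = (P i - r) * Q i" using PQ i nz by simp
    finally have curve: "curve (P i) = (P i - r) \<cdot> l i" by (simp add: l_def E.scale_right_distrib)
    have "curve (P i) \<in> U" unfolding curve using lU sU by (simp add: E.subspace_scale)
    then show "curve (P i) \<in> ?A" using PQ i by simp
    show "w i * pow (l i) M = w i / (P i - r) ^ 3 * pow (curve (P i)) M" if "size M = 3" for M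
      using nz that by (simp add: curve pow_scale)
  qed
  have wy: "waring 3 ?A 1 (\<lambda>M. c * pow y M)" "waring 3 ?A 1 (\<lambda>M. e * pow z M)"
    by (rule waring_single[of y], use xyz h in simp, rule refl)
       (rule waring_single[of z], use xyz h in simp, rule refl)
  have "waring 3 ?A (((1 + 1) + 1) + (1 + 1)) F"
    by (rule waring_add[OF waring_add[OF waring_add[OF wl[of 0] wl[of 1]] wl[of 2]] waring_add[OF wy]])
       (use split in simp_all)
  then show ?thesis by (simp add: eval_nat_numeral)
qed


lemma tri_two:
  shows "tri F b a a = tri F a a b" and "tri F a b a = tri F a a b"
  by (simp_all only: tri_sym(1)[of F b a a] tri_sym(2)[of F a b a])

text \<open>The difference (x + y)^3 - (x - y)^3 = 6 x^2 y + 2 y^3 recovers the values with a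
  repeated entry, and (x + y)^2 z then gives the others.\<close>

lemma tri_vanishes_on:
  assumes F: "multilinear F" and S: "\<And>x y. x \<in> S \<Longrightarrow> y \<in> S \<Longrightarrow> x + y \<in> S \<and> x - y \<in> S"
    and zero: "\<And>x. x \<in> S \<Longrightarrow> tri F x x x = 0"
    and xyz: "x \<in> S" "y \<in> S" "z \<in> S"
  shows "tri F x y z = 0"
proof -
  have 1: "tri F x x y = 0" if "x \<in> S" "y \<in> S" for x y
  proof -
    have "tri F (x + y) (x + y) (x + y) - tri F (x - y) (x - y) (x - y) = 6 * tri F x x y + 2 * tri F y y y"
      by (simp add: tri_linear[OF F] tri_two(1)[of F x y, symmetric] tri_two(2)[of F y x]
          tri_two(2)[of F x y] tri_two(1)[of F y x])
    then show ?thesis using zero S that by simp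
  qed
  have "tri F (x + y) (x + y) z = 2 * tri F x y z + tri F x x z + tri F y y z"
    by (simp add: tri_linear[OF F] tri_sym(1)[of F y x])
  then show ?thesis using 1 S xyz by simp
qed

lemma exists_null_outside:
  assumes "E.has_dim U n" "finite S" "card S < n"
  obtains \<beta> where "null S \<beta>" "\<not> null U \<beta>"
proof -
  obtain B where B: "E.independent B" "finite B" "card B = n" "E.span B = U"
    using assms(1) by (auto simp: E.has_dim_def)
  have "\<not> B \<subseteq> E.span S"
    using E.independent_span_bound[OF assms(2) B(1)] B(3) assms(3) by auto
  then obtain u where u: "u \<in> B" "u \<notin> E.span S" by blast
  from separation[OF E.subspace_span u(2)]
  obtain \<beta> where \<beta>: "null (E.span S) \<beta>" "pr \<beta> u = 1" by (auto simp: null_def)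
  have "u \<in> U" using u(1) B(4) E.span_base by blast
  then have "\<not> null U \<beta>" using \<beta>(2) by (metis null_def zero_neq_one)
  then show ?thesis using that \<beta>(1) by (simp add: null_span)
qed

lemma tri_null:
  assumes "has_support 3 F U" "null U \<beta>"
  shows "tri F \<beta> \<xi> \<zeta> = 0" "tri F \<xi> \<beta> \<zeta> = 0" "tri F \<xi> \<zeta> \<beta> = 0"
  using assms tri_sym unfolding has_support_cubic by metis+

lemma tri_representer:
  assumes F: "multilinear F" and sup: "has_support 3 F U" and U: "E.has_dim U n"
  obtains p where "p \<in> U" "\<And>\<zeta>. tri F \<alpha> \<xi> \<zeta> = pr \<zeta> p"
  by (rule representer[OF U, of "tri F \<alpha> \<xi>"]) (use tri_null[OF sup] in \<open>auto simp: tri_linear[OF F]\<close>)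

text \<open>If all these minors vanished, F would be a multiple of the cube of one linear form: F
  would vanish on the directions S with F(\<alpha>, \<alpha>, \<eta>) = 0, also when one entry is
  \<alpha>. Then every direction in S kills F, and with at least two variables one of them is not
  null on U.\<close>

lemma cubic_hessian_minor:
  assumes F: "multilinear F" and sup: "has_support 3 F U" and U: "E.has_dim U (Suc (Suc n))"
  shows "\<exists>\<alpha> \<eta>. tri F \<alpha> \<alpha> \<alpha> \<noteq> 0 \<and> tri F \<alpha> \<alpha> \<alpha> * tri F \<alpha> \<eta> \<eta> - (tri F \<alpha> \<alpha> \<eta>)\<^sup>2 \<noteq> 0"
proof (rule ccontr)
  assume "\<not> ?thesis"
  then have deg: "tri F \<alpha> \<alpha> \<alpha> * tri F \<alpha> \<eta> \<eta> = (tri F \<alpha> \<alpha> \<eta>)\<^sup>2" if "tri F \<alpha> \<alpha> \<alpha> \<noteq> 0" for \<alpha> \<eta>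
    using that by (metis eq_iff_diff_eq_0)
  obtain \<beta>0 where "\<not> null U \<beta>0" using has_dim_not_null[OF U] .
  then obtain \<xi>0 \<zeta>0 where "tri F \<beta>0 \<xi>0 \<zeta>0 \<noteq> 0" using sup unfolding has_support_cubic by blast
  then obtain \<alpha> where f: "tri F \<alpha> \<alpha> \<alpha> \<noteq> 0"
    using tri_vanishes_on[OF F, of UNIV \<beta>0 \<xi>0 \<zeta>0] by blast
  define S where "S = {\<eta>. tri F \<alpha> \<alpha> \<eta> = 0}"
  have S: "x + y \<in> S \<and> x - y \<in> S" if "x \<in> S" "y \<in> S" for x y
    using that by (simp add: S_def tri_linear[OF F])
  have k: "tri F \<alpha> \<eta> \<eta> = 0" if "\<eta> \<in> S" for \<eta> using deg[OF f, of \<eta>] f that by (simp add: S_def)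
  have e: "tri F \<eta> \<eta> \<eta> = 0" if \<eta>: "\<eta> \<in> S" for \<eta>
  proof -
    \<comment> \<open>Comparing both sides leaves t F(\<alpha>, \<alpha>, \<alpha>) F(\<eta>,
      \<eta>, \<eta>) = 0. At least one of t = 1 and t = -1 satisfies the premise.\<close>
    have *: "(tri F \<alpha> \<alpha> \<alpha> + t ^ 3 * tri F \<eta> \<eta> \<eta>) * (t * tri F \<eta> \<eta> \<eta>) = (t\<^sup>2 * tri F \<eta> \<eta> \<eta>)\<^sup>2"
      if "tri F \<alpha> \<alpha> \<alpha> + t ^ 3 * tri F \<eta> \<eta> \<eta> \<noteq> 0" for t
      using deg[of "\<alpha> + t \<odot> \<eta>" \<eta>] that \<eta> k[OF \<eta>]
      by (simp add: tri_linear[OF F] S_def tri_two(1)[of F \<eta> \<alpha>] tri_two(2)[of F \<alpha> \<eta>]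
          tri_two(2)[of F \<eta> \<alpha>] tri_two(1)[of F \<alpha> \<eta>, symmetric] power2_eq_square power3_eq_cube mult.assoc)
    show ?thesis
    proof (cases "tri F \<alpha> \<alpha> \<alpha> + tri F \<eta> \<eta> \<eta> = 0")
      case False
      then show ?thesis using *[of 1] f by (simp add: power2_eq_square algebra_simps)
    next
      case True
      then have "tri F \<alpha> \<alpha> \<alpha> = - tri F \<eta> \<eta> \<eta>" by (simp add: eq_neg_iff_add_eq_0)
      then show ?thesis using *[of "- 1"] f by (simp add: power2_eq_square power3_eq_cube algebra_simps)
    qed
  qed
  have k': "tri F \<alpha> \<eta> \<zeta> = 0" if "\<eta> \<in> S" "\<zeta> \<in> S" for \<eta> \<zeta>
    using k[of "\<eta> + \<zeta>"] k[OF that(1)] k[OF that(2)] S[OF that]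
    by (simp add: tri_linear[OF F] tri_sym(2)[of F \<alpha> \<zeta> \<eta>])
  have e': "tri F x y z = 0" if "x \<in> S" "y \<in> S" "z \<in> S" for x y z
    using tri_vanishes_on[OF F S e that] .
  obtain p where p: "p \<in> U" "\<And>\<zeta>. tri F \<alpha> \<alpha> \<zeta> = pr \<zeta> p" using tri_representer[OF F sup U] by blast
  obtain \<beta> where \<beta>: "null {p} \<beta>" "\<not> null U \<beta>" using exists_null_outside[OF U, of "{p}"] by auto
  have \<beta>S: "\<beta> \<in> S" using \<beta>(1) p(2)[of \<beta>] by (simp add: S_def null_def)
  have "tri F \<beta> \<xi> \<zeta> = 0" for \<xi> \<zeta>
  proof -
    define c where "c \<xi> = tri F \<alpha> \<alpha> \<xi> / tri F \<alpha> \<alpha> \<alpha>" for \<xi>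
    define \<rho> where "\<rho> \<xi> = \<xi> - c \<xi> \<odot> \<alpha>" for \<xi>
    have \<rho>S: "\<rho> \<xi> \<in> S" for \<xi> using f by (simp add: \<rho>_def S_def tri_linear[OF F] c_def)
    have \<xi>: "\<xi> = \<rho> \<xi> + c \<xi> \<odot> \<alpha>" for \<xi> by (simp add: \<rho>_def)
    have "tri F \<beta> (\<rho> \<xi> + c \<xi> \<odot> \<alpha>) (\<rho> \<zeta> + c \<zeta> \<odot> \<alpha>) = 0"
      using e'[OF \<beta>S \<rho>S[of \<xi>] \<rho>S[of \<zeta>]] k'[OF \<beta>S \<rho>S] \<beta>S
        tri_sym(1)[of F \<beta> \<alpha>] tri_sym(2)[of F \<beta> _ \<alpha>]
      by (simp add: tri_linear[OF F] S_def tri_sym(2)[of F \<alpha> \<beta> \<alpha>])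
    then show ?thesis using \<xi> by metis
  qed
  then show False using sup \<beta>(2) unfolding has_support_cubic by blast
qed

text \<open>The expression is the leading coefficient of the cubic covariant of the binary cubic obtained by
  restricting \<open>F\<close> to the plane spanned by \<open>\<alpha>\<close> and \<open>\<eta>\<close>.\<close>

lemma cubic_covariant:
  assumes F: "multilinear F" and sup: "has_support 3 F U" and U: "E.has_dim U (Suc (Suc n))"
  shows "\<exists>\<alpha> \<eta>. (tri F \<alpha> \<alpha> \<alpha>)\<^sup>2 * tri F \<eta> \<eta> \<eta> - 3 * tri F \<alpha> \<alpha> \<alpha> * tri F \<alpha> \<alpha> \<eta> * tri F \<alpha> \<eta> \<eta> +
    2 * (tri F \<alpha> \<alpha> \<eta>) ^ 3 \<noteq> 0" (is "\<exists>\<alpha> \<eta>. ?J \<alpha> \<eta> \<noteq> 0")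
proof -
  obtain \<alpha> \<eta>0 where f: "tri F \<alpha> \<alpha> \<alpha> \<noteq> 0"
    and minor: "tri F \<alpha> \<alpha> \<alpha> * tri F \<alpha> \<eta>0 \<eta>0 - (tri F \<alpha> \<alpha> \<eta>0)\<^sup>2 \<noteq> 0"
    using cubic_hessian_minor[OF assms] by blast
  define \<eta> where "\<eta> = \<eta>0 - (tri F \<alpha> \<alpha> \<eta>0 / tri F \<alpha> \<alpha> \<alpha>) \<odot> \<alpha>"
  have g: "tri F \<alpha> \<alpha> \<eta> = 0" using f by (simp add: \<eta>_def tri_linear[OF F])
  have "tri F \<alpha> \<alpha> \<alpha> * tri F \<alpha> \<eta> \<eta> = tri F \<alpha> \<alpha> \<alpha> * tri F \<alpha> \<eta>0 \<eta>0 - (tri F \<alpha> \<alpha> \<eta>0)\<^sup>2"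
    using f by (simp add: \<eta>_def tri_linear[OF F] tri_two(2)[of F \<alpha> \<eta>0] power2_eq_square field_simps)
  then have k: "tri F \<alpha> \<eta> \<eta> \<noteq> 0" using minor by auto
  define f' k' e' where "f' = tri F \<alpha> \<alpha> \<alpha>" and "k' = tri F \<alpha> \<eta> \<eta>" and "e' = tri F \<eta> \<eta> \<eta>"
  have J: "?J (\<alpha> + t \<odot> \<eta>) \<eta> = (f' + 3 * t\<^sup>2 * k' + t ^ 3 * e')\<^sup>2 * e'
      - 3 * (f' + 3 * t\<^sup>2 * k' + t ^ 3 * e') * (2 * t * k' + t\<^sup>2 * e') * (k' + t * e')
      + 2 * (2 * t * k' + t\<^sup>2 * e') ^ 3" for t
  proof -
    have "tri F (\<alpha> + t \<odot> \<eta>) (\<alpha> + t \<odot> \<eta>) (\<alpha> + t \<odot> \<eta>) = f' + 3 * t\<^sup>2 * k' + t ^ 3 * e'"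
      "tri F (\<alpha> + t \<odot> \<eta>) (\<alpha> + t \<odot> \<eta>) \<eta> = 2 * t * k' + t\<^sup>2 * e'"
      "tri F (\<alpha> + t \<odot> \<eta>) \<eta> \<eta> = k' + t * e'"
      using g by (simp_all add: tri_linear[OF F] f'_def k'_def e'_def tri_two(1)[of F \<eta> \<alpha>] tri_two(2)[of F \<alpha> \<eta>]
          tri_two(2)[of F \<eta> \<alpha>] tri_two(1)[of F \<alpha> \<eta>, symmetric] power2_eq_square power3_eq_cube algebra_simps)
    then show ?thesis unfolding e'_def by simp
  qed
  show ?thesis
  proof (cases "e' = 0")
    case False
    then have "?J (\<alpha> + 0 \<odot> \<eta>) \<eta> \<noteq> 0" unfolding J using f by (simp add: f'_def)
    then show ?thesis by blast
  next
    case True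
    have J0: "?J (\<alpha> + t \<odot> \<eta>) \<eta> = - 2 * t * k'\<^sup>2 * (3 * f' + t\<^sup>2 * k')" for t
      unfolding J True by Groebner_Basis.algebra
    \<comment> \<open>For t \<noteq> 0 the expression is a nonzero multiple of 3 f' + t^2 k', which
      cannot vanish for two values of t^2.\<close>
    have "?J (\<alpha> + 1 \<odot> \<eta>) \<eta> \<noteq> 0 \<or> ?J (\<alpha> + 2 \<odot> \<eta>) \<eta> \<noteq> 0"
    proof (rule ccontr)
      assume "\<not> ?thesis"
      then have "3 * f' + k' = 0" "3 * f' + 4 * k' = 0" unfolding J0 using k by (auto simp: k'_def)
      then have "3 * k' = 0" by Groebner_Basis.algebra
      then show False using k by (simp add: k'_def)
    qed
    then show ?thesis by blast
  qed
qed

lemma not_in_span: "null S \<xi> \<Longrightarrow> pr \<xi> v \<noteq> 0 \<Longrightarrow> v \<notin> E.span S"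
  using null_span[of S \<xi>] by (auto simp: null_def)

lemma span_three:
  assumes U: "E.has_dim U 3" and "u \<in> U" "v \<in> U" "w \<in> U"
    and "u \<noteq> 0" "v \<notin> E.span {u}" "w \<notin> E.span {u, v}"
  shows "U = E.span {u, v, w}"
proof -
  have 1: "E.has_dim (E.span {u}) 1" using assms by (intro has_dim_singleton)
  have "E.span (insert v (E.span {u})) = E.span {u, v}"
    by (simp only: E.span_insert[of v] E.span_span insert_commute[of u v])
  then have 2: "E.has_dim (E.span {u, v}) (Suc 1)" using E.has_dim_insert[OF 1 assms(6)] by simp
  have "E.span (insert w (E.span {u, v})) = E.span (insert w {u, v})"
    by (simp only: E.span_insert[of w] E.span_span)
  then have "E.has_dim (E.span {u, v, w}) (Suc (Suc 1))"
    using E.has_dim_insert[OF 2 assms(7)] by (simp add: insert_commute)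
  then have "E.has_dim (E.span {u, v, w}) 3" by (simp add: eval_nat_numeral)
  from has_dim_subset_eq[OF U this] show ?thesis
    using assms(2-4) E.span_minimal[of "{u, v, w}" U] E.has_dim_subspace[OF U] by simp
qed

text \<open>The nondegenerate quadric F(\<alpha>, ., .) identifies directions modulo null ones with
  U by the map \<open>p\<close>. A basis \<alpha>, \<eta>, \<zeta> orthogonal for it brings F into
  normal form, and its image under \<open>p\<close> is the dual basis up to scalars. The freedom in
  \<eta> is used to keep y and z off the cone and both mixed coefficients of the binary cubic
  nonzero.\<close>

lemma ternary_cubic_waring:
  assumes F: "multilinear F" and sup: "has_support 3 F U" and U: "E.has_dim U 3"
    and h: "cone_fun h" and u0: "u0 \<in> U" "pr \<alpha> u0 = 0" "h u0 \<noteq> 0"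
    and f: "tri F \<alpha> \<alpha> \<alpha> \<noteq> 0"
    and nondeg: "\<And>\<beta>. (\<And>\<zeta>. tri F \<alpha> \<beta> \<zeta> = 0) \<Longrightarrow> null U \<beta>"
    and a: "tri F \<alpha> \<alpha> a = 0" "tri F \<alpha> a a \<noteq> 0"
    and \<xi>0: "tri F \<alpha> \<alpha> \<xi>0 = 0" "tri F \<xi>0 \<xi>0 \<xi>0 \<noteq> 0"
  shows "waring 3 {l \<in> U. h l \<noteq> 0} 5 F"
proof -
  note tl = tri_linear[OF F]
  have sU: "E.subspace U" using U by (rule E.has_dim_subspace)
  have "\<forall>\<xi>. \<exists>p. p \<in> U \<and> (\<forall>\<zeta>. tri F \<alpha> \<xi> \<zeta> = pr \<zeta> p)"
    using tri_representer[OF F sup U] by metis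
  then obtain p where p: "\<And>\<xi>. p \<xi> \<in> U" "\<And>\<xi> \<zeta>. pr \<zeta> (p \<xi>) = tri F \<alpha> \<xi> \<zeta>" by metis
  have p_add: "p (\<xi> + \<zeta>) = p \<xi> + p \<zeta>" for \<xi> \<zeta> by (rule pr_ext) (simp add: pr_simps p(2) tl)
  have p_scale: "p (c \<odot> \<xi>) = c \<cdot> p \<xi>" for c \<xi> by (rule pr_ext) (simp add: pr_simps p(2) tl)
  have "card {p \<alpha>, p a} < 3" by (rule le_less_trans[OF card_insert_le_m1[of 2]]) auto
  then obtain b where b: "null {p \<alpha>, p a} b" "\<not> null U b" using exists_null_outside[OF U, of "{p \<alpha>, p a}"] by auto
  have b0: "tri F \<alpha> \<alpha> b = 0" "tri F \<alpha> a b = 0" using b(1) by (simp_all add: null_def p(2))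
  define A where "A = tri F \<alpha> a a"
  define D where "D = tri F \<alpha> b b"
  have sa: "tri F \<alpha> a \<alpha> = 0" "tri F \<alpha> b \<alpha> = 0" "tri F \<alpha> b a = 0"
    using a(1) b0 tri_sym(2)[of F \<alpha>] by metis+
  have "p \<alpha> \<noteq> 0" using p(2)[of \<alpha> \<alpha>] f by auto
  moreover have "p a \<notin> E.span {p \<alpha>}"
    by (rule not_in_span[of _ a]) (use a(1,2) in \<open>simp_all add: null_def p(2)\<close>)
  moreover have "p b \<notin> E.span {p \<alpha>, p a}"
  proof
    assume "p b \<in> E.span {p \<alpha>, p a}"
    then obtain s t where st: "p b = s \<cdot> p \<alpha> + t \<cdot> p a"
      unfolding E.span_insert by (auto simp: algebra_simps)
    have "null U (b - (s \<odot> \<alpha> + t \<odot> a))"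
    proof (rule nondeg)
      fix \<zeta>
      have "tri F \<alpha> b \<zeta> = s * tri F \<alpha> \<alpha> \<zeta> + t * tri F \<alpha> a \<zeta>"
        using arg_cong[OF st, of "pr \<zeta>"] by (simp add: pr_simps p(2))
      then show "tri F \<alpha> (b - (s \<odot> \<alpha> + t \<odot> a)) \<zeta> = 0" by (simp add: tl)
    qed
    then have z: "pr (b - (s \<odot> \<alpha> + t \<odot> a)) (p \<xi>) = 0" for \<xi> using p(1) by (simp add: null_def)
    have "s = 0" using z[of \<alpha>] b0 a f sa unfolding p(2) by (simp add: tl)
    moreover have "t = 0" using z[of a] b0 a f sa unfolding p(2) by (simp add: tl)
    ultimately have "p b = 0" using st by simp
    then have "null U b" using nondeg[of b] p(2)[of _ b] by simp
    then show False using b(2) by simp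
  qed
  ultimately have Uspan: "U = E.span {p \<alpha>, p a, p b}" using span_three[OF U p(1) p(1) p(1)] by blast
  have D: "D \<noteq> 0"
  proof
    assume "D = 0"
    then have "null {p \<alpha>, p a, p b} b" using b(1) by (simp add: null_def p(2) D_def)
    then show False using b(2) Uspan null_span by metis
  qed
  have A: "A \<noteq> 0" using a(2) by (simp add: A_def)
  have decomp: "null U (\<xi> - (s \<odot> a + t \<odot> b))"
    if "tri F \<alpha> \<alpha> \<xi> = 0" "s = tri F \<alpha> a \<xi> / A" "t = tri F \<alpha> b \<xi> / D" for \<xi> s t
    unfolding Uspan null_span null_insert using that A D b0 a sa
    by (simp add: p(2) tl null_def A_def[symmetric] D_def[symmetric])
  define S where "S = X.span {a, b}"
  have S_iff: "\<eta> \<in> S \<longleftrightarrow> (\<exists>s t. \<eta> = s \<odot> a + t \<odot> b)" for \<eta>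
    unfolding S_def X.span_insert by (auto simp: algebra_simps)
  have sS: "X.subspace S" by (simp add: S_def)
  \<comment> \<open>A direction of the plane S orthogonal to \<eta> for F(\<alpha>, ., .) and linear
    in \<eta>.\<close>
  define \<sigma> where "\<sigma> \<eta> = tri F \<alpha> \<eta> b \<odot> a - tri F \<alpha> \<eta> a \<odot> b" for \<eta>
  have \<sigma>_st: "\<sigma> (s \<odot> a + t \<odot> b) = (t * D) \<odot> a - (s * A) \<odot> b" for s t
    using b0 sa by (simp add: \<sigma>_def tl A_def D_def)
  have \<sigma>_line: "\<sigma> (x + t \<odot> y) = \<sigma> x + t \<odot> \<sigma> y" for x y t
    by (simp add: \<sigma>_def tl X.scale_left_distrib X.scale_right_diff_distrib algebra_simps)
  \<comment> \<open>Since \<alpha> kills u0, there is no component along \<open>p \<alpha>\<close>: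
    u0 comes from S and witnesses that h composed with \<open>p\<close> is not identically zero
    there.\<close>
  have u0_eq: "\<exists>y z. u0 = p (y \<odot> a + z \<odot> b)"
  proof -
    obtain x y z where u: "u0 = x \<cdot> p \<alpha> + y \<cdot> p a + z \<cdot> p b"
      using u0(1) unfolding Uspan E.span_insert by (auto simp: algebra_simps)
    then have "x = 0" using u0(2) f sa a b0 by (simp add: pr_simps p(2))
    then show ?thesis using u by (auto simp: p_add p_scale)
  qed
  then obtain y0 z0 where yz: "u0 = p (y0 \<odot> a + z0 \<odot> b)" by blast
  \<comment> \<open>The coefficients of the binary cubic on S, up to binomial factors. It is not
    zero because \<open>\<xi>0\<close> lies in S modulo null directions.\<close>
  define q0 q1 q2 q3 where "q0 = tri F a a a" and "q1 = tri F a a b" and "q2 = tri F a b b" and "q3 = tri F b b b"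
  have sq: "tri F a b a = q1" "tri F b a a = q1" "tri F b a b = q2" "tri F b b a = q2"
    using tri_sym unfolding q1_def q2_def by metis+
  note qs = q0_def[symmetric] q1_def[symmetric] q2_def[symmetric] q3_def[symmetric] sq
  have q: "\<not> (q0 = 0 \<and> q1 = 0 \<and> q2 = 0 \<and> q3 = 0)"
  proof
    assume z: "q0 = 0 \<and> q1 = 0 \<and> q2 = 0 \<and> q3 = 0"
    define \<xi>1 where "\<xi>1 = (tri F \<alpha> a \<xi>0 / A) \<odot> a + (tri F \<alpha> b \<xi>0 / D) \<odot> b"
    have n: "null U (\<xi>0 - \<xi>1)" unfolding \<xi>1_def by (rule decomp) (use \<xi>0 in auto)
    have "tri F \<xi>0 \<xi>0 \<xi>0 = tri F \<xi>1 \<xi>1 \<xi>1"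
      using tri_null(1)[OF sup n, of \<xi>0 \<xi>0] tri_null(2)[OF sup n, of \<xi>1 \<xi>0] tri_null(3)[OF sup n, of \<xi>1 \<xi>1]
      by (simp add: tl)
    also have "\<dots> = 0" using z by (simp add: \<xi>1_def tl qs)
    finally show False using \<xi>0 by simp
  qed
  \<comment> \<open>Were it zero for all s, t, the points (1, 0), (0, 1), (1, 1) and (1, -1) would
    force all four coefficients to vanish; likewise in \<open>g5\<close>.\<close>
  have g4: "\<exists>\<eta>\<in>S. tri F \<eta> \<eta> (\<sigma> \<eta>) \<noteq> 0"
  proof (rule ccontr)
    assume na: "\<not> ?thesis"
    have z: "(s * s * q0 + 2 * s * t * q1 + t * t * q2) * (t * D) - (s * s * q1 + 2 * s * t * q2 + t * t * q3) * (s * A) = 0" for s t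
    proof -
      have "tri F (s \<odot> a + t \<odot> b) (s \<odot> a + t \<odot> b) (\<sigma> (s \<odot> a + t \<odot> b)) = 0" using na S_iff by blast
      then show ?thesis unfolding \<sigma>_st by (simp add: tl qs algebra_simps)
    qed
    have "q1 = 0" "q2 = 0" using z[of 1 0] z[of 0 1] A D by auto
    moreover from this have "q0 * D = q3 * A" "q0 * D = - (q3 * A)"
      using z[of 1 1] z[of 1 "- 1"] by (auto simp: eq_neg_iff_add_eq_0 algebra_simps)
    ultimately show False using q A D by auto
  qed
  have g5: "\<exists>\<eta>\<in>S. tri F \<eta> (\<sigma> \<eta>) (\<sigma> \<eta>) \<noteq> 0"
  proof (rule ccontr)
    assume na: "\<not> ?thesis"
    have z: "(s * q0 + t * q1) * (t * D) ^ 2 - 2 * (s * q1 + t * q2) * (t * D) * (s * A) + (s * q2 + t * q3) * (s * A) ^ 2 = 0" for s t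
    proof -
      have "tri F (s \<odot> a + t \<odot> b) (\<sigma> (s \<odot> a + t \<odot> b)) (\<sigma> (s \<odot> a + t \<odot> b)) = 0" using na S_iff by blast
      then show ?thesis unfolding \<sigma>_st by (simp add: tl qs algebra_simps power2_eq_square)
    qed
    have "q1 = 0" "q2 = 0" using z[of 1 0] z[of 0 1] A D by auto
    moreover from this have "q0 * D ^ 2 = - (q3 * A ^ 2)" "q0 * D ^ 2 = q3 * A ^ 2"
      using z[of 1 1] z[of 1 "- 1"] by (auto simp: eq_neg_iff_add_eq_0 algebra_simps)
    ultimately show False using q A D by auto
  qed
  have 1: "X.generic S (\<lambda>\<eta>. tri F \<alpha> \<eta> \<eta> \<noteq> 0)"
    by (rule X.genericI[of _ _ a]) (use A in \<open>auto simp: tl A_def S_def X.span_base intro!: poly_intros\<close>)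
  have 2: "X.generic S (\<lambda>\<eta>. h (p \<eta>) \<noteq> 0)"
    by (rule X.genericI[of _ _ "y0 \<odot> a + z0 \<odot> b"])
       (use u0 yz S_iff cone_fun_line[OF h] in \<open>auto simp: p_add p_scale\<close>)
  have 3: "X.generic S (\<lambda>\<eta>. h (p (\<sigma> \<eta>)) \<noteq> 0)"
  proof (rule X.genericI[of _ _ "(- z0 / A) \<odot> a + (y0 / D) \<odot> b"])
    show "polynomial_fun (\<lambda>t. h (p (\<sigma> (x + t \<odot> y))))" for x y
      unfolding \<sigma>_line p_add p_scale by (rule cone_fun_line[OF h])
    \<comment> \<open>The witness is the preimage under \<sigma> of the direction that
      \<open>p\<close> maps to u0.\<close>
    show "h (p (\<sigma> ((- z0 / A) \<odot> a + (y0 / D) \<odot> b))) \<noteq> 0"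
      unfolding \<sigma>_st using A D u0(3) yz by simp
  qed (use S_iff in blast)
  have 4: "X.generic S (\<lambda>\<eta>. tri F \<eta> \<eta> (\<sigma> \<eta>) \<noteq> 0)"
    using g4 by (elim bexE, intro X.genericI) (auto simp: \<sigma>_line tl intro!: poly_intros)
  have 5: "X.generic S (\<lambda>\<eta>. tri F \<eta> (\<sigma> \<eta>) (\<sigma> \<eta>) \<noteq> 0)"
    using g5 by (elim bexE, intro X.genericI) (auto simp: \<sigma>_line tl intro!: poly_intros)
  have "X.generic S (\<lambda>\<eta>. tri F \<alpha> \<eta> \<eta> \<noteq> 0 \<and> h (p \<eta>) \<noteq> 0 \<and> h (p (\<sigma> \<eta>)) \<noteq> 0 \<and>
      tri F \<eta> \<eta> (\<sigma> \<eta>) \<noteq> 0 \<and> tri F \<eta> (\<sigma> \<eta>) (\<sigma> \<eta>) \<noteq> 0)"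
    by (intro X.generic_conj sS 1 2 3 4 5)
  then obtain \<eta> where \<eta>: "\<eta> \<in> S" "tri F \<alpha> \<eta> \<eta> \<noteq> 0" "h (p \<eta>) \<noteq> 0" "h (p (\<sigma> \<eta>)) \<noteq> 0"
      "tri F \<eta> \<eta> (\<sigma> \<eta>) \<noteq> 0" "tri F \<eta> (\<sigma> \<eta>) (\<sigma> \<eta>) \<noteq> 0"
    using X.generic_ex by blast
  obtain s t where st: "\<eta> = s \<odot> a + t \<odot> b" using \<eta>(1) S_iff by blast
  define \<zeta> where "\<zeta> = \<sigma> \<eta>"
  have "tri F \<alpha> \<zeta> \<zeta> = A * D * tri F \<alpha> \<eta> \<eta>"
    unfolding \<zeta>_def st \<sigma>_st using b0 sa by (simp add: tl A_def[symmetric] D_def[symmetric] algebra_simps)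
  then have \<zeta>\<zeta>: "tri F \<alpha> \<zeta> \<zeta> \<noteq> 0" using A D \<eta>(2) by simp
  have \<eta>\<zeta>: "tri F \<alpha> \<eta> \<zeta> = 0"
    by (simp add: \<zeta>_def \<sigma>_def tl)
  have \<alpha>\<alpha>: "tri F \<alpha> \<alpha> \<eta> = 0" "tri F \<alpha> \<alpha> \<zeta> = 0"
    unfolding \<zeta>_def st \<sigma>_st using a b0 by (simp_all add: tl)
  obtain l where l: "l ^ 3 = tri F \<alpha> \<alpha> \<alpha>" using nth_root_exists[of 3] by auto
  have l0: "l \<noteq> 0" using l f by auto
  obtain m where m: "m ^ 2 = tri F \<alpha> \<eta> \<eta> / l" using nth_root_exists[of 2] by auto
  obtain v where v: "v ^ 2 = tri F \<alpha> \<zeta> \<zeta> / l" using nth_root_exists[of 2] by auto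
  have m0: "m \<noteq> 0" "v \<noteq> 0" using m v l0 \<eta>(2) \<zeta>\<zeta> by auto
  define \<alpha>' \<eta>' \<zeta>' where "\<alpha>' = (1 / l) \<odot> \<alpha>" and "\<eta>' = (1 / m) \<odot> \<eta>" and "\<zeta>' = (1 / v) \<odot> \<zeta>"
  define x y z where "x = (1 / l ^ 2) \<cdot> p \<alpha>" and "y = (1 / (l * m)) \<cdot> p \<eta>" and "z = (1 / (l * v)) \<cdot> p \<zeta>"
  have T: "tri F \<alpha>' \<alpha>' \<alpha>' = 1" "tri F \<alpha>' \<alpha>' \<eta>' = 0" "tri F \<alpha>' \<alpha>' \<zeta>' = 0" "tri F \<alpha>' \<eta>' \<eta>' = 1"
    "tri F \<alpha>' \<eta>' \<zeta>' = 0" "tri F \<alpha>' \<zeta>' \<zeta>' = 1" "tri F \<eta>' \<eta>' \<zeta>' \<noteq> 0" "tri F \<eta>' \<zeta>' \<zeta>' \<noteq> 0"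
  proof -
    show "tri F \<alpha>' \<alpha>' \<alpha>' = 1" using l l0 f by (simp add: \<alpha>'_def tl power3_eq_cube mult.assoc)
    have "m * m * l = tri F \<alpha> \<eta> \<eta>" "v * v * l = tri F \<alpha> \<zeta> \<zeta>"
      using m v l0 by (simp_all add: power2_eq_square)
    then show "tri F \<alpha>' \<eta>' \<eta>' = 1" "tri F \<alpha>' \<zeta>' \<zeta>' = 1"
      using m0 l0 \<eta>(2) \<zeta>\<zeta> by (simp_all add: \<alpha>'_def \<eta>'_def \<zeta>'_def tl field_simps)
  qed (use \<alpha>\<alpha> \<eta>\<zeta> \<eta> m0 in \<open>simp_all add: \<alpha>'_def \<eta>'_def \<zeta>'_def tl \<zeta>_def[symmetric]\<close>)
  have prx: "pr \<xi> x = tri F \<alpha>' \<alpha>' \<xi>" "pr \<xi> y = tri F \<alpha>' \<eta>' \<xi>" "pr \<xi> z = tri F \<alpha>' \<zeta>' \<xi>" for \<xi>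
    by (simp_all add: x_def y_def z_def \<alpha>'_def \<eta>'_def \<zeta>'_def tl pr_simps p(2) power2_eq_square)
  have Ts: "tri F \<alpha>' \<eta>' \<alpha>' = 0" "tri F \<alpha>' \<zeta>' \<alpha>' = 0" "tri F \<alpha>' \<zeta>' \<eta>' = 0"
    using T(2,3,5) tri_sym(2)[of F \<alpha>'] by metis+
  have xyz: "x \<in> U" "y \<in> U" "z \<in> U" using p(1) sU by (simp_all add: x_def y_def z_def E.subspace_scale)
  have span: "U = E.span {x, y, z}"
  proof (rule span_three[OF U xyz])
    show "x \<noteq> 0" using prx(1)[of \<alpha>'] T(1) by auto
    show "y \<notin> E.span {x}" by (rule not_in_span[of _ \<eta>']) (simp_all add: null_def prx T Ts)
    show "z \<notin> E.span {x, y}" by (rule not_in_span[of _ \<zeta>']) (simp_all add: null_def prx T Ts)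
  qed
  have hyz: "h y \<noteq> 0" "h z \<noteq> 0"
    using h \<eta>(3,4) l0 m0 by (simp_all add: y_def z_def cone_fun_def \<zeta>_def)
  have live: "lives_on 3 F U" using sup unfolding lives_on_def by (auto intro: has_supportD)
  show ?thesis
    by (rule ternary_cubic_normal_form[OF F live span h hyz _ _ _ _ _ _ _ _ _ T]) (simp_all add: prx T Ts)
qed

end

section \<open>The bound for forms with given essential variables\<close>

context dual_pair
begin

lemma good_direction_not_null:
  assumes "has_support (Suc (Suc d)) F U" "good_direction d F U h \<alpha>"
  shows "\<not> null U \<alpha>"
proof
  assume n: "null U \<alpha>"
  obtain M where M: "size M = d" "F (add_mset \<alpha> (add_mset \<alpha> M)) \<noteq> 0"
    using assms(2) by (auto simp: good_direction_def)
  then show False using has_supportD[OF assms(1) n, of "add_mset \<alpha> M"] by simp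
qed

lemma good_direction_outside:
  "good_direction d F U h \<alpha> \<Longrightarrow> \<exists>u\<in>U. pr \<alpha> u = 0 \<and> h u \<noteq> 0"
  by (simp add: good_direction_def)

lemma contract_support_exists:
  assumes F: "multilinear F" and sup: "has_support (Suc (Suc d)) F U" and U: "E.has_dim U n"
  obtains W k where "W \<subseteq> U" "has_support (Suc d) (\<lambda>M. F (add_mset \<alpha> M)) W" "E.has_dim W k" "k \<le> n"
proof -
  have "lives_on (Suc d) (\<lambda>M. F (add_mset \<alpha> M)) U"
    unfolding lives_on_def
  proof (intro allI impI)
    fix \<beta> :: 'x and M :: "'x multiset" assume "null U \<beta>" "Suc (size M) = Suc d"
    then show "F (add_mset \<alpha> (add_mset \<beta> M)) = 0"
      using has_supportD[OF sup, of \<beta> "add_mset \<alpha> M"] by (simp add: add_mset_commute[of \<alpha>])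
  qed
  from support_exists[OF multilinear_contract[OF F] U this] show ?thesis using that by blast
qed

text \<open>The derivative of a quadric is the linear form \<open>p \<alpha>\<close>, a single
  power, and \<open>p\<close> is onto U, so for generic \<alpha> it avoids the cone. Degree two
  stands apart because a linear derivative inside the cone could not be repaired as in higher
  degrees: adding a linear form does not add an essential variable.\<close>

lemma waring_claim_quadric:
  assumes IH: "\<And>m. m \<le> n \<Longrightarrow> waring_claim m (Suc 0)"
  shows "waring_claim (Suc n) (Suc 0)"
  unfolding waring_claim_def
proof (intro allI impI)
  fix F U and h :: "'b \<Rightarrow> 'a"
  assume F: "multilinear F" and sup: "has_support (Suc (Suc 0)) F U" and U: "E.has_dim U (Suc (Suc n))"
    and h: "cone_fun h" "\<exists>u\<in>U. h u \<noteq> 0"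
  obtain u where u: "u \<in> U" "h u \<noteq> 0" using h(2) by blast
  have sU: "E.subspace U" using U by (rule E.has_dim_subspace)
  have "\<exists>p. p \<in> U \<and> (\<forall>\<xi>. F {#\<alpha>, \<xi>#} = pr \<xi> p)" for \<alpha>
  proof -
    obtain p where "p \<in> U" "\<And>\<xi>. F (add_mset \<xi> {#\<alpha>#}) = pr \<xi> p"
      using contract_representer[OF F, of "{#\<alpha>#}"] sup U by auto
    then show ?thesis by (auto simp: add_mset_commute)
  qed
  then obtain p where p: "\<And>\<alpha>. p \<alpha> \<in> U" "\<And>\<alpha> \<xi>. pr \<xi> (p \<alpha>) = F {#\<alpha>, \<xi>#}" by metis
  have p_add: "p (\<xi> + \<zeta>) = p \<xi> + p \<zeta>" for \<xi> \<zeta> by (rule pr_ext) (simp add: pr_simps p(2) multilinear_add[OF F])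
  have p_scale: "p (c \<odot> \<xi>) = c \<cdot> p \<xi>" for c \<xi> by (rule pr_ext) (simp add: pr_simps p(2) multilinear_scale[OF F])
  have surj: "\<exists>\<alpha>. u = p \<alpha>"
  proof (rule ccontr)
    assume "\<nexists>\<alpha>. u = p \<alpha>"
    then have "u \<notin> range p" by auto
    moreover have "E.subspace (range p)"
    proof (rule E.subspaceI)
      show "0 \<in> range p" using p_scale[of 0 0] by (metis E.scale_zero_left rangeI)
      show "x + y \<in> range p" if "x \<in> range p" "y \<in> range p" for x y
        using that by (auto simp flip: p_add)
      show "c \<cdot> x \<in> range p" if "x \<in> range p" for c x
        using that by (auto simp flip: p_scale)
    qed
    ultimately obtain \<beta> where \<beta>: "\<forall>w\<in>range p. pr \<beta> w = 0" "pr \<beta> u = 1" using separation by blast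
    have "F (add_mset \<beta> M) = 0" if M: "Suc (size M) = Suc (Suc 0)" for M
    proof -
      obtain \<alpha> where "M = {#\<alpha>#}" using M size_1_singleton_mset[of M] by auto
      then show ?thesis using \<beta>(1) p(2)[of \<beta> \<alpha>] by (simp add: add_mset_commute)
    qed
    then have "null U \<beta>" using sup unfolding has_support_def by blast
    then show False using u(1) \<beta>(2) by (simp add: null_def)
  qed
  have "X.generic UNIV (\<lambda>\<alpha>. good_direction 0 F U h \<alpha> \<and> h (p \<alpha>) \<noteq> 0)"
  proof (intro X.generic_conj X.subspace_UNIV generic_good_direction[OF F sup U h(1) u])
    obtain \<alpha>0 where "u = p \<alpha>0" using surj by blast
    then show "X.generic UNIV (\<lambda>\<alpha>. h (p \<alpha>) \<noteq> 0)"
      using cone_fun_line[OF h(1)] u(2) by (intro X.genericI[of _ _ \<alpha>0]) (simp_all add: p_add p_scale)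
  qed
  then obtain \<alpha> where \<alpha>: "good_direction 0 F U h \<alpha>" "h (p \<alpha>) \<noteq> 0" using X.generic_ex by blast
  have \<alpha>\<alpha>: "pr \<alpha> (p \<alpha>) \<noteq> 0" using \<alpha>(1) by (auto simp: good_direction_def p(2))
  have "waring (Suc 0) {l \<in> U. h l \<noteq> 0 \<and> pr \<alpha> l \<noteq> 0} 1 (\<lambda>M. F (add_mset \<alpha> M))"
  proof (rule waring_single)
    show "p \<alpha> \<in> {l \<in> U. h l \<noteq> 0 \<and> pr \<alpha> l \<noteq> 0}" using p(1) \<alpha>(2) \<alpha>\<alpha> by simp
    show "F (add_mset \<alpha> M) = 1 * pow (p \<alpha>) M" if "size M = Suc 0" for M
      using that size_1_singleton_mset[of M] by (auto simp: p(2))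
  qed
  from waring_claim_step[OF F sup U h(1) good_direction_outside[OF \<alpha>(1)] good_direction_not_null[OF sup \<alpha>(1)] this IH]
  show "waring (Suc (Suc 0)) {l \<in> U. h l \<noteq> 0} (waring_bound (Suc n) (Suc 0)) F"
    by (simp add: add.commute)
qed

lemma waring_claim_higher:
  assumes lower: "\<And>m. m \<le> Suc n \<Longrightarrow> waring_claim m (Suc d)"
    and fewer: "\<And>m. m \<le> n \<Longrightarrow> waring_claim m (Suc (Suc d))"
    and nd: "\<not> (n = 1 \<and> d = 0)"
  shows "waring_claim (Suc n) (Suc (Suc d))"
  unfolding waring_claim_def
proof (intro allI impI)
  fix F U and h :: "'b \<Rightarrow> 'a"
  assume F: "multilinear F" and sup: "has_support (Suc (Suc (Suc d))) F U" and U: "E.has_dim U (Suc (Suc n))"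
    and h: "cone_fun h" "\<exists>u\<in>U. h u \<noteq> 0"
  obtain u where u: "u \<in> U" "h u \<noteq> 0" using h(2) by blast
  obtain \<alpha> where \<alpha>: "good_direction (Suc d) F U h \<alpha>"
    using X.generic_ex[OF generic_good_direction[OF F sup U h(1) u]] by blast
  obtain W k where W: "W \<subseteq> U" "has_support (Suc (Suc d)) (\<lambda>M. F (add_mset \<alpha> M)) W" "E.has_dim W k"
      "k \<le> Suc (Suc n)"
    using contract_support_exists[OF F sup U] .
  have "k - 1 \<le> Suc n" using W(4) by simp
  then have "waring (Suc (Suc d)) {l \<in> U. h l \<noteq> 0 \<and> pr \<alpha> l \<noteq> 0} (waring_bound (Suc n) (Suc d)) (\<lambda>M. F (add_mset \<alpha> M))"
    using waring_mono[OF derivative_waring[OF F sup U h(1) u \<alpha> W lower] order_refl,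
        of "waring_bound (Suc n) (Suc d)"] waring_bound_mono[of "k - 1" "Suc n" "Suc d"]
    by (simp split: if_splits del: waring_bound.simps)
  from waring_claim_step[OF F sup U h(1) good_direction_outside[OF \<alpha>] good_direction_not_null[OF sup \<alpha>] this fewer]
  show "waring (Suc (Suc (Suc d))) {l \<in> U. h l \<noteq> 0} (waring_bound (Suc n) (Suc (Suc d))) F"
    using nd by (auto simp: add.commute)
qed

text \<open>Hessian minor and covariant depend polynomially on \<alpha>, so a good direction can
  make them nonzero as well. Then the quadric \<alpha>F has rank 2 or 3. Rank 2 costs 2 powers from
  the derivative and 3 for a remainder in two variables; rank 3 leads to the normal form.\<close>

lemma waring_claim_ternary_cubic:
  assumes quadric: "\<And>m. m \<le> 2 \<Longrightarrow> waring_claim m 1" and binary: "\<And>m. m \<le> 1 \<Longrightarrow> waring_claim m 2"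
  shows "waring_claim 2 2"
  unfolding waring_claim_def
proof (intro allI impI)
  fix F U and h :: "'b \<Rightarrow> 'a"
  assume F: "multilinear F" and sup': "has_support (Suc 2) F U" and U': "E.has_dim U (Suc 2)"
    and h: "cone_fun h" "\<exists>u\<in>U. h u \<noteq> 0"
  have sup: "has_support 3 F U" "has_support (Suc (Suc 1)) F U" "has_support (Suc (Suc (Suc 0))) F U"
    and U: "E.has_dim U 3" "E.has_dim U (Suc (Suc 1))"
    using sup' U' by (simp_all add: eval_nat_numeral)
  note tl = tri_linear[OF F]
  obtain u where u: "u \<in> U" "h u \<noteq> 0" using h(2) by blast
  obtain \<alpha>1 \<eta>1 where 1: "tri F \<alpha>1 \<alpha>1 \<alpha>1 \<noteq> 0"
      "tri F \<alpha>1 \<alpha>1 \<alpha>1 * tri F \<alpha>1 \<eta>1 \<eta>1 - (tri F \<alpha>1 \<alpha>1 \<eta>1)\<^sup>2 \<noteq> 0"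
    using cubic_hessian_minor[OF F sup(1) U(2)] by blast
  obtain \<alpha>2 \<eta>2 where 2: "(tri F \<alpha>2 \<alpha>2 \<alpha>2)\<^sup>2 * tri F \<eta>2 \<eta>2 \<eta>2 -
      3 * tri F \<alpha>2 \<alpha>2 \<alpha>2 * tri F \<alpha>2 \<alpha>2 \<eta>2 * tri F \<alpha>2 \<eta>2 \<eta>2 + 2 * (tri F \<alpha>2 \<alpha>2 \<eta>2) ^ 3 \<noteq> 0"
    using cubic_covariant[OF F sup(1) U(2)] by blast
  have poly: "polynomial_fun (\<lambda>t. tri F (x + t \<odot> y) (x + t \<odot> y) (x + t \<odot> y))"
    "polynomial_fun (\<lambda>t. tri F (x + t \<odot> y) (x + t \<odot> y) \<eta>)" "polynomial_fun (\<lambda>t. tri F (x + t \<odot> y) \<eta> \<eta>)" for x y \<eta>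
    by (simp_all add: tl) (intro poly_intros)+
  have "X.generic UNIV (\<lambda>\<alpha>. good_direction 1 F U h \<alpha> \<and> tri F \<alpha> \<alpha> \<alpha> \<noteq> 0 \<and>
      tri F \<alpha> \<alpha> \<alpha> * tri F \<alpha> \<eta>1 \<eta>1 - (tri F \<alpha> \<alpha> \<eta>1)\<^sup>2 \<noteq> 0 \<and>
      (tri F \<alpha> \<alpha> \<alpha>)\<^sup>2 * tri F \<eta>2 \<eta>2 \<eta>2 - 3 * tri F \<alpha> \<alpha> \<alpha> * tri F \<alpha> \<alpha> \<eta>2 * tri F \<alpha> \<eta>2 \<eta>2 +
        2 * (tri F \<alpha> \<alpha> \<eta>2) ^ 3 \<noteq> 0)"
  proof (intro X.generic_conj X.subspace_UNIV generic_good_direction[OF F sup(2) U(2) h(1) u])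
    show "X.generic UNIV (\<lambda>\<alpha>. tri F \<alpha> \<alpha> \<alpha> \<noteq> 0)"
      using 1(1) by (rule X.genericI[rotated 2]) (simp_all add: poly)
    show "X.generic UNIV (\<lambda>\<alpha>. tri F \<alpha> \<alpha> \<alpha> * tri F \<alpha> \<eta>1 \<eta>1 - (tri F \<alpha> \<alpha> \<eta>1)\<^sup>2 \<noteq> 0)"
      using 1(2) by (rule X.genericI[rotated 2]) (simp_all, intro poly_intros poly)
    show "X.generic UNIV (\<lambda>\<alpha>. (tri F \<alpha> \<alpha> \<alpha>)\<^sup>2 * tri F \<eta>2 \<eta>2 \<eta>2 -
        3 * tri F \<alpha> \<alpha> \<alpha> * tri F \<alpha> \<alpha> \<eta>2 * tri F \<alpha> \<eta>2 \<eta>2 + 2 * (tri F \<alpha> \<alpha> \<eta>2) ^ 3 \<noteq> 0)"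
      using 2 by (rule X.genericI[rotated 2]) (simp_all, intro poly_intros poly)
  qed
  then obtain \<alpha> where \<alpha>: "good_direction 1 F U h \<alpha>" and f: "tri F \<alpha> \<alpha> \<alpha> \<noteq> 0"
    and minor: "tri F \<alpha> \<alpha> \<alpha> * tri F \<alpha> \<eta>1 \<eta>1 - (tri F \<alpha> \<alpha> \<eta>1)\<^sup>2 \<noteq> 0"
    and J: "(tri F \<alpha> \<alpha> \<alpha>)\<^sup>2 * tri F \<eta>2 \<eta>2 \<eta>2 - 3 * tri F \<alpha> \<alpha> \<alpha> * tri F \<alpha> \<alpha> \<eta>2 * tri F \<alpha> \<eta>2 \<eta>2 +
        2 * (tri F \<alpha> \<alpha> \<eta>2) ^ 3 \<noteq> 0"
    using X.generic_ex by blast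
  define a where "a = \<eta>1 - (tri F \<alpha> \<alpha> \<eta>1 / tri F \<alpha> \<alpha> \<alpha>) \<odot> \<alpha>"
  have a1: "tri F \<alpha> \<alpha> a = 0" using f by (simp add: a_def tl)
  have "tri F \<alpha> \<alpha> \<alpha> * tri F \<alpha> a a = tri F \<alpha> \<alpha> \<alpha> * tri F \<alpha> \<eta>1 \<eta>1 - (tri F \<alpha> \<alpha> \<eta>1)\<^sup>2"
    using f by (simp add: a_def tl tri_two(2)[of F \<alpha> \<eta>1] power2_eq_square field_simps)
  then have a2: "tri F \<alpha> a a \<noteq> 0" using minor by auto
  \<comment> \<open>Corrected by \<alpha> to be orthogonal to it; the value at its cube is
    F(\<alpha>, \<alpha>, \<alpha>) times the covariant.\<close>
  define \<xi>0 where "\<xi>0 = tri F \<alpha> \<alpha> \<alpha> \<odot> \<eta>2 - tri F \<alpha> \<alpha> \<eta>2 \<odot> \<alpha>"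
  have \<xi>1: "tri F \<alpha> \<alpha> \<xi>0 = 0" by (simp add: \<xi>0_def tl)
  have "tri F \<xi>0 \<xi>0 \<xi>0 = tri F \<alpha> \<alpha> \<alpha> * ((tri F \<alpha> \<alpha> \<alpha>)\<^sup>2 * tri F \<eta>2 \<eta>2 \<eta>2 -
      3 * tri F \<alpha> \<alpha> \<alpha> * tri F \<alpha> \<alpha> \<eta>2 * tri F \<alpha> \<eta>2 \<eta>2 + 2 * (tri F \<alpha> \<alpha> \<eta>2) ^ 3)"
    by (simp add: \<xi>0_def tl tri_two(1)[of F \<eta>2 \<alpha>] tri_two(2)[of F \<alpha> \<eta>2]
          tri_two(2)[of F \<eta>2 \<alpha>] tri_two(1)[of F \<alpha> \<eta>2, symmetric] power2_eq_square power3_eq_cube algebra_simps)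
  then have \<xi>2: "tri F \<xi>0 \<xi>0 \<xi>0 \<noteq> 0" using f J by simp
  obtain u0 where u0: "u0 \<in> U" "pr \<alpha> u0 = 0" "h u0 \<noteq> 0" using good_direction_outside[OF \<alpha>] by blast
  obtain W k where W: "W \<subseteq> U" "has_support (Suc 1) (\<lambda>M. F (add_mset \<alpha> M)) W" "E.has_dim W k"
      "k \<le> Suc (Suc 1)"
    using contract_support_exists[OF F sup(2) U(2)] .
  have \<alpha>W: "\<not> null W \<alpha>" and hW: "(\<exists>u\<in>W. h u \<noteq> 0) \<or> k \<le> 1"
    using derivative_support[OF F U(2) u \<alpha> W] by blast+
  obtain k' where k': "k = Suc k'" "E.has_dim (W \<inter> ker \<alpha>) k'" using has_dim_hyperplane[OF W(3) \<alpha>W] .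
  \<comment> \<open>The derivative of F along \<alpha> and a: it lies in W, is killed by \<alpha>
    but not by a. Since \<alpha> is not null on W, the dimension of W is at least 2.\<close>
  obtain q where q: "q \<in> W" "\<And>\<zeta>. tri F \<alpha> a \<zeta> = pr \<zeta> q"
  proof -
    obtain q where "q \<in> W" "\<And>\<zeta>. F (add_mset \<alpha> (add_mset \<zeta> {#a#})) = pr \<zeta> q"
      using contract_representer[OF multilinear_contract[OF F, of \<alpha>], of "{#a#}" W k] W(2,3) by auto
    then show ?thesis using that by (simp add: tri_def add_mset_commute)
  qed
  have "k' \<noteq> 0"
  proof
    assume "k' = 0"
    then have "W \<inter> ker \<alpha> = {0}" using k'(2) E.has_dim_zeroD by simp
    moreover have "q \<in> W \<inter> ker \<alpha>" using q(1) q(2)[of \<alpha>] a1 by (simp add: ker_def tri_two(2))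
    ultimately show False using q(2)[of a] a2 by simp
  qed
  then have k1: "k \<noteq> 0" "k \<noteq> 1" and hW: "\<exists>u\<in>W. h u \<noteq> 0" using k'(1) hW by auto
  have "waring 3 {l \<in> U. h l \<noteq> 0} 5 F"
  proof (cases "k = 2")
    case True
    have "waring (Suc (Suc 0)) {l \<in> U. h l \<noteq> 0 \<and> pr \<alpha> l \<noteq> 0} (waring_bound (k - 1) (Suc 0)) (\<lambda>M. F (add_mset \<alpha> M))"
      using derivative_waring[OF F sup(3) U(2) h(1) u _ W(1) _ W(3,4)] \<alpha> W(2) quadric hW
      by (simp add: eval_nat_numeral)
    then have "waring (Suc 1) {l \<in> U. h l \<noteq> 0 \<and> pr \<alpha> l \<noteq> 0} 2 (\<lambda>M. F (add_mset \<alpha> M))"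
      using True by (simp add: eval_nat_numeral)
    from waring_claim_step[OF F sup(2) U(2) h(1) good_direction_outside[OF \<alpha>] good_direction_not_null[OF sup(2) \<alpha>] this]
    show ?thesis using binary by (simp add: eval_nat_numeral)
  next
    case False
    then have "k = 3" using k1 W(4) by (simp add: eval_nat_numeral)
    then have WU: "W = U" using has_dim_subset_eq[OF U(1) _ W(1)] W(3) by simp
    have nondeg: "null U \<beta>" if "\<And>\<zeta>. tri F \<alpha> \<beta> \<zeta> = 0" for \<beta>
    proof -
      have "F (add_mset \<alpha> (add_mset \<beta> M)) = 0" if M: "Suc (size M) = Suc 1" for M
      proof -
        have "size M = 1" using M by simp
        then obtain \<zeta> where "M = {#\<zeta>#}" using size_1_singleton_mset by blast
        then show ?thesis using \<open>\<And>\<zeta>. tri F \<alpha> \<beta> \<zeta> = 0\<close> by (simp add: tri_def)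
      qed
      then show ?thesis using W(2) unfolding WU has_support_def by blast
    qed
    show ?thesis by (rule ternary_cubic_waring[OF F sup(1) U(1) h(1) u0 f nondeg a1 a2 \<xi>1 \<xi>2])
  qed
  moreover have "waring_bound 2 2 = 5" by (simp add: eval_nat_numeral)
  ultimately show "waring (Suc 2) {l \<in> U. h l \<noteq> 0} (waring_bound 2 2) F" by (simp add: eval_nat_numeral)
qed

theorem waring_claim_all: "waring_claim n d"
proof (induction "n + d" arbitrary: n d rule: less_induct)
  case less
  show ?case
  proof (cases n)
    case 0
    then show ?thesis by (simp add: waring_claim_one_variable)
  next
    case (Suc n')
    show ?thesis
    proof (cases d)
      case 0
      then show ?thesis by (simp add: waring_claim_linear)
    next
      case d: (Suc d')
      show ?thesis
      proof (cases d')
        case 0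
        then show ?thesis using waring_claim_quadric[of n'] less Suc d by simp
      next
        case d': (Suc e)
        have lower: "waring_claim m (Suc e)" if "m \<le> Suc n'" for m using less[of m "Suc e"] that Suc d d' by simp
        have fewer: "waring_claim m (Suc (Suc e))" if "m \<le> n'" for m
          using less[of m "Suc (Suc e)"] that Suc d d' by simp
        show ?thesis
        proof (cases "n' = 1 \<and> e = 0")
          case True
          then show ?thesis
            using waring_claim_ternary_cubic lower fewer Suc d d' by (simp add: eval_nat_numeral)
        next
          case False
          then show ?thesis using waring_claim_higher[OF lower fewer] Suc d d' by simp
        qed
      qed
    qed
  qed
qed

end

section \<open>Solving the recursion by binomial coefficients\<close>

lemma waring_bound_boundary: "n \<le> 1 \<or> d \<le> 1 \<Longrightarrow> waring_bound n d = (n + d) choose d"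
proof (induction n d rule: waring_bound.induct)
  case (3 n d)
  have "waring_bound (Suc n) (Suc d) = waring_bound n (Suc d) + waring_bound (Suc n) d"
    using 3(3) by auto
  also have "\<dots> = (n + Suc d choose Suc d) + (Suc n + d choose d)"
    using 3 by auto
  finally show ?case by simp
qed auto

text \<open>The defect is 1 for n = d = 0 and obeys Pascal's rule: along n = 0 or d = 0 one of the
  two summands is an undiminished boundary value, so the defect stays 1 there.\<close>

lemma waring_bound_closed_form:
  "waring_bound (Suc (Suc n)) (Suc (Suc d)) + ((n + d) choose d) = (n + d + 4) choose (Suc (Suc d))"
proof (induction "n + d" arbitrary: n d rule: less_induct)
  case less
  consider "n = 0" "d = 0" | e where "n = 0" "d = Suc e" | m where "n = Suc m" "d = 0" |
    m e where "n = Suc m" "d = Suc e"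
    by (cases n; cases d) auto
  then show ?case
  proof cases
    case 1
    then show ?thesis by (simp add: eval_nat_numeral)
  next
    case 2
    have "waring_bound 1 (Suc (Suc (Suc e))) = e + 4"
      using waring_bound_boundary[of 1 "Suc (Suc (Suc e))"] by (simp del: waring_bound.simps)
    moreover have "waring_bound (Suc (Suc 0)) (Suc (Suc e)) + 1 = (e + 4) choose (Suc (Suc e))"
      using less[of 0 e] 2 by (simp del: waring_bound.simps)
    moreover have "(e + 4) choose (Suc (Suc (Suc e))) = e + 4"
      using binomial_symmetric[of "Suc (Suc (Suc e))" "e + 4"] by simp
    ultimately show ?thesis using 2
      by (simp add: eval_nat_numeral)
  next
    case 3
    have "waring_bound (Suc (Suc (Suc m))) 1 = m + 4"
      using waring_bound_boundary[of "Suc (Suc (Suc m))" 1] by (simp del: waring_bound.simps)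
    moreover have "waring_bound (Suc (Suc m)) 2 + 1 = (m + 4) choose 2"
      using less[of m 0] 3 by (simp add: eval_nat_numeral del: waring_bound.simps)
    ultimately show ?thesis using 3 by (simp add: eval_nat_numeral)
  next
    case 4
    have "waring_bound (Suc (Suc m)) (Suc (Suc (Suc e))) + ((m + Suc e) choose Suc e) = (m + Suc e + 4) choose (Suc (Suc (Suc e)))"
      using less[of m "Suc e"] 4 by (simp del: waring_bound.simps)
    moreover have "waring_bound (Suc (Suc (Suc m))) (Suc (Suc e)) + ((Suc m + e) choose e) = (Suc m + e + 4) choose (Suc (Suc e))"
      using less[of "Suc m" e] 4 by (simp del: waring_bound.simps)
    moreover have "waring_bound (Suc (Suc (Suc m))) (Suc (Suc (Suc e))) =
        waring_bound (Suc (Suc m)) (Suc (Suc (Suc e))) + waring_bound (Suc (Suc (Suc m))) (Suc (Suc e))"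
      by simp
    moreover have "(Suc m + Suc e) choose Suc e = ((m + Suc e) choose Suc e) + ((Suc m + e) choose e)" by simp
    moreover have "(Suc m + Suc e + 4) choose (Suc (Suc (Suc e))) =
        ((m + Suc e + 4) choose (Suc (Suc (Suc e)))) + ((Suc m + e + 4) choose (Suc (Suc e)))"
    proof -
      have 1: "Suc m + Suc e + 4 = Suc (m + Suc e + 4)" "Suc m + e + 4 = m + Suc e + 4" by simp_all
      show ?thesis unfolding 1 binomial_Suc_Suc by (rule add.commute)
    qed
    ultimately show ?thesis unfolding 4 by linarith
  qed
qed

section \<open>Multivariate polynomials\<close>

text \<open>Polynomials are paired with arbitrary functions on monomials, so that evaluation at a point
  \<open>a\<close> is the pairing with \<open>monomial_value a\<close>.\<close>

definition monomial_value :: "(nat \<Rightarrow> 'a) \<Rightarrow> (nat \<Rightarrow>\<^sub>0 nat) \<Rightarrow> 'a::comm_semiring_1" where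
  "monomial_value a m = (\<Prod>i\<in>Poly_Mapping.keys m. a i ^ Poly_Mapping.lookup m i)"

definition pairing :: "((nat \<Rightarrow>\<^sub>0 nat) \<Rightarrow> 'a) \<Rightarrow> 'a::comm_semiring_1 mvpoly \<Rightarrow> 'a" where
  "pairing \<xi> p = (\<Sum>m\<in>Poly_Mapping.keys p. Poly_Mapping.lookup p m * \<xi> m)"

lemma mveval_eq_pairing: "mveval a p = pairing (monomial_value a) p"
  by (simp add: mveval_def pairing_def monomial_value_def)

lemma monomial_value_superset:
  "finite I \<Longrightarrow> Poly_Mapping.keys m \<subseteq> I \<Longrightarrow> monomial_value a m = (\<Prod>i\<in>I. a i ^ Poly_Mapping.lookup m i)"
  unfolding monomial_value_def by (rule prod.mono_neutral_left) (auto simp: in_keys_iff)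

lemma monomial_value_add: "monomial_value a (m + m') = monomial_value a m * monomial_value a m'"
proof -
  have "Poly_Mapping.keys (m + m') \<subseteq> Poly_Mapping.keys m \<union> Poly_Mapping.keys m'" by (rule keys_add)
  then show ?thesis
    by (simp add: monomial_value_superset[of "Poly_Mapping.keys m \<union> Poly_Mapping.keys m'"]
        lookup_add power_add prod.distrib)
qed

lemma monomial_value_single [simp]: "monomial_value a (Poly_Mapping.single i k) = a i ^ k"
  by (cases "k = 0") (simp_all add: monomial_value_def)

lemma monomial_value_0 [simp]: "monomial_value a 0 = 1"
  by (simp add: monomial_value_def)

lemma pairing_superset:
  "finite S \<Longrightarrow> Poly_Mapping.keys p \<subseteq> S \<Longrightarrow> pairing \<xi> p = (\<Sum>m\<in>S. Poly_Mapping.lookup p m * \<xi> m)"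
  unfolding pairing_def by (rule sum.mono_neutral_left) (auto simp: in_keys_iff)

lemma pairing_add_right: "pairing \<xi> (p + q) = pairing \<xi> p + pairing \<xi> q"
proof -
  have "Poly_Mapping.keys (p + q) \<subseteq> Poly_Mapping.keys p \<union> Poly_Mapping.keys q" by (rule keys_add)
  then show ?thesis
    by (simp add: pairing_superset[of "Poly_Mapping.keys p \<union> Poly_Mapping.keys q"]
        lookup_add algebra_simps sum.distrib)
qed

lemma pairing_0 [simp]: "pairing \<xi> 0 = 0"
  by (simp add: pairing_def)

lemma pairing_sum: "pairing \<xi> (\<Sum>i\<in>I. p i) = (\<Sum>i\<in>I. pairing \<xi> (p i))"
  by (induction I rule: infinite_finite_induct) (simp_all add: pairing_add_right)

lemma pairing_single [simp]: "pairing \<xi> (Poly_Mapping.single m c) = c * \<xi> m"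
  by (simp add: pairing_def)

lemma sum_singles: "(\<Sum>m\<in>Poly_Mapping.keys p. Poly_Mapping.single m (Poly_Mapping.lookup p m)) = p"
proof (rule poly_mapping_eqI)
  fix k
  have "Poly_Mapping.lookup (\<Sum>m\<in>Poly_Mapping.keys p. Poly_Mapping.single m (Poly_Mapping.lookup p m)) k =
      (\<Sum>m\<in>Poly_Mapping.keys p. if m = k then Poly_Mapping.lookup p k else 0)"
    unfolding lookup_sum by (intro sum.cong refl) (auto simp: lookup_single)
  also have "\<dots> = Poly_Mapping.lookup p k" by (simp add: in_keys_iff)
  finally show "Poly_Mapping.lookup (\<Sum>m\<in>Poly_Mapping.keys p. Poly_Mapping.single m (Poly_Mapping.lookup p m)) k =
    Poly_Mapping.lookup p k" .
qed

lemma mveval_sum: "mveval a (\<Sum>i\<in>I. p i) = (\<Sum>i\<in>I. mveval a (p i))"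
  by (simp add: mveval_eq_pairing pairing_sum)

lemma mveval_mult: "mveval a (p * q) = mveval a p * mveval a q"
proof -
  have "p * q = (\<Sum>m\<in>Poly_Mapping.keys p. \<Sum>m'\<in>Poly_Mapping.keys q.
      Poly_Mapping.single m (Poly_Mapping.lookup p m) * Poly_Mapping.single m' (Poly_Mapping.lookup q m'))"
    by (subst sum_singles[of p, symmetric], subst sum_singles[of q, symmetric]) (simp add: sum_product)
  also have "mveval a \<dots> = (\<Sum>m\<in>Poly_Mapping.keys p. \<Sum>m'\<in>Poly_Mapping.keys q.
      (Poly_Mapping.lookup p m * monomial_value a m) * (Poly_Mapping.lookup q m' * monomial_value a m'))"
    by (simp add: mveval_eq_pairing pairing_sum mult_single monomial_value_add algebra_simps)
  also have "\<dots> = mveval a p * mveval a q"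
    by (simp add: mveval_eq_pairing pairing_def sum_product)
  finally show ?thesis .
qed

lemma mveval_const [simp]: "mveval a (mvconst c) = c"
  by (simp add: mvconst_def mveval_eq_pairing)

lemma mveval_1 [simp]: "mveval a 1 = 1"
  using mveval_const[of a 1] by (simp add: mvconst_def)

lemma mveval_var [simp]: "mveval a (mvvar i) = a i"
  by (simp add: mvvar_def mveval_eq_pairing)

lemma mveval_power: "mveval a (p ^ n) = mveval a p ^ n"
  by (induction n) (simp_all add: mveval_mult)

lemma mveval_prod: "mveval a (\<Prod>i\<in>I. p i) = (\<Prod>i\<in>I. mveval a (p i))"
  by (induction I rule: infinite_finite_induct) (simp_all add: mveval_mult)

lemma mveval_subst: "mveval a (mvsubst s p) = mveval (\<lambda>i. mveval a (s i)) p"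
  by (simp add: mvsubst_def mveval_sum mveval_mult mveval_prod mveval_power mveval_def[of _ p])

lemma mveval_cong:
  assumes "\<And>i. i \<in> mvvars p \<Longrightarrow> a i = b i"
  shows "mveval a p = mveval b p"
proof -
  have "monomial_value a m = monomial_value b m" if "m \<in> Poly_Mapping.keys p" for m
    unfolding monomial_value_def
  proof (intro prod.cong refl)
    fix i assume "i \<in> Poly_Mapping.keys m"
    then have "a i = b i" using that by (intro assms) (auto simp: mvvars_def)
    then show "a i ^ Poly_Mapping.lookup m i = b i ^ Poly_Mapping.lookup m i" by simp
  qed
  then show ?thesis by (simp add: mveval_eq_pairing pairing_def)
qed

text \<open>Induction on the variables: with the others fixed, the sum is a polynomial in one
  variable, so the coefficient of each of its powers vanishes.\<close>

lemma monomials_independent: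
  fixes c :: "(nat \<Rightarrow>\<^sub>0 nat) \<Rightarrow> 'a::field_char_0"
  assumes "finite J" "finite S"
    and "\<And>m m'. m \<in> S \<Longrightarrow> m' \<in> S \<Longrightarrow> (\<forall>i\<in>J. Poly_Mapping.lookup m i = Poly_Mapping.lookup m' i) \<Longrightarrow> m = m'"
    and "\<And>a. (\<Sum>m\<in>S. c m * (\<Prod>i\<in>J. a i ^ Poly_Mapping.lookup m i)) = 0"
    and "m \<in> S"
  shows "c m = 0"
  using assms
proof (induction J arbitrary: S rule: finite_induct)
  case empty
  then have "S = {m}" by auto
  then show ?case using empty.prems(3) by simp
next
  case (insert j J)
  define e where "e = Poly_Mapping.lookup m j"
  define S' where "S' = {m'\<in>S. Poly_Mapping.lookup m' j = e}"
  have "(\<Sum>m\<in>S'. c m * (\<Prod>i\<in>J. a i ^ Poly_Mapping.lookup m i)) = 0" for a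
  proof -
    define w where "w m = c m * (\<Prod>i\<in>J. a i ^ Poly_Mapping.lookup m i)" for m
    define q where "q = (\<Sum>m\<in>S. monom (w m) (Poly_Mapping.lookup m j))"
    have "poly q t = 0" for t
    proof -
      have "c m * (\<Prod>i\<in>insert j J. (a(j := t)) i ^ Poly_Mapping.lookup m i) = w m * t ^ Poly_Mapping.lookup m j" for m
      proof -
        have "(\<Prod>i\<in>J. (a(j := t)) i ^ Poly_Mapping.lookup m i) = (\<Prod>i\<in>J. a i ^ Poly_Mapping.lookup m i)"
          using insert.hyps(2) by (intro prod.cong) auto
        then show ?thesis using insert.hyps by (simp add: w_def)
      qed
      then show ?thesis using insert.prems(3)[of "a(j := t)"] by (simp add: q_def poly_sum poly_monom)
    qed
    then have "q = 0" using poly_all_0_iff_0 by blast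
    then have "0 = coeff q e" by simp
    also have "\<dots> = (\<Sum>m\<in>S. if Poly_Mapping.lookup m j = e then w m else 0)"
      unfolding q_def coeff_sum by simp
    also have "\<dots> = (\<Sum>m\<in>S'. w m)"
      unfolding S'_def by (rule sum.inter_filter[symmetric]) (rule insert.prems(1))
    finally show ?thesis by (simp add: w_def)
  qed
  moreover have "finite S'" "m \<in> S'" using insert.prems by (auto simp: S'_def e_def)
  moreover have "m1 = m2" if "m1 \<in> S'" "m2 \<in> S'" "\<forall>i\<in>J. Poly_Mapping.lookup m1 i = Poly_Mapping.lookup m2 i" for m1 m2
    using insert.prems(2)[of m1 m2] that by (auto simp: S'_def)
  ultimately show ?case using insert.IH[of S'] by blast
qed

lemma mveval_eq_0_coeffs:
  fixes c :: "(nat \<Rightarrow>\<^sub>0 nat) \<Rightarrow> 'a::field_char_0"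
  assumes S: "finite S" and z: "\<And>a. (\<Sum>m\<in>S. c m * monomial_value a m) = 0" and m: "m \<in> S"
  shows "c m = 0"
proof -
  define J where "J = (\<Union>m\<in>S. Poly_Mapping.keys m)"
  have J: "finite J" using S by (simp add: J_def)
  show ?thesis
  proof (rule monomials_independent[OF J S _ _ m])
    show "(\<Sum>m\<in>S. c m * (\<Prod>i\<in>J. a i ^ Poly_Mapping.lookup m i)) = 0" for a
    proof -
      have "(\<Sum>m\<in>S. c m * (\<Prod>i\<in>J. a i ^ Poly_Mapping.lookup m i)) = (\<Sum>m\<in>S. c m * monomial_value a m)"
        by (intro sum.cong refl) (subst monomial_value_superset[OF J]; auto simp: J_def)
      then show ?thesis using z by simp
    qed
    show "m1 = m2" if "m1 \<in> S" "m2 \<in> S" "\<forall>i\<in>J. Poly_Mapping.lookup m1 i = Poly_Mapping.lookup m2 i" for m1 m2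
    proof (rule poly_mapping_eqI)
      fix i
      show "Poly_Mapping.lookup m1 i = Poly_Mapping.lookup m2 i"
      proof (cases "i \<in> J")
        case False
        then have "i \<notin> Poly_Mapping.keys m1" "i \<notin> Poly_Mapping.keys m2" using that(1,2) by (auto simp: J_def)
        then show ?thesis by (simp add: in_keys_iff)
      qed (use that in blast)
    qed
  qed
qed

lemma mvpoly_eqI:
  fixes p q :: "'a::field_char_0 mvpoly"
  assumes "\<And>a. mveval a p = mveval a q"
  shows "p = q"
proof -
  let ?S = "Poly_Mapping.keys p \<union> Poly_Mapping.keys q"
  have z: "Poly_Mapping.lookup p m - Poly_Mapping.lookup q m = 0" if "m \<in> ?S" for m
  proof (rule mveval_eq_0_coeffs[OF _ _ that])
    show "(\<Sum>m\<in>?S. (Poly_Mapping.lookup p m - Poly_Mapping.lookup q m) * monomial_value a m) = 0" for a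
      using assms[of a] by (simp add: mveval_eq_pairing pairing_superset[of ?S] algebra_simps sum_subtractf)
  qed simp
  show ?thesis
  proof (rule poly_mapping_eqI)
    fix m show "Poly_Mapping.lookup p m = Poly_Mapping.lookup q m"
      using z[of m] by (cases "m \<in> ?S") (auto simp: in_keys_iff)
  qed
qed

text \<open>Setting the variable j to 0 removes exactly the monomials that contain it. By the
  assumption the removed part is the zero function, so its coefficients vanish.\<close>

lemma not_in_mvvars:
  fixes p :: "'a::field_char_0 mvpoly"
  assumes "\<And>a t. mveval (a(j := t)) p = mveval a p"
  shows "j \<notin> mvvars p"
proof
  assume "j \<in> mvvars p"
  then obtain m where m: "m \<in> Poly_Mapping.keys p" "j \<in> Poly_Mapping.keys m" by (auto simp: mvvars_def)
  define S where "S = {m \<in> Poly_Mapping.keys p. j \<in> Poly_Mapping.keys m}"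
  have "Poly_Mapping.lookup p m = 0"
  proof (rule mveval_eq_0_coeffs[of S])
    show "finite S" "m \<in> S" using m by (simp_all add: S_def)
    fix a :: "nat \<Rightarrow> 'a"
    have split: "mveval b p = (\<Sum>m\<in>S. Poly_Mapping.lookup p m * monomial_value b m) +
        (\<Sum>m\<in>Poly_Mapping.keys p - S. Poly_Mapping.lookup p m * monomial_value b m)" for b
      unfolding mveval_eq_pairing pairing_def by (subst add.commute, rule sum.subset_diff) (auto simp: S_def)
    have 1: "monomial_value (a(j := 0)) m = 0" if "m \<in> S" for m
      using that unfolding monomial_value_def by (intro prod_zero bexI[of _ j]) (auto simp: S_def in_keys_iff power_0_left)
    have 2: "monomial_value (a(j := 0)) m = monomial_value a m" if "m \<in> Poly_Mapping.keys p - S" for m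
      using that unfolding monomial_value_def by (intro prod.cong) (auto simp: S_def)
    have "mveval (a(j := 0)) p = (\<Sum>m\<in>Poly_Mapping.keys p - S. Poly_Mapping.lookup p m * monomial_value a m)"
      unfolding split by (simp add: 1 2)
    then show "(\<Sum>m\<in>S. Poly_Mapping.lookup p m * monomial_value a m) = 0"
      using assms[of a 0] split[of a] by simp
  qed
  then show False using m(1) by (simp add: in_keys_iff)
qed

lemma lookup_mvconst_mult [simp]: "Poly_Mapping.lookup (mvconst c * p) m = c * Poly_Mapping.lookup p m"
  for c :: "'a::comm_semiring_1"
proof -
  have "mvconst c * p = mvconst c * (\<Sum>k\<in>Poly_Mapping.keys p. Poly_Mapping.single k (Poly_Mapping.lookup p k))"
    by (simp only: sum_singles)
  also have "\<dots> = (\<Sum>k\<in>Poly_Mapping.keys p. Poly_Mapping.single k (c * Poly_Mapping.lookup p k))"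
    by (simp add: sum_distrib_left mvconst_def mult_single)
  finally have "Poly_Mapping.lookup (mvconst c * p) m =
      (\<Sum>k\<in>Poly_Mapping.keys p. if k = m then c * Poly_Mapping.lookup p m else 0)"
    by (simp add: lookup_sum lookup_single when_def)
  then show ?thesis by (simp add: in_keys_iff)
qed

lemma mvconst_add: "mvconst (a + b) = mvconst a + mvconst b"
  by (simp add: mvconst_def single_add)

lemma mvconst_mult: "mvconst (a * b) = mvconst a * (mvconst b :: 'a::comm_semiring_1 mvpoly)"
  by (simp add: mvconst_def mult_single)

lemma mvconst_1 [simp]: "mvconst 1 = (1 :: 'a::comm_semiring_1 mvpoly)"
  by (simp add: mvconst_def)

lemma pairing_mvconst_mult: "pairing \<xi> (mvconst c * p) = c * pairing \<xi> p"
proof -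
  have "Poly_Mapping.keys (mvconst c * p) \<subseteq> Poly_Mapping.keys p" by (auto simp: in_keys_iff)
  then show ?thesis
    by (simp add: pairing_superset[of "Poly_Mapping.keys p"] sum_distrib_left mult.assoc)
qed

lemma vector_space_mvpoly: "vector_space (\<lambda>c p. mvconst c * (p :: 'a::field mvpoly))"
  by unfold_locales (simp_all add: mvconst_add mvconst_mult algebra_simps)

lemma vector_space_functions: "vector_space (\<lambda>(c::'a::field) (\<xi> :: 'i \<Rightarrow> 'a) m. c * \<xi> m)"
  by unfold_locales (simp_all add: fun_eq_iff algebra_simps)

text \<open>Monomials form a basis, so any linear functional on polynomials is the pairing with a
  function on monomials.\<close>

lemma pairing_separation:
  fixes v :: "'a::field mvpoly"
  assumes W: "module.subspace (\<lambda>c p. mvconst c * (p :: 'a mvpoly)) W" and v: "v \<notin> W"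
  shows "\<exists>\<xi>. (\<forall>w\<in>W. pairing \<xi> w = 0) \<and> pairing \<xi> v = 1"
proof -
  interpret vs: vector_space "\<lambda>c p. mvconst c * (p :: 'a mvpoly)" by (rule vector_space_mvpoly)
  interpret k: vector_space "(*) :: 'a \<Rightarrow> 'a \<Rightarrow> 'a" by unfold_locales (simp_all add: algebra_simps)
  interpret vp: vector_space_pair "\<lambda>c p. mvconst c * (p :: 'a mvpoly)" "(*) :: 'a \<Rightarrow> 'a \<Rightarrow> 'a" ..
  obtain B where B: "B \<subseteq> W" "vs.independent B" "W \<subseteq> vs.span B" by (rule vs.maximal_independent_subset)
  have BW: "vs.span B = W" using vs.span_minimal[OF B(1) W] B(3) by simp
  have "vs.independent (insert v B)" using B(2) v BW by (simp add: vs.independent_insertI)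
  from vp.linear_independent_extend[OF this, of "\<lambda>x. if x = v then 1 else 0"]
  obtain g where g: "Vector_Spaces.linear (\<lambda>c p. mvconst c * (p :: 'a mvpoly)) (*) g"
    "\<forall>x\<in>insert v B. g x = (if x = v then 1 else 0)" by blast
  interpret g: Vector_Spaces.linear "\<lambda>c p. mvconst c * (p :: 'a mvpoly)" "(*)" g by (rule g(1))
  have "vs.subspace {x. g x = 0}" by (auto simp: vs.subspace_def g.add g.scale g.zero)
  moreover have "B \<subseteq> {x. g x = 0}" using g(2) B(1) v by auto
  ultimately have gW: "g w = 0" if "w \<in> W" for w using that vs.span_minimal BW by blast
  define \<xi> where "\<xi> m = g (Poly_Mapping.single m 1)" for m
  have "pairing \<xi> p = g p" for p
  proof -
    have "g p = g (\<Sum>m\<in>Poly_Mapping.keys p. mvconst (Poly_Mapping.lookup p m) * Poly_Mapping.single m 1)"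
      by (subst sum_singles[of p, symmetric]) (simp add: mvconst_def mult_single)
    also have "\<dots> = pairing \<xi> p" by (simp add: g.sum g.scale pairing_def \<xi>_def)
    finally show ?thesis by simp
  qed
  then show ?thesis using gW g(2) by (intro exI[of _ \<xi>]) simp
qed

interpretation mvp: dual_pair "\<lambda>c p. mvconst c * (p :: 'a::{alg_closed_field,field_char_0} mvpoly)"
  "\<lambda>c \<xi> m. c * \<xi> m" pairing
proof (intro dual_pair.intro vspace.intro vector_space_mvpoly vector_space_functions dual_pair_axioms.intro)
  show "pairing (\<xi> + \<eta>) u = pairing \<xi> u + pairing \<eta> u" for \<xi> \<eta> and u :: "'a mvpoly"
    by (simp add: pairing_def algebra_simps sum.distrib)
  show "pairing (\<lambda>m. c * \<xi> m) u = c * pairing \<xi> u" for c \<xi> and u :: "'a mvpoly"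
    by (simp add: pairing_def algebra_simps sum_distrib_left)
qed (simp_all add: pairing_add_right pairing_mvconst_mult pairing_separation)

section \<open>Polarization of forms\<close>

context dual_pair
begin

definition polarizable :: "'b set \<Rightarrow> nat \<Rightarrow> ('x \<Rightarrow> 'a) \<Rightarrow> bool" where
  "polarizable U d f \<longleftrightarrow>
     (\<exists>F. multilinear F \<and> lives_on d F U \<and> (\<forall>\<xi>. F (replicate_mset d \<xi>) = f \<xi>))"

lemma polarizable_const: "polarizable U 0 (\<lambda>_. c)"
  unfolding polarizable_def
  by (rule exI[of _ "\<lambda>M. if M = {#} then c else 0"]) (simp add: multilinear_def lives_on_def)

lemma polarizable_add:
  assumes "polarizable U d f" "polarizable U d g"
  shows "polarizable U d (\<lambda>\<xi>. f \<xi> + g \<xi>)"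
proof -
  obtain F G where F: "multilinear F" "lives_on d F U" "\<forall>\<xi>. F (replicate_mset d \<xi>) = f \<xi>"
    and G: "multilinear G" "lives_on d G U" "\<forall>\<xi>. G (replicate_mset d \<xi>) = g \<xi>"
    using assms unfolding polarizable_def by blast
  show ?thesis
    unfolding polarizable_def
    using multilinear_plus[OF F(1) G(1)] F(2,3) G(2,3)
    by (intro exI[of _ "\<lambda>M. F M + G M"]) (auto simp: lives_on_def)
qed

lemma polarizable_scale:
  assumes "polarizable U d f"
  shows "polarizable U d (\<lambda>\<xi>. c * f \<xi>)"
proof -
  obtain F where F: "multilinear F" "lives_on d F U" "\<forall>\<xi>. F (replicate_mset d \<xi>) = f \<xi>"
    using assms unfolding polarizable_def by blast
  show ?thesis
    unfolding polarizable_def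
    using multilinear_times[OF F(1), of c] F(2,3)
    by (intro exI[of _ "\<lambda>M. c * F M"]) (auto simp: lives_on_def)
qed

lemma polarizable_sum:
  "finite I \<Longrightarrow> (\<And>i. i \<in> I \<Longrightarrow> polarizable U d (f i)) \<Longrightarrow> polarizable U d (\<lambda>\<xi>. \<Sum>i\<in>I. f i \<xi>)"
proof (induction I rule: finite_induct)
  case empty
  have "polarizable U d (\<lambda>_. 0)"
    unfolding polarizable_def by (rule exI[of _ "\<lambda>_. 0"]) (simp add: multilinear_def lives_on_def)
  then show ?case by simp
next
  case (insert i I)
  then show ?case using polarizable_add[of U d "f i" "\<lambda>\<xi>. \<Sum>i\<in>I. f i \<xi>"] by simp
qed

text \<open>Symmetrised product: one entry is fed to l and the others to F, summed over all choices
  of the entry. On the diagonal this counts the product d + 1 times.\<close>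

lemma polarizable_mult:
  assumes "polarizable U d f" and l: "l \<in> U"
  shows "polarizable U (Suc d) (\<lambda>\<xi>. pr \<xi> l * f \<xi>)"
proof -
  obtain F where F: "multilinear F" "lives_on d F U" "\<And>\<xi>. F (replicate_mset d \<xi>) = f \<xi>"
    using assms(1) unfolding polarizable_def by blast
  define G where "G M = (\<Sum>\<xi>\<in>#M. pr \<xi> l * F (M - {#\<xi>#}))" for M
  have G_add: "G (add_mset \<zeta> N) = pr \<zeta> l * F N + (\<Sum>\<xi>\<in>#N. pr \<xi> l * F (add_mset \<zeta> (N - {#\<xi>#})))" for \<zeta> N
  proof -
    have "image_mset (\<lambda>\<xi>. pr \<xi> l * F (add_mset \<zeta> N - {#\<xi>#})) N =
        image_mset (\<lambda>\<xi>. pr \<xi> l * F (add_mset \<zeta> (N - {#\<xi>#}))) N"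
      by (rule image_mset_cong) (auto simp: add_mset_remove_trivial_If)
    then show ?thesis by (simp add: G_def)
  qed
  have "multilinear G"
    unfolding multilinear_def G_add
    by (simp add: pr_simps multilinear_add[OF F(1)] multilinear_scale[OF F(1)] algebra_simps
        sum_mset.distrib sum_mset_distrib_left multiset.map_comp comp_def)
  moreover have "lives_on (Suc d) G U"
    unfolding lives_on_def
  proof (intro allI impI)
    fix \<beta> :: 'x and N :: "'x multiset" assume \<beta>: "null U \<beta>" and N: "Suc (size N) = Suc d"
    have "F (add_mset \<beta> (N - {#\<xi>#})) = 0" if "\<xi> \<in># N" for \<xi>
    proof -
      have "Suc (size (N - {#\<xi>#})) = d" using N that by (metis Suc_inject size_Suc_Diff1)
      then show ?thesis using F(2) \<beta> unfolding lives_on_def by blast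
    qed
    then have "image_mset (\<lambda>\<xi>. pr \<xi> l * F (add_mset \<beta> (N - {#\<xi>#}))) N = image_mset (\<lambda>\<xi>. 0) N"
      by (intro image_mset_cong) simp
    moreover have "pr \<beta> l = 0" using \<beta> l by (simp add: null_def)
    ultimately show "G (add_mset \<beta> N) = 0" by (simp add: G_add)
  qed
  moreover have "G (replicate_mset (Suc d) \<xi>) = of_nat (Suc d) * (pr \<xi> l * f \<xi>)" for \<xi>
    by (simp add: G_def F(3) sum_mset_replicate_mset algebra_simps)
  ultimately have "polarizable U (Suc d) (\<lambda>\<xi>. of_nat (Suc d) * (pr \<xi> l * f \<xi>))"
    unfolding polarizable_def by blast
  from polarizable_scale[OF this, of "1 / of_nat (Suc d)"] show ?thesis
    using of_nat_neq_0[of d, where 'a = 'a] by (simp del: of_nat_Suc)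
qed

lemma polarizable_power:
  "polarizable U d f \<Longrightarrow> l \<in> U \<Longrightarrow> polarizable U (e + d) (\<lambda>\<xi>. pr \<xi> l ^ e * f \<xi>)"
  by (induction e) (simp_all add: mult.assoc polarizable_mult)

lemma polarizable_prod:
  "finite I \<Longrightarrow> (\<And>i. i \<in> I \<Longrightarrow> x i \<in> U) \<Longrightarrow> polarizable U (\<Sum>i\<in>I. e i) (\<lambda>\<xi>. \<Prod>i\<in>I. pr \<xi> (x i) ^ e i)"
proof (induction I rule: finite_induct)
  case empty
  then show ?case using polarizable_const[of U 1] by simp
next
  case (insert i I)
  then show ?case
    using polarizable_power[of U "\<Sum>i\<in>I. e i" "\<lambda>\<xi>. \<Prod>i\<in>I. pr \<xi> (x i) ^ e i" "x i" "e i"] by simp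
qed

text \<open>Turns a vanishing derivative into invariance under translation, the form in which it can
  be read off from the polynomial.\<close>

lemma multilinear_invariant:
  assumes F: "multilinear F" and \<beta>: "\<And>M. Suc (size M) = d \<Longrightarrow> F (add_mset \<beta> M) = 0"
  shows "F (replicate_mset d (\<xi> + c \<odot> \<beta>)) = F (replicate_mset d \<xi>)"
proof -
  have "F (replicate_mset k (\<xi> + c \<odot> \<beta>) + M) = F (replicate_mset k \<xi> + M)" if "k + size M = d" for k M
    using that
  proof (induction k arbitrary: M)
    case (Suc k)
    have "F (replicate_mset (Suc k) (\<xi> + c \<odot> \<beta>) + M) = F (replicate_mset k (\<xi> + c \<odot> \<beta>) + add_mset \<xi> M)"
      using \<beta>[of "replicate_mset k (\<xi> + c \<odot> \<beta>) + M"] Suc.prems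
      by (simp add: multilinear_add[OF F] multilinear_scale[OF F])
    also have "\<dots> = F (replicate_mset k \<xi> + add_mset \<xi> M)" using Suc.prems by (intro Suc.IH) simp
    finally show ?case by simp
  qed simp
  from this[of d "{#}"] show ?thesis by simp
qed

end

section \<open>Linear forms and homogeneous polynomials\<close>

lemma mon_degree_eq_1: "mon_degree m = 1 \<longleftrightarrow> (\<exists>i. m = Poly_Mapping.single i 1)"
proof
  assume "mon_degree m = 1"
  then have "(\<Sum>i\<in>Poly_Mapping.keys m. Poly_Mapping.lookup m i) = 1" by (simp add: mon_degree_def)
  then obtain i where i: "i \<in> Poly_Mapping.keys m" "Poly_Mapping.lookup m i = 1"
    "\<forall>j\<in>Poly_Mapping.keys m. i \<noteq> j \<longrightarrow> Poly_Mapping.lookup m j = 0"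
    using sum_eq_1_iff[of "Poly_Mapping.keys m" "Poly_Mapping.lookup m"] by auto
  have "m = Poly_Mapping.single i 1"
  proof (rule poly_mapping_eqI)
    fix j show "Poly_Mapping.lookup m j = Poly_Mapping.lookup (Poly_Mapping.single i 1) j"
      using i(2,3) by (cases "i = j") (auto simp: lookup_single in_keys_iff)
  qed
  then show "\<exists>i. m = Poly_Mapping.single i 1" ..
qed (auto simp: mon_degree_def)

lemma linear_form_keys:
  "l \<in> forms n 1 \<Longrightarrow> Poly_Mapping.keys l \<subseteq> (\<lambda>i. Poly_Mapping.single i 1) ` {..<n}"
proof
  fix m assume l: "l \<in> forms n 1" and m: "m \<in> Poly_Mapping.keys l"
  then obtain i where i: "m = Poly_Mapping.single i 1" using mon_degree_eq_1 by (auto simp: forms_def)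
  then have "i \<in> mvvars l" unfolding mvvars_def using m by (intro UN_I[of m]) simp_all
  then show "m \<in> (\<lambda>i. Poly_Mapping.single i 1) ` {..<n}" using l i by (auto simp: forms_def)
qed

lemma pairing_linear_form:
  assumes "l \<in> forms n 1"
  shows "pairing \<xi> l = (\<Sum>i<n. linear_coord l i * \<xi> (Poly_Mapping.single i 1))"
proof -
  have inj: "inj_on (\<lambda>i. Poly_Mapping.single i (1::nat)) {..<n}"
    by (rule inj_onI) (metis keys_single one_neq_zero singleton_insert_inj_eq)
  show ?thesis
    using pairing_superset[OF _ linear_form_keys[OF assms], of \<xi>]
    by (simp add: sum.reindex[OF inj] linear_coord_def del: One_nat_def)
qed

lemma mvvar_in_forms: "i < n \<Longrightarrow> mvvar i \<in> forms n 1"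
  by (simp add: forms_def mvvar_def mvvars_def mon_degree_def)

lemma linear_form_eq_sum:
  assumes "l \<in> forms n 1"
  shows "l = (\<Sum>i<n. mvconst (linear_coord l i) * (mvvar i :: 'a::{alg_closed_field,field_char_0} mvpoly))"
  by (rule mvp.pr_ext) (simp add: pairing_linear_form[OF assms] pairing_sum pairing_mvconst_mult mvvar_def)

lemma forms_subspace: "mvp.E.subspace (forms n d :: 'a::{alg_closed_field,field_char_0} mvpoly set)"
proof (rule mvp.E.subspaceI)
  show "0 \<in> (forms n d :: 'a mvpoly set)" by (simp add: forms_def mvvars_def)
  fix p q :: "'a mvpoly" assume pq: "p \<in> forms n d" "q \<in> forms n d"
  have "Poly_Mapping.keys (p + q) \<subseteq> Poly_Mapping.keys p \<union> Poly_Mapping.keys q" by (rule keys_add)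
  then show "p + q \<in> forms n d" using pq unfolding forms_def mvvars_def by blast
next
  fix c and p :: "'a mvpoly" assume p: "p \<in> forms n d"
  have "Poly_Mapping.keys (mvconst c * p) \<subseteq> Poly_Mapping.keys p" by (auto simp: in_keys_iff)
  then show "mvconst c * p \<in> forms n d" using p unfolding forms_def mvvars_def by blast
qed

lemma forms_has_dim: "mvp.E.has_dim (forms n 1 :: 'a::{alg_closed_field,field_char_0} mvpoly set) n"
proof (induction n)
  case 0
  have "forms 0 1 = {0 :: 'a mvpoly}"
    using linear_form_keys[of _ 0] mvp.E.subspace_0[OF forms_subspace] by auto
  then show ?case unfolding mvp.E.has_dim_def by (intro exI[of _ "{}"]) (simp add: mvp.E.independent_empty)
next
  case (Suc n)
  have "mvvar n \<notin> (forms n 1 :: 'a mvpoly set)" by (auto simp: forms_def mvvars_def mvvar_def)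
  then have "mvp.E.has_dim (mvp.E.span (insert (mvvar n) (forms n 1 :: 'a mvpoly set))) (Suc n)"
    using mvp.E.has_dim_insert[OF Suc] by blast
  moreover have "mvp.E.span (insert (mvvar n) (forms n 1)) = (forms (Suc n) 1 :: 'a mvpoly set)"
  proof
    have "forms n 1 \<subseteq> (forms (Suc n) 1 :: 'a mvpoly set)" by (auto simp: forms_def)
    then show "mvp.E.span (insert (mvvar n) (forms n 1)) \<subseteq> (forms (Suc n) 1 :: 'a mvpoly set)"
      using mvvar_in_forms[of n "Suc n"] by (intro mvp.E.span_minimal forms_subspace) auto
    show "(forms (Suc n) 1 :: 'a mvpoly set) \<subseteq> mvp.E.span (insert (mvvar n) (forms n 1))"
    proof
      fix l :: "'a mvpoly" assume l: "l \<in> forms (Suc n) 1"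
      have "l = (\<Sum>i<Suc n. mvconst (linear_coord l i) * mvvar i)" by (rule linear_form_eq_sum[OF l])
      also have "\<dots> \<in> mvp.E.span (insert (mvvar n) (forms n 1))"
        by (intro mvp.E.span_sum mvp.E.span_scale mvp.E.span_base) (auto simp: less_Suc_eq intro: mvvar_in_forms simp del: One_nat_def)
      finally show "l \<in> mvp.E.span (insert (mvvar n) (forms n 1))" .
    qed
  qed
  ultimately show ?case by simp
qed

lemma form_polarizable:
  fixes F :: "'a::{alg_closed_field,field_char_0} mvpoly"
  assumes "F \<in> forms n d"
  shows "mvp.polarizable (forms n 1) d (\<lambda>\<xi>. mveval (\<lambda>i. \<xi> (Poly_Mapping.single i 1)) F)"
  unfolding mveval_def
proof (intro mvp.polarizable_sum mvp.polarizable_scale)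
  fix m assume m: "m \<in> Poly_Mapping.keys F"
  have d: "d = (\<Sum>i\<in>Poly_Mapping.keys m. Poly_Mapping.lookup m i)"
    using assms m by (auto simp: forms_def mon_degree_def)
  have "mvp.polarizable (forms n 1) (\<Sum>i\<in>Poly_Mapping.keys m. Poly_Mapping.lookup m i)
      (\<lambda>\<xi>. \<Prod>i\<in>Poly_Mapping.keys m. pairing \<xi> (mvvar i :: 'a mvpoly) ^ Poly_Mapping.lookup m i)"
    using assms m by (intro mvp.polarizable_prod mvvar_in_forms) (auto simp: forms_def mvvars_def)
  then show "mvp.polarizable (forms n 1 :: 'a mvpoly set) d
      (\<lambda>\<xi>. \<Prod>i\<in>Poly_Mapping.keys m. \<xi> (Poly_Mapping.single i 1) ^ Poly_Mapping.lookup m i)"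
    unfolding d mvvar_def pairing_single mult_1 .
qed simp

lemma linear_coord_add:
  "linear_coord (l + l' :: 'a::comm_semiring_1 mvpoly) i = linear_coord l i + linear_coord l' i"
  by (simp add: linear_coord_def lookup_add)

lemma linear_coord_scale: "linear_coord (mvconst c * (l :: 'a::comm_semiring_1 mvpoly)) i = c * linear_coord l i"
  by (simp add: linear_coord_def)

lemma mveval_scale_homogeneous:
  assumes "p \<in> forms n e"
  shows "mveval (\<lambda>i. c * a i) p = c ^ e * mveval a p"
proof -
  have "monomial_value (\<lambda>i. c * a i) m = c ^ e * monomial_value a m" if "m \<in> Poly_Mapping.keys p" for m
  proof -
    have "e = (\<Sum>i\<in>Poly_Mapping.keys m. Poly_Mapping.lookup m i)"
      using assms that by (auto simp: forms_def mon_degree_def)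
    then show ?thesis by (simp add: monomial_value_def power_mult_distrib prod.distrib power_sum)
  qed
  then show ?thesis by (simp add: mveval_eq_pairing pairing_def sum_distrib_left algebra_simps)
qed

lemma cone_fun_mveval:
  fixes p :: "'a::{alg_closed_field,field_char_0} mvpoly"
  assumes "p \<in> forms n e"
  shows "mvp.cone_fun (\<lambda>l. mveval (linear_coord l) p)"
  unfolding mvp.cone_fun_def
proof (intro conjI allI impI)
  show "polynomial_fun (\<lambda>t. mveval (linear_coord (a + mvconst t * b + mvconst (t * t) * c)) p)" for a b c
    unfolding mveval_def linear_coord_add linear_coord_scale by (intro poly_intros)
  show "mveval (linear_coord (mvconst c * u)) p = 0 \<longleftrightarrow> mveval (linear_coord u) p = 0" if "c \<noteq> 0" for c u
  proof -
    have "linear_coord (mvconst c * u) = (\<lambda>i. c * linear_coord u i)" by (rule ext) (rule linear_coord_scale)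
    then show ?thesis using that by (simp add: mveval_scale_homogeneous[OF assms])
  qed
qed

text \<open>The change of coordinates replaces the \<open>j\<close>-th basis vector by the direction \<open>b\<close>.\<close>

lemma essentially_depends_direction:
  fixes F :: "'a::field_char_0 mvpoly"
  assumes ess: "essentially_depends n F" and vars: "mvvars F \<subseteq> {..<n}"
    and inv: "\<And>a t. mveval (\<lambda>i. a i + t * b i) F = mveval a F"
    and j: "j < n"
  shows "b j = 0"
proof (rule ccontr)
  assume bj: "b j \<noteq> 0"
  define A where "A = mat n n (\<lambda>(i, k). if k = j then b i else if i = k then 1 else 0)"
  define B where "B = mat n n (\<lambda>(i, k). if k = j then (if i = j then 1 / b j else - b i / b j) else if i = k then 1 else 0)"
  have AB: "A \<in> carrier_mat n n" "B \<in> carrier_mat n n" by (simp_all add: A_def B_def)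
  have "A * B = 1\<^sub>m n"
  proof (rule eq_matI)
    fix i k assume "i < dim_row (1\<^sub>m n :: 'a mat)" "k < dim_col (1\<^sub>m n :: 'a mat)"
    then have ik: "i < n" "k < n" by auto
    define B' where "B' i = (if k = j then (if i = j then 1 / b j else - b i / b j) else if i = k then 1 else 0)" for i
    have "(A * B) $$ (i, k) = (\<Sum>m<n. (if m = j then b i else if i = m then 1 else 0) * B' m)"
      using ik by (simp add: A_def B_def B'_def scalar_prod_def atLeast0LessThan)
    also have "\<dots> = (\<Sum>m<n. (if m = j then b i * B' j else 0) + (if m = i then (if i = j then 0 else B' i) else 0))"
      by (intro sum.cong) auto
    also have "\<dots> = b i * B' j + (if i = j then 0 else B' i)"
      using ik j by (simp add: sum.distrib)
    also have "\<dots> = (if i = k then 1 else 0)" using bj by (simp add: B'_def)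
    finally show "(A * B) $$ (i, k) = 1\<^sub>m n $$ (i, k)" using ik by simp
  qed (simp_all add: A_def B_def)
  moreover from this have "B * A = 1\<^sub>m n" using mat_mult_left_right_inverse[OF AB] by simp
  ultimately have inv_A: "invertible_mat A"
    unfolding invertible_mat_def inverts_mat_def using AB by auto
  define q where "q = linear_change n A F"
  \<comment> \<open>F is constant along b, so the j-th new coordinate drops out.\<close>
  have q: "mveval a q = mveval (\<lambda>i. if i = j then 0 else a i) F" for a
  proof -
    have "mveval a q = mveval (\<lambda>i. \<Sum>k<n. A $$ (i, k) * a k) F"
      by (simp add: q_def linear_change_def mveval_subst mveval_sum mveval_mult)
    also have "\<dots> = mveval (\<lambda>i. (if i = j then 0 else a i) + a j * b i) F"
    proof (rule mveval_cong)
      fix i assume "i \<in> mvvars F"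
      then have i: "i < n" using vars by auto
      have "(\<Sum>k<n. A $$ (i, k) * a k) =
          (\<Sum>k<n. (if k = j then b i * a j else 0) + (if k = i then (if i = j then 0 else a i) else 0))"
        using i by (intro sum.cong) (auto simp: A_def)
      then show "(\<Sum>k<n. A $$ (i, k) * a k) = (if i = j then 0 else a i) + a j * b i"
        using i j by (simp add: sum.distrib)
    qed
    also have "\<dots> = mveval (\<lambda>i. if i = j then 0 else a i) F" by (rule inv)
    finally show ?thesis .
  qed
  have "k \<notin> mvvars q" if k: "k \<notin> {..<n} - {j}" for k
  proof (rule not_in_mvvars)
    show "mveval (a(k := t)) q = mveval a q" for a t
      unfolding q by (rule mveval_cong) (use k vars in auto)
  qed
  then have "mvvars q \<subseteq> {..<n} - {j}" by blast
  then have "card (mvvars q) \<le> card ({..<n} - {j})" by (intro card_mono) auto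
  also have "\<dots> < n" using j by simp
  finally show False using ess inv_A AB(1) unfolding essentially_depends_def q_def by blast
qed

text \<open>A direction that kills the polarization leaves F invariant along its coordinate vector
  b; essential dependence on n variables gives b = 0, so the support is the whole space of linear
  forms.\<close>

lemma form_polarization:
  fixes F :: "'a::{alg_closed_field,field_char_0} mvpoly"
  assumes F: "F \<in> forms n d" and ess: "essentially_depends n F"
  obtains \<Phi> where "mvp.multilinear \<Phi>" "mvp.has_support d \<Phi> (forms n 1)"
    "\<And>a. \<Phi> (replicate_mset d (monomial_value a)) = mveval a F"
proof -
  obtain \<Phi> where \<Phi>: "mvp.multilinear \<Phi>" "mvp.lives_on d \<Phi> (forms n 1)"
    "\<And>\<xi>. \<Phi> (replicate_mset d \<xi>) = mveval (\<lambda>i. \<xi> (Poly_Mapping.single i 1)) F"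
    using form_polarizable[OF F] unfolding mvp.polarizable_def by blast
  have "mvp.has_support d \<Phi> (forms n 1)"
    unfolding mvp.has_support_def
  proof (intro allI iffI)
    fix \<beta> :: "(nat \<Rightarrow>\<^sub>0 nat) \<Rightarrow> 'a"
    assume \<beta>: "\<forall>M. Suc (size M) = d \<longrightarrow> \<Phi> (add_mset \<beta> M) = 0"
    define b where "b i = \<beta> (Poly_Mapping.single i 1)" for i
    have "mveval (\<lambda>i. a i + t * b i) F = mveval a F" for a t
      using mvp.multilinear_invariant[OF \<Phi>(1), of d \<beta> "monomial_value a" t] \<beta>
      unfolding \<Phi>(3) by (simp add: b_def)
    then have "b i = 0" if "i < n" for i
      using essentially_depends_direction[OF ess _ _ that] F by (auto simp: forms_def)
    then show "mvp.null (forms n 1) \<beta>"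
      unfolding mvp.null_def using pairing_linear_form[of _ n \<beta>] by (simp add: b_def)
  next
    fix \<beta> :: "(nat \<Rightarrow>\<^sub>0 nat) \<Rightarrow> 'a" and M
    assume "mvp.null (forms n 1) \<beta>"
    then show "Suc (size M) = d \<longrightarrow> \<Phi> (add_mset \<beta> M) = 0"
      using \<Phi>(2) by (simp add: mvp.lives_on_def)
  qed
  moreover have "\<Phi> (replicate_mset d (monomial_value a)) = mveval a F" for a
    using \<Phi>(3)[of "monomial_value a"] by simp
  ultimately show ?thesis using that \<Phi>(1) by blast
qed

section \<open>From polarized forms to the open Waring rank\<close>

lemma Ork_avoiding_le:
  fixes F :: "'a::{alg_closed_field,field_char_0} mvpoly"
  assumes F: "F \<in> forms (Suc n) (Suc d)" "essentially_depends (Suc n) F"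
    and V: "V \<subset> forms (Suc n) 1" "homogeneous_closed (Suc n) V"
  shows "Ork_avoiding (Suc n) (Suc d) F V \<le> enat (waring_bound n d)"
proof -
  obtain P where P: "P \<subseteq> (\<Union>e. forms (Suc n) e)" "V = linear_zero_set (Suc n) P"
    using V(2) by (auto simp: homogeneous_closed_def)
  obtain l0 p where p: "l0 \<in> forms (Suc n) 1" "p \<in> P" "mveval (linear_coord l0) p \<noteq> 0"
    using V(1) unfolding P(2) linear_zero_set_def by blast
  obtain e where e: "p \<in> forms (Suc n) e" using P(1) p(2) by blast
  define h where "h l = mveval (linear_coord l) p" for l :: "'a mvpoly"
  have h: "mvp.cone_fun h" unfolding h_def by (rule cone_fun_mveval[OF e])
  have hV: "l \<notin> V" if "h l \<noteq> 0" for l using that p(2) by (auto simp: P(2) linear_zero_set_def h_def)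
  obtain \<Phi> where \<Phi>: "mvp.multilinear \<Phi>" "mvp.has_support (Suc d) \<Phi> (forms (Suc n) 1)"
    "\<And>a. \<Phi> (replicate_mset (Suc d) (monomial_value a)) = mveval a F"
    using form_polarization[OF F] by blast
  have "mvp.waring (Suc d) {l \<in> forms (Suc n) 1. h l \<noteq> 0} (waring_bound n d) \<Phi>"
    by (rule mvp.waring_claimD[OF mvp.waring_claim_all \<Phi>(1,2) forms_has_dim h p(1)])
       (use p(3) in \<open>simp add: h_def\<close>)
  then obtain L where L: "length L \<le> waring_bound n d"
    "\<forall>(c, l)\<in>set L. c \<noteq> 0 \<and> l \<in> {l \<in> forms (Suc n) 1. h l \<noteq> 0}"
    "\<forall>M. size M = Suc d \<longrightarrow> \<Phi> M = mvp.power_sum L M"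
    unfolding mvp.waring_def by blast
  \<comment> \<open>Roots of nonzero coefficients are nonzero, so scaling by them keeps the linear
    forms off the zero set of h and hence outside V.\<close>
  have "\<exists>r. r ^ Suc d = c" for c :: 'a using nth_root_exists[of "Suc d" c] by auto
  then obtain r where r: "\<And>c :: 'a. r c ^ Suc d = c" by metis
  define l where "l i = mvconst (r (fst (L ! i))) * snd (L ! i)" for i
  have "l i \<in> forms (Suc n) 1 - V" if "i < length L" for i
  proof -
    obtain c x where cx: "L ! i = (c, x)" by (cases "L ! i")
    then have x: "c \<noteq> 0" "x \<in> forms (Suc n) 1" "h x \<noteq> 0" using L(2) nth_mem[OF that] by auto
    have "r c \<noteq> 0" using r[of c] x(1) by auto
    then have "h (l i) \<noteq> 0" using h x(3) unfolding mvp.cone_fun_def l_def cx by simp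
    moreover have "l i \<in> forms (Suc n) 1"
      unfolding l_def cx using mvp.E.subspace_scale[OF forms_subspace x(2)] by simp
    ultimately show ?thesis using hV by blast
  qed
  moreover have "F = (\<Sum>i<length L. l i ^ Suc d)"
  proof (rule mvpoly_eqI)
    fix a
    have "mveval a F = mvp.power_sum L (replicate_mset (Suc d) (monomial_value a))"
      using \<Phi>(3)[of a] L(3) by simp
    also have "\<dots> = (\<Sum>i<length L. fst (L ! i) * mveval a (snd (L ! i)) ^ Suc d)"
      unfolding mvp.power_sum_def
      by (simp add: sum_list_sum_nth atLeast0LessThan case_prod_beta mveval_eq_pairing del: replicate_mset_Suc power_Suc)
    also have "\<dots> = mveval a (\<Sum>i<length L. l i ^ Suc d)"
      by (simp add: mveval_sum mveval_power mveval_mult l_def power_mult_distrib r del: power_Suc)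
    finally show "mveval a F = mveval a (\<Sum>i<length L. l i ^ Suc d)" .
  qed
  ultimately have "Ork_avoiding (Suc n) (Suc d) F V \<le> enat (length L)"
    unfolding Ork_avoiding_def by (intro Inf_lower) blast
  also have "\<dots> \<le> enat (waring_bound n d)" using L(1) by simp
  finally show ?thesis .
qed

theorem corollary6:
  fixes n d :: nat
  assumes "n \<ge> 3" and "d \<ge> 3"
  shows "Ork TYPE('k::{alg_closed_field, field_char_0}) n d
    \<le> enat (((n + d - 2) choose (d - 1)) - ((n + d - 6) choose (d - 3)))"
proof -
  obtain m where m: "n = Suc (Suc (Suc m))"
    using le_Suc_ex[OF assms(1)] by (auto simp: numeral_3_eq_3)
  obtain e where e: "d = Suc (Suc (Suc e))"
    using le_Suc_ex[OF assms(2)] by (auto simp: numeral_3_eq_3)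
  have bound: "waring_bound (Suc (Suc m)) (Suc (Suc e)) =
      ((n + d - 2) choose (d - 1)) - ((n + d - 6) choose (d - 3))"
  proof -
    have "n + d - 2 = m + e + 4" "d - 1 = Suc (Suc e)" "n + d - 6 = m + e" "d - 3 = e"
      by (simp_all add: m e)
    then show ?thesis using waring_bound_closed_form[of m e] by (simp only:)
  qed
  have "Ork_form n d F \<le> enat (waring_bound (Suc (Suc m)) (Suc (Suc e)))"
    if F: "F \<in> forms n d" "essentially_depends n F" for F :: "'k mvpoly"
    unfolding Ork_form_def
  proof (rule Sup_least)
    fix x assume "x \<in> {Ork_avoiding n d F V | V. V \<subset> forms n 1 \<and> homogeneous_closed n V}"
    then obtain V where "x = Ork_avoiding n d F V" "V \<subset> forms n 1" "homogeneous_closed n V" by blast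
    then show "x \<le> enat (waring_bound (Suc (Suc m)) (Suc (Suc e)))"
      using Ork_avoiding_le F unfolding m e by blast
  qed
  then show ?thesis unfolding Ork_def bound by (intro Sup_least) blast
qed

end
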